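(* Let $\ell\ge1$ be an integer, and for $d\ge1$ let $G:\mathbb C^\ell\to\mathbb C^d\otimes\mathbb C^d$ be a random linear map with i.i.d. standard complex Gaussian matrix entries (Ginibre matrix). Define $\Phi_G:\mathcal M_\ell(\mathbb C)\to\mathcal M_d(\mathbb C)$ by $\Phi_G(X)=[\mathrm{Tr}_d\otimes\mathrm{id}_d](GXG^* )$ and $\Psi:\mathcal M_\ell(\mathbb C)\to\mathcal M_\ell(\mathbb C)$ by $\Psi(X)=X+(\mathrm{Tr}X)I_\ell$. Let $$Z=[\Phi_G\otimes\Psi](\omega_\ell)\in\mathcal M_{d\ell}(\mathbb C),\qquad Z_0=[\Phi_G\otimes\mathrm{id}](\omega_\ell)\in\mathcal M_{d\ell}(\mathbb C).$$ Then for all integers $n,\ell\ge1$, $$m_n^{\mathrm{ST}}(\ell)=\lim_{d\to\infty}\mathbb E\,\frac1d\mathrm{Tr}\big[(d^{-1}Z_0)(d^{-1}Z)^{n-1}\big],\qquad\text{where } m_n^{\mathrm{ST}}(\ell)=\sum_{\alpha\in\mathrm{Int}(n),\ \beta\in\mathrm{NC}(n)}\ell^{\#(\alpha^{-1}\beta)}.$$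
   Context: $\mathrm{NC}(n)$ is the set of non-crossing partitions of $[n]$ and $\mathrm{Int}(n)\subseteq\mathrm{NC}(n)$ the set of interval partitions (blocks of consecutive integers); each partition is identified with the permutation in $\mathcal S_n$ whose cycles are its blocks with elements in increasing order. $\#\sigma$ is the number of cycles of a permutation. For a fixed orthonormal basis $(e_i)$ of $\mathbb C^\ell$, $\Omega_\ell=\sum_i e_i\otimes e_i$ and $\omega_\ell=\Omega_\ell\Omega_\ell^*\in\mathcal M_{\ell^2}(\mathbb C)$. $\mathrm{Tr}_d\otimes\mathrm{id}_d$ is the partial trace over the first tensor factor of $\mathbb C^d\otimes\mathbb C^d$. *)

theory Defs
  imports
    "HOL-Probability.Probability"
    "HOL-Combinatorics.Cycles"
    "HOL-Combinatorics.Orbits"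
    "Jordan_Normal_Form.Schur_Decomposition"
begin

unbundle no vec_syntax

section \<open>Non-crossing and interval partitions, and the permutations they encode\<close>

definition noncrossing_partitions :: "nat \<Rightarrow> nat set set set" where
  "noncrossing_partitions n = {P. partition_on {1..n} P \<and>
     (\<forall>B\<in>P. \<forall>C\<in>P. B \<noteq> C \<longrightarrow>
        \<not> (\<exists>a b c d. a < b \<and> b < c \<and> c < d \<and> a \<in> B \<and> c \<in> B \<and> b \<in> C \<and> d \<in> C))}"

definition interval_partitions :: "nat \<Rightarrow> nat set set set" where
  "interval_partitions n = {P. partition_on {1..n} P \<and> (\<forall>B\<in>P. \<exists>a b. B = {a..b})}"

definition partition_perm :: "nat set set \<Rightarrow> nat \<Rightarrow> nat" where
  "partition_perm P x =
     (if x \<in> \<Union>P then cycle_of_list (sorted_list_of_set (THE B. B \<in> P \<and> x \<in> B)) x else x)"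

text \<open>Fixed points are counted as cycles.\<close>

definition num_cycles :: "nat \<Rightarrow> (nat \<Rightarrow> nat) \<Rightarrow> nat" where
  "num_cycles n \<sigma> = card ((\<lambda>x. orbit \<sigma> x) ` {1..n})"

definition m_ST :: "nat \<Rightarrow> nat \<Rightarrow> nat" where
  "m_ST n l = (\<Sum>\<alpha>\<in>interval_partitions n. \<Sum>\<beta>\<in>noncrossing_partitions n.
     l ^ num_cycles n (inv_into UNIV (partition_perm \<alpha>) \<circ> partition_perm \<beta>))"

section \<open>Matrices and linear maps on tensor products\<close>

text \<open>Throughout, the tensor product of spaces of dimensions \<open>p\<close> and \<open>q\<close> is identified with the
  space of dimension \<open>p * q\<close> so that the tensor product of the \<open>i\<close>-th and the \<open>j\<close>-th standard
  basis vectors is the standard basis vector of index \<open>i * q + j\<close> (indices start at 0).\<close>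

definition mat_trace :: "complex mat \<Rightarrow> complex" where
  "mat_trace A = (\<Sum>i<dim_row A. A $$ (i, i))"

definition tensor_vec :: "complex vec \<Rightarrow> complex vec \<Rightarrow> complex vec" where
  "tensor_vec u v = vec (dim_vec u * dim_vec v)
     (\<lambda>k. u $ (k div dim_vec v) * v $ (k mod dim_vec v))"

definition tensor_mat :: "complex mat \<Rightarrow> complex mat \<Rightarrow> complex mat" where
  "tensor_mat A B = mat (dim_row A * dim_row B) (dim_col A * dim_col B)
     (\<lambda>(r, s). A $$ (r div dim_row B, s div dim_col B) * B $$ (r mod dim_row B, s mod dim_col B))"

definition partial_trace_fst :: "nat \<Rightarrow> nat \<Rightarrow> complex mat \<Rightarrow> complex mat" where
  "partial_trace_fst p q X = mat q q (\<lambda>(b, c). \<Sum>a<p. X $$ (a * q + b, a * q + c))"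

definition matrix_unit :: "nat \<Rightarrow> nat \<Rightarrow> nat \<Rightarrow> complex mat" where
  "matrix_unit n i j = mat n n (\<lambda>(r, s). if r = i \<and> s = j then 1 else 0)"

text \<open>For linear maps \<open>F\<close> from \<open>p\<close>-by-\<open>p\<close> to \<open>p'\<close>-by-\<open>p'\<close> matrices and \<open>H\<close> from \<open>q\<close>-by-\<open>q\<close> to
  \<open>q'\<close>-by-\<open>q'\<close> matrices, this is the linear map sending every \<open>tensor_mat A B\<close> to
  \<open>tensor_mat (F A) (H B)\<close>, written out by expanding \<open>X\<close> in tensor products of matrix units.\<close>

definition tensor_map ::
  "nat \<Rightarrow> nat \<Rightarrow> (complex mat \<Rightarrow> complex mat) \<Rightarrow> nat \<Rightarrow> nat \<Rightarrow> (complex mat \<Rightarrow> complex mat)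
     \<Rightarrow> complex mat \<Rightarrow> complex mat" where
  "tensor_map p p' F q q' H X = mat (p' * q') (p' * q')
     (\<lambda>rs. \<Sum>i<p. \<Sum>j<p. \<Sum>a<q. \<Sum>b<q. X $$ (i * q + a, j * q + b) *
        tensor_mat (F (matrix_unit p i j)) (H (matrix_unit q a b)) $$ rs)"

text \<open>\<open>l\<close> orthonormal vectors in the \<open>l\<close>-dimensional space, hence a basis.\<close>

definition orthonormal_basis :: "nat \<Rightarrow> (nat \<Rightarrow> complex vec) \<Rightarrow> bool" where
  "orthonormal_basis l e \<longleftrightarrow> (\<forall>i<l. e i \<in> carrier_vec l) \<and>
     (\<forall>i<l. \<forall>j<l. e i \<bullet>c e j = (if i = j then 1 else 0))"

definition Omega_vec :: "nat \<Rightarrow> (nat \<Rightarrow> complex vec) \<Rightarrow> complex vec" where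
  "Omega_vec l e = vec (l * l) (\<lambda>k. \<Sum>i<l. tensor_vec (e i) (e i) $ k)"

definition omega_mat :: "nat \<Rightarrow> (nat \<Rightarrow> complex vec) \<Rightarrow> complex mat" where
  "omega_mat l e = mat (l * l) (l * l) (\<lambda>(r, s). Omega_vec l e $ r * cnj (Omega_vec l e $ s))"

definition Phi :: "nat \<Rightarrow> complex mat \<Rightarrow> complex mat \<Rightarrow> complex mat" where
  "Phi d G X = partial_trace_fst d d (G * X * mat_adjoint G)"

definition Psi :: "nat \<Rightarrow> complex mat \<Rightarrow> complex mat" where
  "Psi l X = X + mat_trace X \<cdot>\<^sub>m 1\<^sub>m l"

definition Z_mat :: "nat \<Rightarrow> (nat \<Rightarrow> complex vec) \<Rightarrow> nat \<Rightarrow> complex mat \<Rightarrow> complex mat" where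
  "Z_mat l e d G = tensor_map l d (Phi d G) l l (Psi l) (omega_mat l e)"

definition Z0_mat :: "nat \<Rightarrow> (nat \<Rightarrow> complex vec) \<Rightarrow> nat \<Rightarrow> complex mat \<Rightarrow> complex mat" where
  "Z0_mat l e d G = tensor_map l d (Phi d G) l l id (omega_mat l e)"

section \<open>Ginibre matrices\<close>

context prob_space
begin

text \<open>Independent real and imaginary parts of variance \<open>1/2\<close>, so that the expectation of
  the squared modulus is \<open>1\<close>.\<close>

definition std_complex_gaussian :: "('a \<Rightarrow> complex) \<Rightarrow> bool" where
  "std_complex_gaussian X \<longleftrightarrow>
     indep_var borel (\<lambda>\<omega>. Re (X \<omega>)) borel (\<lambda>\<omega>. Im (X \<omega>)) \<and>
     distributed M lborel (\<lambda>\<omega>. Re (X \<omega>)) (normal_density 0 (sqrt (1 / 2))) \<and>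
     distributed M lborel (\<lambda>\<omega>. Im (X \<omega>)) (normal_density 0 (sqrt (1 / 2)))"

definition ginibre :: "nat \<Rightarrow> nat \<Rightarrow> ('a \<Rightarrow> complex mat) \<Rightarrow> bool" where
  "ginibre p q G \<longleftrightarrow> (\<forall>\<omega>\<in>space M. G \<omega> \<in> carrier_mat p q) \<and>
     indep_vars (\<lambda>_. borel) (\<lambda>rs \<omega>. G \<omega> $$ rs) ({..<p} \<times> {..<q}) \<and>
     (\<forall>rs\<in>{..<p} \<times> {..<q}. std_complex_gaussian (\<lambda>\<omega>. G \<omega> $$ rs))"

end

end

theory Submission
  imports Defs
begin

text \<open>Write \<open>S = \<Sum>i. e\<^sub>i e\<^sub>i\<^sup>T\<close>, a symmetric unitary matrix. Conjugation by the tensor product of the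
  identity and \<open>S\<close> replaces the basis \<open>e\<close> by the standard one, after which \<open>Z = Z\<^sub>0 + B \<otimes> 1\<close> with \<open>B\<close>
  a partial trace of \<open>Z\<^sub>0\<close>. Expanding the trace of \<open>Z\<^sup>n\<^sup>-\<^sup>1 Z\<^sub>0\<close> over the set \<open>T\<close> of the factors at
  which \<open>Z\<^sub>0\<close> is chosen (the last factor is one of them) and summing out the indices in dimension
  \<open>l\<close> leaves products of Gram matrix entries whose indices are linked by the permutation that cycles
  through \<open>T\<close> and fixes the other points. This permutation is \<open>\<alpha>\<^sup>-\<^sup>1 \<gamma>\<close>, where \<open>\<gamma> = (1 2 \<dots> n)\<close> and \<open>\<alpha>\<close>
  is the interval partition whose blocks end at the elements of \<open>T\<close>. Wick's formula gives
  \<open>\<Sum>T. \<Sum>\<pi>. d ^ (#\<pi> + #(\<gamma> \<pi>)) * l ^ #(\<alpha>\<^sup>-\<^sup>1 \<gamma> \<pi>) / d ^ (n + 1)\<close>. With \<open>\<beta> = \<gamma> \<pi>\<close>, the exponent of \<open>d\<close> in the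
  numerator is \<open>#\<beta> + #(\<beta>\<^sup>-\<^sup>1 \<gamma>)\<close>, which is at most \<open>n + 1\<close>, with equality exactly when \<open>\<beta>\<close> is the
  permutation of a non-crossing partition.\<close>

section \<open>Cycle counts and transpositions\<close>

text \<open>\<open>Omega_vec\<close> carries no complex conjugate, so it depends on the basis. It is
  the standard vector with \<open>S\<close> applied to the second factor, and \<open>Psi\<close>
  commutes with unitary conjugation; hence \<open>Z\<close> and \<open>Z\<^sub>0\<close> are
  conjugated together and the trace forgets the basis. The factor \<open>Z\<^sub>0\<close>, moved to
  the last place by cyclicity, forces \<open>n\<close> into \<open>T\<close>. Since \<open>n\<close>
  always ends the last block, this makes the sets \<open>T\<close> correspond one-to-one to interval
  partitions.

  The expectation is computed exactly for every \<open>d\<close>, and only the last step is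
  asymptotic. The same Gaussian entry may occur several times in a product, so Wick's formula is
  needed with repeated indices; it is obtained from the mixed moments of a single variable and a
  count of matching permutations. Of the \<open>n + 1\<close> powers of \<open>d\<close> in the
  denominator, \<open>n\<close> come from the scaling of the factors and one from the normalised
  trace.

  The bound on the two cycle counts is a genus inequality. It is proved by induction on
  \<open>n\<close> with transpositions, each of which changes a cycle count by exactly one, so that
  the bound and its equality case come out of the same induction.\<close>

lemma orbit_eq_iff:
  assumes "permutation f"
  shows "orbit f x = orbit f y \<longleftrightarrow> x \<in> orbit f y"
proof
  assume "orbit f x = orbit f y"
  then show "x \<in> orbit f y" using permutation_self_in_orbit[OF assms, of x] by simp
next
  assume "x \<in> orbit f y"
  then show "orbit f x = orbit f y"
    using cyclic_on_orbit'[OF assms, of y] orbit_cyclic_eq3 by metis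
qed

lemma permutes_atLeastAtMost_imp_permutation:
  "f permutes {1..n::nat} \<Longrightarrow> permutation f"
  by (auto simp: permutation_permutes)

text \<open>The transposition swaps the continuations at \<open>a\<close> and \<open>b\<close>: a
  walk along \<open>h\<close> leaves \<open>a\<close> as \<open>f\<close> leaves \<open>b\<close>,
  and conversely, so the two cycles are joined into one. Every other cycle avoids both points and is
  unchanged.\<close>

lemma orbit_comp_transpose_merge:
  assumes f: "permutation f" and ab: "b \<notin> orbit f a"
  defines "h \<equiv> f \<circ> Transposition.transpose a b"
  shows "orbit h x = (if x \<in> orbit f a \<union> orbit f b then orbit f a \<union> orbit f b else orbit f x)"
proof -
  have h: "permutation h" unfolding h_def
    by (intro permutation_compose f permutation_swap_id)
  \<comment> \<open>\<open>orbit\<close> starts with the first iterate; that a point lies in its own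
    orbit comes from \<open>permutation\<close>, that is, from bijectivity and finite
    support.\<close>
  have refl: "y \<in> orbit f y" "y \<in> orbit h y" for y
    using permutation_self_in_orbit[OF f, of y] permutation_self_in_orbit[OF h, of y] by auto
  have aNb: "a \<notin> orbit f b" using ab orbit_eq_iff[OF f] refl by metis
  have ne: "a \<noteq> b" using ab refl by auto
  have ha: "h a = f b" and hb: "h b = f a" using ne by (auto simp: h_def)
  have ho: "h y = f y" if "y \<noteq> a" "y \<noteq> b" for y
    using that by (simp add: h_def transpose_def)
  have *: "y \<in> orbit h b" if "y \<in> orbit f a" for y
    using that
  proof induction
    case base then show ?case using hb orbit.base by metis
  next
    case (step y)
    show ?case
    proof (cases "y = a")
      case True then show ?thesis using hb orbit.base by metis
    next
      case False
      have "y \<noteq> b" using step.hyps ab by auto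
      then show ?thesis using ho[OF False] step.IH orbit.step by metis
    qed
  qed
  have **: "y \<in> orbit h a" if "y \<in> orbit f b" for y
    using that
  proof induction
    case base then show ?case using ha orbit.base by metis
  next
    case (step y)
    show ?case
    proof (cases "y = b")
      case True then show ?thesis using ha orbit.base by metis
    next
      case False
      have "y \<noteq> a" using step.hyps aNb by auto
      then show ?thesis using ho False step.IH orbit.step by metis
    qed
  qed
  have eq: "orbit h a = orbit h b" using *[OF refl(1)] orbit_eq_iff[OF h] by metis
  have sup: "orbit f a \<union> orbit f b \<subseteq> orbit h a" using * ** eq by auto
  have cl: "h y \<in> orbit f a \<union> orbit f b" if "y \<in> orbit f a \<union> orbit f b" for y
    using that ha hb ho by (metis UnCI UnE orbit.base orbit.step)
  have sub: "y \<in> orbit f a \<union> orbit f b" if "y \<in> orbit h a" for y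
    using that by induction (use cl refl in blast)+
  have E: "orbit h a = orbit f a \<union> orbit f b" using sup sub by blast
  show ?thesis
  proof (cases "x \<in> orbit f a \<union> orbit f b")
    case True
    then have "orbit h x = orbit h a" using E orbit_eq_iff[OF h] by metis
    with True E show ?thesis by simp
  next
    case False
    have "orbit h x = orbit f x"
    proof (rule orbit_cong)
      show "x \<in> orbit f x" by (rule refl)
      fix s assume s: "s \<in> orbit f x"
      then have "orbit f s = orbit f x" using orbit_eq_iff[OF f] by metis
      then have "s \<noteq> a" "s \<noteq> b" using False refl by auto
      then show "h s = f s" by (rule ho)
    qed
    with False show ?thesis by simp
  qed
qed

lemma num_cycles_comp_transpose_merge:
  assumes f: "f permutes {1..n}" and a: "a \<in> {1..n}" and b: "b \<in> {1..n}" and ab: "b \<notin> orbit f a"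
  shows "Suc (num_cycles n (f \<circ> Transposition.transpose a b)) = num_cycles n f"
proof -
  have pf: "permutation f" using f by (rule permutes_atLeastAtMost_imp_permutation)
  have refl: "y \<in> orbit f y" for y using permutation_self_in_orbit[OF pf] .
  note orb = orbit_comp_transpose_merge[OF pf ab]
  let ?A = "orbit f a" and ?B = "orbit f b"
  let ?R = "orbit f ` {1..n} - {?A, ?B}"
  have AB: "?A \<noteq> ?B" using ab refl by auto
  have mem: "x \<in> ?A \<union> ?B \<longleftrightarrow> orbit f x \<in> {?A, ?B}" for x
    using orbit_eq_iff[OF pf] by auto
  have "orbit (f \<circ> Transposition.transpose a b) ` {1..n} = insert (?A \<union> ?B) ?R"
  proof (intro equalityI subsetI)
    fix Q assume "Q \<in> orbit (f \<circ> Transposition.transpose a b) ` {1..n}"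
    then show "Q \<in> insert (?A \<union> ?B) ?R" using mem orb by auto
  next
    fix Q assume "Q \<in> insert (?A \<union> ?B) ?R"
    then have "Q = ?A \<union> ?B \<or> (\<exists>x. x \<in> {1..n} \<and> Q = orbit f x \<and> x \<notin> ?A \<union> ?B)"
      unfolding mem by blast
    then consider "Q = ?A \<union> ?B" | x where "x \<in> {1..n}" "Q = orbit f x" "x \<notin> ?A \<union> ?B"
      by blast
    then show "Q \<in> orbit (f \<circ> Transposition.transpose a b) ` {1..n}"
    proof cases
      case 1
      then have "Q = orbit (f \<circ> Transposition.transpose a b) a" using orb[of a] refl by simp
      with a show ?thesis by blast
    next
      case 2
      then have "Q = orbit (f \<circ> Transposition.transpose a b) x" using orb[of x] by simp
      with 2 show ?thesis by blast
    qed
  qed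
  \<comment> \<open>If the union were among the untouched orbits, inserting it would not raise the
    cardinality.\<close>
  moreover have "?A \<union> ?B \<notin> ?R"
  proof
    assume "?A \<union> ?B \<in> ?R"
    then obtain x where x: "?A \<union> ?B = orbit f x" "orbit f x \<notin> {?A,?B}" by auto
    then have "a \<in> orbit f x" using refl by blast
    then show False using x orbit_eq_iff[OF pf] by auto
  qed
  moreover have "Suc (Suc (card ?R)) = card (orbit f ` {1..n})"
  proof -
    have "orbit f ` {1..n} = insert ?A (insert ?B ?R)" using a b by auto
    then have "card (orbit f ` {1..n}) = card (insert ?A (insert ?B ?R))" by simp
    also have "\<dots> = Suc (Suc (card ?R))" using AB by simp
    finally show ?thesis by simp
  qed
  ultimately show ?thesis by (simp add: num_cycles_def)
qed

text \<open>The least positive power of \<open>f\<close> taking \<open>b\<close> to \<open>a\<close> cuts out of the orbit a piece that is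
  stable under \<open>f \<circ> Transposition.transpose a b\<close> and misses \<open>b\<close>.\<close>

lemma orbit_comp_transpose_split:
  assumes f: "permutation f" and ab: "b \<in> orbit f a" and ne: "a \<noteq> b"
  shows "b \<notin> orbit (f \<circ> Transposition.transpose a b) a"
proof -
  define h where "h = f \<circ> Transposition.transpose a b"
  have ha: "h a = f b" using ne by (auto simp: h_def)
  have ho: "h y = f y" if "y \<noteq> a" "y \<noteq> b" for y
    using that by (simp add: h_def transpose_def)
  have "a \<in> orbit f b" using ab orbit_eq_iff[OF f] permutation_self_in_orbit[OF f] by metis
  then obtain j0 where "0 < j0 \<and> (f ^^ j0) b = a" by (auto simp: orbit_altdef)
  then obtain j where j: "0 < j \<and> (f ^^ j) b = a"
    and least: "\<And>i. 0 < i \<and> (f ^^ i) b = a \<Longrightarrow> j \<le> i"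
    using exists_least_iff[of "\<lambda>j. 0 < j \<and> (f ^^ j) b = a"] by (metis leI)
  define S where "S = (\<lambda>i. (f ^^ i) b) ` {1..j}"
  have bS: "b \<notin> S"
  proof
    assume "b \<in> S"
    then obtain i where i: "1 \<le> i" "i \<le> j" "(f ^^ i) b = b" unfolding S_def by auto
    then have "i \<noteq> j" using j ne by auto
    then have "(f ^^ j) b = (f ^^ (j - i)) ((f ^^ i) b)"
      using i by (metis comp_apply funpow_add le_add_diff_inverse2)
    then have "(f ^^ (j - i)) b = a" using i j by simp
    moreover have "0 < j - i" "j - i < j" using i \<open>i \<noteq> j\<close> by auto
    ultimately show False using least[of "j - i"] by simp
  qed
  have fb: "f b \<in> S" unfolding S_def using j by (intro image_eqI[of _ _ 1]) auto
  have cl: "h x \<in> S" if "x \<in> S" for x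
  proof (cases "x = a")
    case True then show ?thesis using ha fb by simp
  next
    case False
    obtain i where "i \<in> {1..j}" and i3: "x = (f ^^ i) b" using \<open>x \<in> S\<close> unfolding S_def by blast
    then have i: "1 \<le> i" "i \<le> j" by auto
    have "i \<noteq> j" using i3 False j by auto
    have "x \<noteq> b" using bS that by auto
    then have "h x = (f ^^ Suc i) b" using ho[OF False] i3 by simp
    then show ?thesis unfolding S_def using i \<open>i \<noteq> j\<close> by (intro image_eqI[of _ _ "Suc i"]) auto
  qed
  have "y \<in> S" if "y \<in> orbit h a" for y
    using that by induction (use ha fb cl in auto)
  then show ?thesis using bS h_def by auto
qed

text \<open>The merge count is applied to the product, which a second multiplication by the same
  transposition turns back into \<open>f\<close>.\<close>

lemma num_cycles_comp_transpose_split: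
  assumes f: "f permutes {1..n}" and a: "a \<in> {1..n}" and b: "b \<in> {1..n}"
    and ab: "b \<in> orbit f a" and ne: "a \<noteq> b"
  shows "num_cycles n (f \<circ> Transposition.transpose a b) = Suc (num_cycles n f)"
proof -
  have pf: "permutation f" using f by (rule permutes_atLeastAtMost_imp_permutation)
  have h: "f \<circ> Transposition.transpose a b permutes {1..n}"
    using f a b by (intro permutes_compose permutes_swap_id)
  have "f \<circ> Transposition.transpose a b \<circ> Transposition.transpose a b = f" by (simp add: comp_assoc)
  then show ?thesis
    using num_cycles_comp_transpose_merge[OF h a b orbit_comp_transpose_split[OF pf ab ne]] by simp
qed

lemma num_cycles_inv:
  assumes "f permutes {1..n}"
  shows "num_cycles n (inv_into UNIV f) = num_cycles n f"
  using orbit_inv_eq[OF permutes_atLeastAtMost_imp_permutation[OF assms]] by (simp add: num_cycles_def)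

text \<open>Inversion preserves orbits and exchanges left and right multiplication, so the counts
  for left multiplication follow from those for right multiplication.\<close>

lemma num_cycles_transpose_comp:
  assumes f: "f permutes {1..n}" and a: "a \<in> {1..n}" and b: "b \<in> {1..n}"
  shows "num_cycles n (Transposition.transpose a b \<circ> f) = num_cycles n (inv_into UNIV f \<circ> Transposition.transpose a b)"
proof -
  have "Transposition.transpose a b \<circ> f permutes {1..n}"
    using f a b by (intro permutes_compose permutes_swap_id)
  moreover have "inv_into UNIV (Transposition.transpose a b \<circ> f) = inv_into UNIV f \<circ> Transposition.transpose a b"
    using f by (simp add: o_inv_distrib permutes_bij)
  ultimately show ?thesis using num_cycles_inv by metis
qed

lemma num_cycles_transpose_comp_merge:
  assumes f: "f permutes {1..n}" and a: "a \<in> {1..n}" and b: "b \<in> {1..n}" and ab: "b \<notin> orbit f a"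
  shows "Suc (num_cycles n (Transposition.transpose a b \<circ> f)) = num_cycles n f"
  using num_cycles_comp_transpose_merge[OF permutes_inv[OF f] a b] ab
    num_cycles_transpose_comp[OF f a b] num_cycles_inv[OF f]
    orbit_inv_eq[OF permutes_atLeastAtMost_imp_permutation[OF f]] by simp

lemma num_cycles_transpose_comp_split:
  assumes f: "f permutes {1..n}" and a: "a \<in> {1..n}" and b: "b \<in> {1..n}"
    and ab: "b \<in> orbit f a" and ne: "a \<noteq> b"
  shows "num_cycles n (Transposition.transpose a b \<circ> f) = Suc (num_cycles n f)"
  using num_cycles_comp_transpose_split[OF permutes_inv[OF f] a b _ ne] ab
    num_cycles_transpose_comp[OF f a b] num_cycles_inv[OF f]
    orbit_inv_eq[OF permutes_atLeastAtMost_imp_permutation[OF f]] by simp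

lemma num_cycles_Suc_fixed:
  assumes f: "f permutes {1..n}"
  shows "num_cycles (Suc n) f = Suc (num_cycles n f)"
proof -
  have pf: "permutation f" using f by (rule permutes_atLeastAtMost_imp_permutation)
  have "f (Suc n) = Suc n" using permutes_not_in[OF f, of "Suc n"] by simp
  then have o: "orbit f (Suc n) = {Suc n}" using orbit_eq_singleton_iff by metis
  have "{Suc n} \<notin> orbit f ` {1..n}"
  proof
    assume "{Suc n} \<in> orbit f ` {1..n}"
    then obtain x where "x \<in> {1..n}" "orbit f x = {Suc n}" by auto
    with permutes_orbit_subset[OF f] show False by fastforce
  qed
  moreover have "{1..Suc n} = insert (Suc n) {1..n}" by auto
  ultimately show ?thesis by (simp add: num_cycles_def o)
qed

section \<open>Permutations of non-crossing partitions\<close>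

definition long_cycle :: "nat \<Rightarrow> nat \<Rightarrow> nat" where
  "long_cycle n k = (if k \<in> {1..<n} then Suc k else if k \<in> {1..n} then 1 else k)"

text \<open>This recursion lets the induction on \<open>n\<close> pass from one long cycle to the
  next by a single transposition.\<close>

lemma long_cycle_Suc:
  "1 \<le> n \<Longrightarrow> long_cycle (Suc n) = long_cycle n \<circ> Transposition.transpose n (Suc n)"
  by (auto simp: fun_eq_iff long_cycle_def Transposition.transpose_def)

lemma long_cycle_1: "long_cycle (Suc 0) = id"
  by (auto simp: fun_eq_iff long_cycle_def)

lemma long_cycle_permutes: "long_cycle n permutes {1..n}"
proof (cases "n = 0")
  case True
  then show ?thesis by (auto simp: permutes_def long_cycle_def)
next
  case False
  then have "1 \<le> n" by simp
  then show ?thesis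
  proof (induction n rule: dec_induct)
    case base
    then show ?case unfolding One_nat_def long_cycle_1 by (rule permutes_id)
  next
    case (step n)
    then have "long_cycle n permutes {1..Suc n}"
      by (intro permutes_subset[OF step.IH]) auto
    then show ?case unfolding long_cycle_Suc[OF step.hyps(1)] using step.hyps
      by (intro permutes_compose permutes_swap_id) auto
  qed
qed

section \<open>Action of a partition permutation on a block\<close>

definition next_in :: "nat set \<Rightarrow> nat \<Rightarrow> nat" where
  "next_in B x = (if \<exists>y\<in>B. x < y then Min {y \<in> B. x < y} else Min B)"

text \<open>Replaces lists by sets: when a new largest element enters a block,
  \<open>next_in\<close> changes only at the old maximum and at the new one, which is awkward to
  read off a sorted list.\<close>

lemma cycle_of_list_sorted_list_of_set:
  assumes "finite B" "x \<in> B"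
  shows "cycle_of_list (sorted_list_of_set B) x = next_in B x"
proof -
  define cs where "cs = sorted_list_of_set B"
  have d: "distinct cs" and s: "sorted_wrt (<) cs" and B: "set cs = B"
    using assms by (auto simp: cs_def strict_sorted_list_of_set)
  have len: "0 < length cs" using assms B by (cases cs) auto
  obtain i where i: "i < length cs" "x = cs ! i" using assms B by (metis in_set_conv_nth)
  have "map (cycle_of_list cs) cs = rotate1 cs" using cyclic_rotation[OF d, of 1] by simp
  then have *: "cycle_of_list cs x = cs ! (Suc i mod length cs)"
    using i nth_rotate1[OF i(1)] by (metis nth_map)
  have mono: "cs ! j < cs ! k" if "j < k" "k < length cs" for j k
    using s that by (simp add: sorted_wrt_iff_nth_less)
  show ?thesis
  proof (cases "Suc i < length cs")
    case True
    have m: "cs ! Suc i \<in> {y \<in> B. x < y}" using True mono[of i "Suc i"] i B by auto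
    have "Min {y \<in> B. x < y} = cs ! Suc i"
    proof (rule Min_eqI)
      fix y assume "y \<in> {y \<in> B. x < y}"
      then obtain k where k: "k < length cs" "y = cs ! k" "x < y" using B by (auto simp: in_set_conv_nth)
      have "i < k" using k i mono[of k i] by (metis linorder_neqE_nat order_less_asym)
      then show "cs ! Suc i \<le> y" using mono[of "Suc i" k] k by (cases "Suc i = k") auto
    qed (use assms m in auto)
    then show ?thesis using m True * by (auto simp: next_in_def cs_def)
  next
    case False
    then have l: "Suc i = length cs" using i by auto
    have no: "\<not> (\<exists>y\<in>B. x < y)"
    proof
      assume "\<exists>y\<in>B. x < y"
      then obtain k where k: "k < length cs" "x < cs ! k" using B by (auto simp: in_set_conv_nth)
      then show False using mono[of k i] i l by (cases "k = i") auto
    qed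
    have "Min B = cs ! 0"
    proof (rule Min_eqI)
      fix y assume "y \<in> B"
      then obtain k where k: "k < length cs" "y = cs ! k" using B by (auto simp: in_set_conv_nth)
      then show "cs ! 0 \<le> y" using mono[of 0 k] by (cases "k = 0") auto
    qed (use assms B len in auto)
    then show ?thesis using no l * by (auto simp: next_in_def cs_def)
  qed
qed

lemma partition_block_unique:
  assumes "partition_on A P" "B \<in> P" "C \<in> P" "x \<in> B" "x \<in> C"
  shows "B = C"
  using assms by (auto simp: partition_on_def disjoint_def)

lemma partition_block:
  assumes "partition_on {1..n::nat} P" "B \<in> P"
  shows "B \<subseteq> {1..n}" "finite B" "B \<noteq> {}" "Max B \<in> B" "Min B \<in> B"
proof -
  show B: "B \<subseteq> {1..n}" using assms by (auto simp: partition_on_def)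
  show f: "finite B" using finite_subset[OF B] by simp
  show "B \<noteq> {}" using assms by (auto simp: partition_on_def)
  then show "Max B \<in> B" "Min B \<in> B" using f by auto
qed

lemma partition_block_ex:
  assumes "partition_on A P" "x \<in> A"
  obtains B where "B \<in> P" "x \<in> B"
  using assms by (auto simp: partition_on_def)

lemma partition_perm_in:
  assumes P: "partition_on {1..n} P" "B \<in> P" "x \<in> B"
  shows "partition_perm P x = next_in B x"
proof -
  have "(THE B. B \<in> P \<and> x \<in> B) = B"
    using partition_block_unique[OF P(1)] P(2,3) by (intro the_equality) auto
  moreover have "x \<in> \<Union>P" using P by auto
  ultimately show ?thesis
    using cycle_of_list_sorted_list_of_set[OF partition_block(2)[OF P(1,2)] P(3)]
    by (simp add: partition_perm_def)
qed

lemma partition_perm_notin: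
  assumes "partition_on {1..n} P" "x \<notin> {1..n}"
  shows "partition_perm P x = x"
  using assms by (auto simp: partition_perm_def partition_on_def)

lemma next_in_mem: "finite B \<Longrightarrow> x \<in> B \<Longrightarrow> next_in B x \<in> B"
proof -
  assume a: "finite B" "x \<in> B"
  show "next_in B x \<in> B"
  proof (cases "\<exists>y\<in>B. x < y")
    case True
    then have "Min {y \<in> B. x < y} \<in> {y \<in> B. x < y}" using a by (intro Min_in) auto
    then show ?thesis using True by (simp add: next_in_def)
  next
    case False
    then show ?thesis using a by (auto simp: next_in_def intro!: Min_in)
  qed
qed

lemma next_in_Max: "finite B \<Longrightarrow> B \<noteq> {} \<Longrightarrow> next_in B (Max B) = Min B"
  by (auto simp: next_in_def dest: Max_ge)

lemma next_in_eqI: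
  assumes "finite B" "y \<in> B" "x < y" "\<And>z. z \<in> B \<Longrightarrow> x < z \<Longrightarrow> y \<le> z"
  shows "next_in B x = y"
proof -
  have "Min {y \<in> B. x < y} = y" using assms by (intro Min_eqI) auto
  then show ?thesis using assms by (auto simp: next_in_def)
qed

lemma partition_perm_permutes:
  assumes P: "partition_on {1..n} P"
  shows "partition_perm P permutes {1..n}"
proof -
  have inj: "inj_on (partition_perm P) {1..n}"
  proof (rule inj_onI)
    fix x y assume xy: "x \<in> {1..n}" "y \<in> {1..n}" "partition_perm P x = partition_perm P y"
    obtain B C where B: "B \<in> P" "x \<in> B" and C: "C \<in> P" "y \<in> C"
      using partition_block_ex[OF P] xy by metis
    have "partition_perm P x \<in> B" "partition_perm P y \<in> C"
      using partition_perm_in[OF P] next_in_mem B C partition_block(2)[OF P] by metis+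
    then have "B = C" using partition_block_unique[OF P] B C xy by metis
    have "cycle_of_list (sorted_list_of_set B) x = cycle_of_list (sorted_list_of_set B) y"
      using partition_perm_in[OF P] B C xy \<open>B = C\<close>
        cycle_of_list_sorted_list_of_set[OF partition_block(2)[OF P B(1)]] by metis
    moreover have "cycle_of_list (sorted_list_of_set B) permutes set (sorted_list_of_set B)"
      by (rule cycle_permutes)
    ultimately show "x = y" using permutes_inj by (metis injD)
  qed
  have "partition_perm P ` {1..n} \<subseteq> {1..n}"
  proof
    fix y assume "y \<in> partition_perm P ` {1..n}"
    then obtain x where x: "x \<in> {1..n}" "y = partition_perm P x" by auto
    obtain B where B: "B \<in> P" "x \<in> B" using partition_block_ex[OF P x(1)] .
    then show "y \<in> {1..n}"
      using partition_perm_in[OF P B] next_in_mem[of B x] x(2) partition_block(1,2)[OF P B(1)] by auto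
  qed
  then have "bij_betw (partition_perm P) {1..n} {1..n}"
    using inj by (simp add: bij_betw_def endo_inj_surj)
  then show ?thesis using partition_perm_notin[OF P] by (intro bij_imp_permutes) auto
qed

text \<open>Every element of the block is reached from the least one by way of its predecessor in
  the block, and the block is closed under the permutation.\<close>

lemma orbit_partition_perm:
  assumes P: "partition_on {1..n} P" and B: "B \<in> P" "x \<in> B"
  shows "orbit (partition_perm P) x = B"
proof -
  have pf: "permutation (partition_perm P)"
    using partition_perm_permutes[OF P] permutes_atLeastAtMost_imp_permutation by blast
  note pb = partition_block[OF P B(1)]
  have m: "y \<in> orbit (partition_perm P) (Min B)" if "y \<in> B" for y
    using that
  proof (induction y rule: less_induct)
    case (less y)
    show ?case
    proof (cases "y = Min B")
      case True
      then show ?thesis using permutation_self_in_orbit[OF pf] by simp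
    next
      case False
      then have "Min B < y" using Min_le[OF pb(2) less.prems] by simp
      then have ne: "{z \<in> B. z < y} \<noteq> {}" using pb(5) by blast
      \<comment> \<open>The predecessor of \<open>y\<close> in the block.\<close>
      define z where "z = Max {z \<in> B. z < y}"
      have z: "z \<in> {z \<in> B. z < y}" unfolding z_def using ne pb by (intro Max_in) auto
      have "next_in B z = y"
      proof (rule next_in_eqI)
        fix w assume w: "w \<in> B" "z < w"
        show "y \<le> w"
        proof (rule ccontr)
          assume "\<not> y \<le> w"
          then have "w \<le> z" unfolding z_def using w pb by (intro Max_ge) auto
          with w show False by simp
        qed
      qed (use z less.prems pb in auto)
      then have "partition_perm P z = y" using partition_perm_in[OF P B(1)] z by auto
      moreover have "z \<in> orbit (partition_perm P) (Min B)" using less.IH z by auto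
      ultimately show ?thesis using orbit.step by metis
    qed
  qed
  have "B \<subseteq> orbit (partition_perm P) x" using m B orbit_eq_iff[OF pf] by blast
  moreover have "y \<in> B" if "y \<in> orbit (partition_perm P) x" for y
    using that
    by induction (use partition_perm_in[OF P B(1)] next_in_mem pb B in auto)
  ultimately show ?thesis by blast
qed

text \<open>The partition is recovered from its permutation as the set of orbits.\<close>

lemma partition_perm_inject:
  assumes P: "partition_on {1..n} P" and Q: "partition_on {1..n} Q"
    and eq: "partition_perm P = partition_perm Q"
  shows "P = Q"
proof -
  have *: "R = orbit (partition_perm R) ` {1..n}" if R: "partition_on {1..n} R" for R
  proof (intro equalityI subsetI)
    fix B assume B: "B \<in> R"
    then show "B \<in> orbit (partition_perm R) ` {1..n}"
      using orbit_partition_perm[OF R B, of "Min B"] partition_block[OF R B] by blast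
  next
    fix B assume "B \<in> orbit (partition_perm R) ` {1..n}"
    then obtain x where x: "x \<in> {1..n}" "B = orbit (partition_perm R) x" by auto
    obtain C where "C \<in> R" "x \<in> C" using partition_block_ex[OF R x(1)] .
    then show "B \<in> R" using orbit_partition_perm[OF R] x by metis
  qed
  show ?thesis using *[OF P] *[OF Q] eq by simp
qed

section \<open>Removal and insertion of the largest point of a non-crossing partition\<close>

definition noncrossing :: "nat set set \<Rightarrow> bool" where
  "noncrossing P \<longleftrightarrow> (\<forall>B\<in>P. \<forall>C\<in>P. B \<noteq> C \<longrightarrow>
     \<not> (\<exists>a b c d. a < b \<and> b < c \<and> c < d \<and> a \<in> B \<and> c \<in> B \<and> b \<in> C \<and> d \<in> C))"

lemma mem_noncrossing_partitions:
  "P \<in> noncrossing_partitions n \<longleftrightarrow> partition_on {1..n} P \<and> noncrossing P"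
  by (simp add: noncrossing_partitions_def noncrossing_def)

lemma noncrossingD:
  assumes "noncrossing P" "B \<in> P" "C \<in> P" "a \<in> B" "c \<in> B" "b \<in> C" "d \<in> C" "a < b" "b < c" "c < d"
  shows "B = C"
proof (rule ccontr)
  assume "B \<noteq> C"
  then have "\<not> (\<exists>a b c d. a < b \<and> b < c \<and> c < d \<and> a \<in> B \<and> c \<in> B \<and> b \<in> C \<and> d \<in> C)"
    by (rule assms(1)[unfolded noncrossing_def, THEN bspec, THEN bspec, THEN mp, OF assms(2,3)])
  then show False using assms(4-) by blast
qed

lemma noncrossing_subset:
  assumes "noncrossing P" "R \<subseteq> P"
  shows "noncrossing R"
  unfolding noncrossing_def
proof (intro ballI impI)
  fix B C assume "B \<in> R" "C \<in> R" "B \<noteq> C"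
  then have "B \<in> P" "C \<in> P" using assms(2) by auto
  then show "\<not> (\<exists>a b c d. a < b \<and> b < c \<and> c < d \<and> a \<in> B \<and> c \<in> B \<and> b \<in> C \<and> d \<in> C)"
    by (rule assms(1)[unfolded noncrossing_def, THEN bspec, THEN bspec, THEN mp, OF _ _ \<open>B \<noteq> C\<close>])
qed

text \<open>Visibility from the right: no arc passes over the gap just after \<open>p\<close>, so a
  point placed beyond all others can be joined to \<open>p\<close> without a crossing.\<close>

definition uncovered :: "nat set set \<Rightarrow> nat \<Rightarrow> bool" where
  "uncovered P p \<longleftrightarrow> \<not> (\<exists>B\<in>P. \<exists>a\<in>B. \<exists>c\<in>B. a \<le> p \<and> p < c)"

lemma uncoveredD: "uncovered P p \<Longrightarrow> B \<in> P \<Longrightarrow> a \<in> B \<Longrightarrow> c \<in> B \<Longrightarrow> a \<le> p \<Longrightarrow> c \<le> p"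
  by (meson not_le uncovered_def)

lemma uncovered_Max:
  assumes "partition_on {1..n} P" "B \<in> P" "p \<in> B" "uncovered P p"
  shows "Max B = p"
  using partition_block[OF assms(1,2)] uncoveredD[OF assms(4,2,3)] assms(3)
  by (intro Max_eqI) auto

lemma noncrossing_partitions_insert_singleton:
  assumes "P \<in> noncrossing_partitions n"
  shows "insert {Suc n} P \<in> noncrossing_partitions (Suc n)"
proof -
  have P: "partition_on {1..n} P" "noncrossing P"
    using assms by (auto simp: mem_noncrossing_partitions)
  have sub: "B \<subseteq> {1..n}" if "B \<in> P" for B using partition_block[OF P(1) that] by simp
  have U: "\<Union>P = {1..n}" "{} \<notin> P" using P(1) by (auto simp: partition_on_def)
  have "\<Union>(insert {Suc n} P) = insert (Suc n) (\<Union>P)" by blast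
  also have "\<dots> = {1..Suc n}" unfolding U by auto
  finally have "\<Union>(insert {Suc n} P) = {1..Suc n}" .
  moreover have "C \<inter> D = {}" if CD: "C \<in> insert {Suc n} P" "D \<in> insert {Suc n} P" "C \<noteq> D" for C D
  proof -
    have N: "{Suc n} \<inter> B = {}" if "B \<in> P" for B using sub[OF that] by auto
    consider "C \<in> P" "D \<in> P" | "C = {Suc n}" "D \<in> P" | "C \<in> P" "D = {Suc n}" using CD by blast
    then show ?thesis
    proof cases
      case 1 then show ?thesis using CD P(1) by (auto simp: partition_on_def disjoint_def)
    next
      case 2 then show ?thesis using N by simp
    next
      case 3 then show ?thesis using N[of C] by blast
    qed
  qed
  ultimately have "partition_on {1..Suc n} (insert {Suc n} P)"
    using U(2) by (simp add: partition_on_def disjoint_def)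
  moreover have "noncrossing (insert {Suc n} P)"
    unfolding noncrossing_def
  proof (intro ballI impI notI)
    fix B C assume BC: "B \<in> insert {Suc n} P" "C \<in> insert {Suc n} P" "B \<noteq> C"
      and "\<exists>a b c d. a < b \<and> b < c \<and> c < d \<and> a \<in> B \<and> c \<in> B \<and> b \<in> C \<and> d \<in> C"
    then obtain a b c d where abcd: "a < b" "b < c" "c < d" "a \<in> B" "c \<in> B" "b \<in> C" "d \<in> C" by blast
    then have "B \<noteq> {Suc n}" "C \<noteq> {Suc n}" by auto
    then have "B \<in> P" "C \<in> P" using BC by auto
    then show False using noncrossingD[OF P(2)] abcd BC(3) by blast
  qed
  ultimately show ?thesis by (simp add: mem_noncrossing_partitions)
qed

text \<open>The new point exceeds all others, so in a crossing it can only be the fourth point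
  \<open>d\<close>, and only the case in which the enlarged block supplies \<open>b\<close> and
  \<open>d\<close> is new.\<close>

lemma noncrossing_partitions_insert_block:
  assumes "P \<in> noncrossing_partitions n" and B: "B \<in> P" and unc: "uncovered P (Max B)"
  shows "insert (insert (Suc n) B) (P - {B}) \<in> noncrossing_partitions (Suc n)"
proof -
  have P: "partition_on {1..n} P" "noncrossing P"
    using assms by (auto simp: mem_noncrossing_partitions)
  have sub: "C \<subseteq> {1..n}" if "C \<in> P" for C using partition_block[OF P(1) that] by simp
  have N: "Suc n \<notin> C" if "C \<in> P" for C using sub[OF that] by auto
  have dis: "C \<inter> D = {}" if "C \<in> P" "D \<in> P" "C \<noteq> D" for C D
    using P(1) that by (auto simp: partition_on_def disjoint_def)
  let ?B = "insert (Suc n) B" and ?Q = "insert (insert (Suc n) B) (P - {B})"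
  have "\<Union>P = {1..n}" using P(1) by (simp add: partition_on_def)
  have "\<Union>?Q = insert (Suc n) (\<Union>P)" using B by blast
  also have "\<dots> = {1..Suc n}" using \<open>\<Union>P = {1..n}\<close> by auto
  finally have "\<Union>?Q = {1..Suc n}" .
  moreover have "C \<inter> D = {}" if "C \<in> ?Q" "D \<in> ?Q" "C \<noteq> D" for C D
    using that dis N B by (auto 4 3)
  moreover have "{} \<notin> ?Q" using P(1) by (auto simp: partition_on_def)
  ultimately have "partition_on {1..Suc n} ?Q" by (simp add: partition_on_def disjoint_def)
  moreover have "noncrossing ?Q"
    unfolding noncrossing_def
  proof (intro ballI impI notI)
    fix C D assume CD: "C \<in> ?Q" "D \<in> ?Q" "C \<noteq> D"
      and "\<exists>a b c d. a < b \<and> b < c \<and> c < d \<and> a \<in> C \<and> c \<in> C \<and> b \<in> D \<and> d \<in> D"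
    then obtain a b c d where abcd: "a < b" "b < c" "c < d" "a \<in> C" "c \<in> C" "b \<in> D" "d \<in> D" by blast
    have "d \<le> Suc n" using abcd(7) CD(2) sub B by fastforce
    then have ne: "a \<noteq> Suc n" "b \<noteq> Suc n" "c \<noteq> Suc n" using abcd by auto
    consider "C \<in> P" "D \<in> P" | "C = ?B" "D \<in> P - {B}" | "C \<in> P - {B}" "D = ?B"
      using CD by blast
    then show False
    proof cases
      case 1
      then show False using noncrossingD[OF P(2)] abcd CD by blast
    next
      case 2
      then have "a \<in> B" "c \<in> B" using abcd ne by auto
      then have "B = D" using noncrossingD[OF P(2) B, of D a c b d] 2 abcd by auto
      then show False using 2 by auto
    next
      case 3
      \<comment> \<open>Since \<open>Max B\<close> is uncovered, \<open>c\<close> cannot lie beyond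
        it. Then \<open>Max B\<close> can take the place of \<open>d\<close>, and the crossing was
        already present in \<open>P\<close>.\<close>
      then have b: "b \<in> B" using abcd ne by auto
      have mB: "Max B \<in> B" "finite B" using partition_block[OF P(1) B] by auto
      then have "b \<le> Max B" using b by auto
      then have "c \<le> Max B" using uncoveredD[OF unc, of C a c] 3 abcd by auto
      moreover have "c \<noteq> Max B" using 3 abcd mB dis[of C B] B by auto
      ultimately have "c < Max B" by simp
      then have "C = B" using noncrossingD[OF P(2) _ B, of C a c b "Max B"] 3 abcd b mB by auto
      then show False using 3 by auto
    qed
  qed
  ultimately show ?thesis by (simp add: mem_noncrossing_partitions)
qed

text \<open>The largest point is deleted from its block \<open>C\<close>. If something remains of
  \<open>C\<close>, its maximum is uncovered: a block passing over this maximum would cross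
  \<open>C\<close>, which reaches on to \<open>Suc n\<close>.\<close>

lemma noncrossing_partitions_SucE:
  assumes "Q \<in> noncrossing_partitions (Suc n)"
  obtains P where "P \<in> noncrossing_partitions n" "Q = insert {Suc n} P"
  | P B where "P \<in> noncrossing_partitions n" "B \<in> P" "uncovered P (Max B)"
      "Q = insert (insert (Suc n) B) (P - {B})"
proof -
  have Q: "partition_on {1..Suc n} Q" "noncrossing Q"
    using assms by (auto simp: mem_noncrossing_partitions)
  have dis: "C \<inter> D = {}" if "C \<in> Q" "D \<in> Q" "C \<noteq> D" for C D
    using Q(1) that by (auto simp: partition_on_def disjoint_def)
  have UQ: "\<Union>Q = {1..Suc n}" "{} \<notin> Q" using Q(1) by (auto simp: partition_on_def)
  obtain C where C: "C \<in> Q" "Suc n \<in> C" using partition_block_ex[OF Q(1), of "Suc n"] by auto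
  have UR: "\<Union>(Q - {C}) = {1..Suc n} - C"
  proof (intro equalityI subsetI)
    fix x assume "x \<in> \<Union>(Q - {C})"
    then obtain D where "D \<in> Q" "D \<noteq> C" "x \<in> D" by blast
    then show "x \<in> {1..Suc n} - C" using dis[of D C] C UQ(1) by blast
  next
    fix x assume x: "x \<in> {1..Suc n} - C"
    then have "x \<in> \<Union>Q" using UQ(1) by simp
    then show "x \<in> \<Union>(Q - {C})" using x by blast
  qed
  have n_eq: "{1..n} = {1..Suc n} - {Suc n}" by auto
  show ?thesis
  proof (cases "C = {Suc n}")
    case True
    let ?P = "Q - {C}"
    have "\<Union>?P = {1..n}" using UR True n_eq by simp
    then have "partition_on {1..n} ?P"
      using Q(1) by (auto simp: partition_on_def disjoint_def)
    moreover have "noncrossing ?P" using noncrossing_subset[OF Q(2)] by simp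
    ultimately have "?P \<in> noncrossing_partitions n" by (simp add: mem_noncrossing_partitions)
    moreover have "Q = insert {Suc n} ?P" using C True by auto
    ultimately show ?thesis using that(1) by blast
  next
    case False
    let ?B = "C - {Suc n}"
    let ?P = "insert ?B (Q - {C})"
    have C_sub: "C \<subseteq> {1..Suc n}" using C(1) UQ by auto
    have "?B \<union> ({1..Suc n} - C) = {1..Suc n} - {Suc n}" using C C_sub by blast
    then have "\<Union>?P = {1..n}" using UR n_eq by simp
    moreover have "{} \<notin> ?P" using UQ C False by blast
    moreover have "D \<inter> E = {}" if DE: "D \<in> ?P" "E \<in> ?P" "D \<noteq> E" for D E
    proof -
      have *: "F \<inter> ?B = {}" if "F \<in> Q - {C}" for F using dis[of F C] C that by auto
      consider "D \<in> Q" "E \<in> Q" | "D = ?B" "E \<in> Q - {C}" | "D \<in> Q - {C}" "E = ?B"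
        using DE by blast
      then show ?thesis
      proof cases
        case 1 then show ?thesis using dis DE by simp
      next
        case 2 then show ?thesis using *[of E] by (simp add: Int_commute)
      next
        case 3 then show ?thesis using *[of D] by simp
      qed
    qed
    ultimately have P: "partition_on {1..n} ?P" by (simp add: partition_on_def disjoint_def)
    have B_ne: "?B \<noteq> {}" "finite ?B" using C False C_sub finite_subset[OF C_sub] by auto
    then have mB: "Max ?B \<in> ?B" by (rule Max_in[rotated])
    have "noncrossing ?P"
      unfolding noncrossing_def
    proof (intro ballI impI notI)
      fix D E assume DE: "D \<in> ?P" "E \<in> ?P" "D \<noteq> E"
        and "\<exists>a b c d. a < b \<and> b < c \<and> c < d \<and> a \<in> D \<and> c \<in> D \<and> b \<in> E \<and> d \<in> E"
      then obtain a b c d where abcd: "a < b" "b < c" "c < d" "a \<in> D" "c \<in> D" "b \<in> E" "d \<in> E" by blast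
      consider "D \<in> Q" "E \<in> Q" | "D = ?B" "E \<in> Q - {C}" | "D \<in> Q - {C}" "E = ?B"
        using DE by blast
      then show False
      proof cases
        case 1 then show False using noncrossingD[OF Q(2)] abcd DE by blast
      next
        case 2
        then have "C = E" using noncrossingD[OF Q(2) C(1), of E a c b d] abcd by auto
        then show False using 2 by auto
      next
        case 3
        then have "D = C" using noncrossingD[OF Q(2) _ C(1), of D a c b d] abcd by auto
        then show False using 3 by auto
      qed
    qed
    then have "?P \<in> noncrossing_partitions n" using P by (simp add: mem_noncrossing_partitions)
    moreover have "uncovered ?P (Max ?B)"
      unfolding uncovered_def
    proof
      assume "\<exists>D\<in>?P. \<exists>a\<in>D. \<exists>c\<in>D. a \<le> Max ?B \<and> Max ?B < c"
      then obtain D a c where D: "D \<in> ?P" "a \<in> D" "c \<in> D" "a \<le> Max ?B" "Max ?B < c" by blast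
      have "D \<noteq> ?B" using D B_ne Max_ge by (metis not_le)
      then have DQ: "D \<in> Q - {C}" using D by auto
      have "a \<noteq> Max ?B" using D DQ dis[of D C] C mB by blast
      moreover have "c < Suc n"
      proof -
        have "c \<in> \<Union>(Q - {C})" using D DQ by blast
        then have "c \<le> Suc n" "c \<notin> C" unfolding UR by auto
        then show ?thesis using C by (metis le_neq_implies_less)
      qed
      ultimately have "D = C"
        using noncrossingD[OF Q(2) _ C(1), of D a c "Max ?B" "Suc n"] D DQ C mB by auto
      then show False using DQ by auto
    qed
    \<comment> \<open>Otherwise the removal of \<open>?B\<close> from \<open>?P\<close> would also
      delete a block of \<open>Q\<close>.\<close>
    moreover have "?B \<notin> Q - {C}" using dis[OF _ C(1)] B_ne by blast
    then have "Q = insert (insert (Suc n) ?B) (?P - {?B})"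
      using C by (auto simp: insert_absorb)
    ultimately show ?thesis using that(2)[of ?P ?B] by blast
  qed
qed

text \<open>As \<open>p\<close> is uncovered, the point that follows it under \<gamma> is the least
  of its block, so the inverse of the partition permutation sends it to the greatest. That maximum
  is uncovered again: a block over it would have to start inside \<open>B\<close>, and so would
  cross \<open>B\<close>. Thus \<open>\<sigma>\<^sup>-\<^sup>1 \<gamma>\<close> maps uncovered
  points to uncovered points.\<close>

lemma long_cycle_uncovered:
  assumes "P \<in> noncrossing_partitions n" and p: "p \<in> {1..n}" "uncovered P p"
  obtains B where "B \<in> P" "long_cycle n p \<in> B" "long_cycle n p \<le> Max B"
    "inv_into UNIV (partition_perm P) (long_cycle n p) = Max B" "uncovered P (Max B)"
proof -
  have P: "partition_on {1..n} P" "noncrossing P"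
    using assms by (auto simp: mem_noncrossing_partitions)
  define m where "m = long_cycle n p"
  have m: "m \<in> {1..n}" unfolding m_def using permutes_in_image[OF long_cycle_permutes] p by blast
  obtain B where B: "B \<in> P" "m \<in> B" using partition_block_ex[OF P(1) m] .
  note pb = partition_block[OF P(1) B(1)]
  have low: "\<not> (a < m \<and> m \<le> c)" if C: "C \<in> P" "a \<in> C" "c \<in> C" for C a c
  proof
    assume a: "a < m \<and> m \<le> c"
    have "1 \<le> a" using partition_block(1)[OF P(1) C(1)] C by auto
    \<comment> \<open>The other value, \<open>m = 1\<close> for \<open>p = n\<close>, is excluded by
      \<open>1 \<le> a < m\<close>.\<close>
    then have "m = Suc p" using a p unfolding m_def long_cycle_def by (auto split: if_splits)
    then show False using uncoveredD[OF p(2) C] a by simp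
  qed
  have "Min B = m" using low[OF B(1) _ B(2)] pb B by (intro Min_eqI) (auto simp: not_less)
  then have "partition_perm P (Max B) = m"
    using partition_perm_in[OF P(1) B(1) pb(4)] next_in_Max pb by simp
  then have inv: "inv_into UNIV (partition_perm P) m = Max B"
    using partition_perm_permutes[OF P(1)] by (metis permutes_inverses(2))
  have mM: "m \<le> Max B" using pb B by simp
  have "uncovered P (Max B)"
    unfolding uncovered_def
  proof
    assume "\<exists>C\<in>P. \<exists>a\<in>C. \<exists>c\<in>C. a \<le> Max B \<and> Max B < c"
    then obtain C a c where C: "C \<in> P" "a \<in> C" "c \<in> C" "a \<le> Max B" "Max B < c" by blast
    have "C \<noteq> B" using C pb by (metis Max_ge not_le)
    then have ne: "a \<noteq> Max B" "a \<noteq> m" using partition_block_unique[OF P(1) C(1) B(1)] C(2) pb(4) B(2) by auto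
    have "m < a" using low[OF C(1-3)] C mM ne by auto
    then have "B = C" using noncrossingD[OF P(2) B(1) C(1) B(2) pb(4), of a c] C ne by auto
    with \<open>C \<noteq> B\<close> show False by simp
  qed
  then show ?thesis using that B inv mM unfolding m_def by blast
qed

text \<open>Starting from \<open>n\<close>, the map runs through the uncovered points in increasing
  order, because each is sent to the end of the block that begins right after it. Hence the points
  to which \<open>n + 1\<close> may be joined form exactly one cycle.\<close>

lemma orbit_partition_perm_long_cycle:
  assumes P: "P \<in> noncrossing_partitions n" and n: "1 \<le> n"
  shows "orbit (inv_into UNIV (partition_perm P) \<circ> long_cycle n) n = {p \<in> {1..n}. uncovered P p}"
proof -
  define f where "f = inv_into UNIV (partition_perm P) \<circ> long_cycle n"
  have part: "partition_on {1..n} P" using P by (simp add: mem_noncrossing_partitions)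
  have unc_n: "uncovered P n"
    using partition_block(1)[OF part] by (force simp: uncovered_def)
  have step: "f p \<in> {1..n} \<and> uncovered P (f p)" if p: "p \<in> {1..n}" "uncovered P p" for p
  proof -
    obtain B where B: "B \<in> P" "f p = Max B" "uncovered P (Max B)"
      using long_cycle_uncovered[OF P p] unfolding f_def by (metis comp_apply)
    then show ?thesis using partition_block(1,4)[OF part B(1)] by auto
  qed
  have sub: "p \<in> {1..n} \<and> uncovered P p" if "p \<in> orbit f n" for p
    using that by induction (use step unc_n n in auto)
  have sup: "p \<in> orbit f n" if "p \<in> {1..n}" "uncovered P p" for p
    using that
  proof (induction p rule: less_induct)
    case (less p)
    define E where "E = {q \<in> {1..n}. uncovered P q \<and> q < p}"
    \<comment> \<open>The cyclic predecessor of \<open>p\<close> among the uncovered points: before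
      the first of them stands the last one, \<open>n\<close>.\<close>
    define q where "q = (if E = {} then n else Max E)"
    have fin: "finite E" by (simp add: E_def)
    have qE: "q \<in> E" if "E \<noteq> {}" using that fin Max_in[OF fin] by (simp add: q_def)
    have q: "q \<in> {1..n}" "uncovered P q" using qE n unc_n by (cases "E = {}"; auto simp: E_def q_def)+
    obtain B where B: "B \<in> P" "f q = Max B" "uncovered P (Max B)" "long_cycle n q \<in> B"
        "long_cycle n q \<le> Max B"
      using long_cycle_uncovered[OF P q] unfolding f_def by (metis comp_apply)
    have fq: "f q \<in> {1..n}" using step q by blast
    have lc: "long_cycle n q \<le> p"
      using qE less.prems by (cases "E = {}") (auto simp: q_def E_def long_cycle_def)
    have "f q \<le> p"
      using uncoveredD[OF less.prems(2) B(1,4) partition_block(4)[OF part B(1)]] lc B(2) by simp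
    \<comment> \<open>An uncovered point below \<open>p\<close> is at most \<open>q\<close>, whereas
      \<open>f q\<close> is at least the successor of \<open>q\<close>.\<close>
    moreover have "\<not> f q < p"
    proof
      assume "f q < p"
      then have mem: "f q \<in> E" using fq B by (simp add: E_def)
      then have "q = Max E" by (auto simp: q_def)
      then have "f q \<le> q" using mem fin by simp
      moreover have "q < p" "p \<le> n" using qE mem less.prems unfolding E_def by auto
      ultimately show False using B(2,5) q(1) by (auto simp: long_cycle_def)
    qed
    ultimately have "f q = p" by simp
    moreover have "q \<in> orbit f n \<or> q = n"
      using less.IH[of q] q qE by (cases "E = {}") (auto simp: q_def E_def)
    ultimately show ?case using orbit.base orbit.step by metis
  qed
  show ?thesis using sub sup unfolding f_def by blast
qed

lemma partition_perm_insert_singleton: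
  assumes P: "P \<in> noncrossing_partitions n"
  shows "partition_perm (insert {Suc n} P) = partition_perm P"
proof
  fix x
  have part: "partition_on {1..n} P" using P by (simp add: mem_noncrossing_partitions)
  have part': "partition_on {1..Suc n} (insert {Suc n} P)"
    using noncrossing_partitions_insert_singleton[OF P] by (simp add: mem_noncrossing_partitions)
  consider "x \<in> {1..n}" | "x = Suc n" | "x \<notin> {1..Suc n}" by fastforce
  then show "partition_perm (insert {Suc n} P) x = partition_perm P x"
  proof cases
    case 1
    obtain B where B: "B \<in> P" "x \<in> B" using partition_block_ex[OF part 1] .
    then show ?thesis using partition_perm_in[OF part B] partition_perm_in[OF part', of B x] by simp
  next
    case 2
    then show ?thesis
      using partition_perm_in[OF part', of "{Suc n}" x] partition_perm_notin[OF part, of x]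
      by (simp add: next_in_def)
  next
    case 3
    then have "x \<notin> {1..n}" by auto
    then show ?thesis using partition_perm_notin[OF part', of x] partition_perm_notin[OF part, of x] 3 by simp
  qed
qed

text \<open>Right multiplication by the transposition inserts \<open>Suc n\<close> into the cycle of
  \<open>B\<close> right after \<open>Max B\<close>: the old permutation fixes \<open>Suc n\<close>,
  and \<open>Suc n\<close> inherits the image \<open>Min B\<close> of \<open>Max B\<close>.\<close>

lemma partition_perm_insert_block:
  assumes P: "P \<in> noncrossing_partitions n" and B: "B \<in> P" and unc: "uncovered P (Max B)"
  shows "partition_perm (insert (insert (Suc n) B) (P - {B}))
    = partition_perm P \<circ> Transposition.transpose (Max B) (Suc n)"
proof
  fix x
  let ?B = "insert (Suc n) B"
  let ?Q = "insert ?B (P - {B})"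
  have part: "partition_on {1..n} P" using P by (simp add: mem_noncrossing_partitions)
  have part': "partition_on {1..Suc n} ?Q"
    using noncrossing_partitions_insert_block[OF P B unc] by (simp add: mem_noncrossing_partitions)
  note pb = partition_block[OF part B]
  have BN: "y < Suc n" if "y \<in> B" for y using that pb(1) by auto
  have MB: "Max B < Suc n" using BN pb(4) by simp
  have Q: "partition_perm ?Q y = next_in ?B y" if "y \<in> ?B" for y
    using partition_perm_in[OF part', of ?B y] that by simp
  have N: "partition_perm P (Suc n) = Suc n" using partition_perm_notin[OF part] by simp
  consider "x = Suc n" | "x = Max B" | "x \<in> B" "x \<noteq> Max B" | "x \<in> {1..n}" "x \<notin> B" | "x \<notin> {1..Suc n}"
    by fastforce
  then show "partition_perm ?Q x = (partition_perm P \<circ> Transposition.transpose (Max B) (Suc n)) x"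
  proof cases
    case 1
    have "\<not> (\<exists>y\<in>?B. Suc n < y)" using BN by fastforce
    then have "next_in ?B (Suc n) = Min ?B" unfolding next_in_def by (rule if_not_P)
    also have "\<dots> = Min B" unfolding Min_insert[OF pb(2,3)] using BN[OF pb(5)] by simp
    finally show ?thesis using 1 Q partition_perm_in[OF part B pb(4)] next_in_Max pb by simp
  next
    case 2
    have "next_in ?B (Max B) = Suc n"
      using pb MB by (intro next_in_eqI) (auto simp: not_less[symmetric] dest: Max_ge)
    then show ?thesis using 2 Q pb(4) N by simp
  next
    case 3
    then have "x < Max B" using Max_ge[OF pb(2) 3(1)] 3(2) by linarith
    then have ne: "{y \<in> B. x < y} \<noteq> {}" using pb(4) by blast
    have m: "Min {y \<in> B. x < y} \<in> {y \<in> B. x < y}" using ne pb by (intro Min_in) auto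
    have "next_in B x = Min {y \<in> B. x < y}" using ne by (auto simp: next_in_def)
    moreover have "next_in ?B x = Min {y \<in> B. x < y}"
    proof (rule next_in_eqI)
      fix z assume z: "z \<in> ?B" "x < z"
      show "Min {y \<in> B. x < y} \<le> z"
      proof (cases "z = Suc n")
        case True then show ?thesis using m BN by (metis (no_types, lifting) less_imp_le mem_Collect_eq)
      next
        case False then show ?thesis using z pb by (intro Min_le) auto
      qed
    qed (use m pb in auto)
    moreover have "Transposition.transpose (Max B) (Suc n) x = x"
      using 3 BN by (intro transpose_apply_other) auto
    ultimately show ?thesis using 3 Q[of x] partition_perm_in[OF part B 3(1)] by simp
  next
    case 4
    obtain C where C: "C \<in> P" "x \<in> C" using partition_block_ex[OF part 4(1)] .
    then have "C \<in> ?Q" using 4 by auto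
    moreover have "Transposition.transpose (Max B) (Suc n) x = x"
      using 4 pb(4) by (intro transpose_apply_other) auto
    ultimately show ?thesis using partition_perm_in[OF part C] partition_perm_in[OF part' _ C(2)] by simp
  next
    case 5
    then have x: "x \<notin> {1..n}" "x \<noteq> Suc n" by auto
    moreover have "x \<noteq> Max B" using x pb by blast
    ultimately show ?thesis
      using partition_perm_notin[OF part', of x] partition_perm_notin[OF part, of x] 5 by simp
  qed
qed

text \<open>The deletion of the largest point in terms of permutations. The point \<open>p\<close>
  is pinned down as the preimage of \<open>Suc n\<close>, which lets it be identified with the point
  met in the induction on arbitrary permutations.\<close>

lemma noncrossing_partitions_perm_SucD:
  assumes Q: "Q \<in> noncrossing_partitions (Suc n)" and ne: "partition_perm Q (Suc n) \<noteq> Suc n"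
  shows "\<exists>P\<in>noncrossing_partitions n. \<exists>p\<in>{1..n}. uncovered P p \<and> partition_perm Q p = Suc n \<and>
    partition_perm Q \<circ> Transposition.transpose p (Suc n) = partition_perm P"
  using Q
proof (cases rule: noncrossing_partitions_SucE)
  case (1 P)
  have "partition_on {1..n} P" using 1 by (simp add: mem_noncrossing_partitions)
  then have "partition_perm Q (Suc n) = Suc n"
    using 1 partition_perm_insert_singleton[OF 1(1)] partition_perm_notin by simp
  with ne show ?thesis by simp
next
  case (2 P B)
  have part: "partition_on {1..n} P" using 2 by (simp add: mem_noncrossing_partitions)
  have MB: "Max B \<in> {1..n}" using partition_block(1,4)[OF part 2(2)] by blast
  have eq: "partition_perm Q = partition_perm P \<circ> Transposition.transpose (Max B) (Suc n)"
    unfolding 2(4) by (rule partition_perm_insert_block[OF 2(1-3)])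
  have "partition_perm Q (Max B) = Suc n" using eq partition_perm_notin[OF part] by simp
  moreover have "partition_perm Q \<circ> Transposition.transpose (Max B) (Suc n) = partition_perm P"
    unfolding eq by (simp add: comp_assoc)
  ultimately show ?thesis using 2 MB by blast
qed

text \<open>Induction on \<open>n\<close>: deleting \<open>n + 1\<close> from the cycle of \<open>\<sigma>\<close> in which it follows \<open>p\<close> multiplies by a
  transposition. The sum of the cycle counts attains the bound again only if \<open>p\<close> lies in the cycle
  of \<open>n\<close> under \<open>\<sigma>\<^sup>-\<^sup>1 \<gamma>\<close>, and these \<open>p\<close> are the uncovered ones, after which \<open>n + 1\<close> can be inserted
  without a crossing.\<close>

lemma num_cycles_long_cycle:
  assumes "1 \<le> n" "\<sigma> permutes {1..n}"
  shows "num_cycles n \<sigma> + num_cycles n (inv_into UNIV \<sigma> \<circ> long_cycle n) \<le> Suc n \<and>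
    (num_cycles n \<sigma> + num_cycles n (inv_into UNIV \<sigma> \<circ> long_cycle n) = Suc n \<longleftrightarrow>
      (\<exists>P\<in>noncrossing_partitions n. \<sigma> = partition_perm P))"
  using assms
proof (induction n arbitrary: \<sigma> rule: dec_induct)
  case base
  then have id: "\<sigma> = id" by (auto simp: permutes_sing)
  have "orbit id (Suc 0) = {Suc 0}" using orbit_eq_singleton_iff[of id "Suc 0"] by simp
  then have n: "num_cycles 1 id = 1" by (simp add: num_cycles_def)
  have part: "partition_on {1..1::nat} {{1}}" by (auto simp: partition_on_def)
  then have "{{1}} \<in> noncrossing_partitions 1"
    by (simp add: mem_noncrossing_partitions noncrossing_def)
  moreover have "id = partition_perm {{1}}"
    using partition_perm_permutes[OF part] by (auto simp: permutes_sing)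
  ultimately have ex: "\<exists>P\<in>noncrossing_partitions (Suc 0). id = partition_perm P"
    unfolding One_nat_def by (rule bexI[rotated])
  have inv: "inv_into UNIV id \<circ> id = (id :: nat \<Rightarrow> nat)" by (simp add: fun_eq_iff)
  show ?case
    unfolding id One_nat_def long_cycle_1 inv n[unfolded One_nat_def] by (simp only: ex) simp
next
  case (step n)
  let ?N = "Suc n"
  \<comment> \<open>For a permutation that fixes \<open>?N\<close>, passing from \<open>n\<close> to
    \<open>?N\<close> adds one fixed point to \<open>\<tau>\<close>, while in
    \<open>\<tau>\<^sup>-\<^sup>1 \<gamma>\<close> the new point is absorbed into the cycle of
    \<open>n\<close>. The sum of the counts grows by one, like the bound.\<close>
  have ext: "num_cycles ?N \<tau> = Suc (num_cycles n \<tau>)"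
      "num_cycles ?N (inv_into UNIV \<tau> \<circ> long_cycle ?N) = num_cycles n (inv_into UNIV \<tau> \<circ> long_cycle n)"
      "orbit (inv_into UNIV \<tau> \<circ> long_cycle ?N) ?N = insert ?N (orbit (inv_into UNIV \<tau> \<circ> long_cycle n) n)"
      "inv_into UNIV \<tau> \<circ> long_cycle ?N permutes {1..?N}"
    if \<tau>: "\<tau> permutes {1..n}" for \<tau>
  proof -
    let ?f = "inv_into UNIV \<tau> \<circ> long_cycle n"
    have f: "?f permutes {1..n}"
      by (intro permutes_compose long_cycle_permutes permutes_inv \<tau>)
    have eq: "inv_into UNIV \<tau> \<circ> long_cycle ?N = ?f \<circ> Transposition.transpose n ?N"
      using long_cycle_Suc[OF step.hyps(1)] by (simp add: comp_assoc)
    have f': "?f permutes {1..?N}" by (rule permutes_subset[OF f]) auto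
    have notin: "?N \<notin> orbit ?f n" using permutes_orbit_subset[OF f, of n] step.hyps by fastforce
    have pf: "permutation ?f" using f by (rule permutes_atLeastAtMost_imp_permutation)
    have "?f ?N = ?N" using permutes_not_in[OF f] by simp
    then have o: "orbit ?f ?N = {?N}" by (simp only: orbit_eq_singleton_iff)
    show "num_cycles ?N \<tau> = Suc (num_cycles n \<tau>)" by (rule num_cycles_Suc_fixed[OF \<tau>])
    show "num_cycles ?N (inv_into UNIV \<tau> \<circ> long_cycle ?N) = num_cycles n ?f"
      using num_cycles_comp_transpose_merge[OF f' _ _ notin] step.hyps num_cycles_Suc_fixed[OF f]
      unfolding eq by simp
    show "orbit (inv_into UNIV \<tau> \<circ> long_cycle ?N) ?N = insert ?N (orbit ?f n)"
      unfolding eq orbit_comp_transpose_merge[OF pf notin] o by auto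
    show "inv_into UNIV \<tau> \<circ> long_cycle ?N permutes {1..?N}"
      unfolding eq using step.hyps by (intro permutes_compose f' permutes_swap_id) auto
  qed
  show ?case
  proof (cases "\<sigma> ?N = ?N")
    case True
    have \<sigma>: "\<sigma> permutes {1..n}"
      by (rule permutes_superset[OF step.prems]) (use True in \<open>auto simp: le_Suc_eq\<close>)
    have "(\<exists>P\<in>noncrossing_partitions ?N. \<sigma> = partition_perm P)
      \<longleftrightarrow> (\<exists>P\<in>noncrossing_partitions n. \<sigma> = partition_perm P)"
    proof
      assume "\<exists>P\<in>noncrossing_partitions n. \<sigma> = partition_perm P"
      then show "\<exists>P\<in>noncrossing_partitions ?N. \<sigma> = partition_perm P"
        using noncrossing_partitions_insert_singleton partition_perm_insert_singleton by metis
    next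
      assume "\<exists>P\<in>noncrossing_partitions ?N. \<sigma> = partition_perm P"
      then obtain Q where Q: "Q \<in> noncrossing_partitions ?N" "\<sigma> = partition_perm Q" by blast
      show "\<exists>P\<in>noncrossing_partitions n. \<sigma> = partition_perm P"
        using Q(1)
      proof (cases rule: noncrossing_partitions_SucE)
        case (1 P)
        then show ?thesis using Q partition_perm_insert_singleton by metis
      next
        case (2 P B)
        have part: "partition_on {1..n} P" using 2 by (simp add: mem_noncrossing_partitions)
        note pb = partition_block[OF part 2(2)]
        have "\<sigma> ?N = Min B"
          unfolding Q(2) 2(4) partition_perm_insert_block[OF 2(1-3)]
          using partition_perm_in[OF part 2(2) pb(4)] next_in_Max pb by simp
        then show ?thesis using True pb(1,5) by auto
      qed
    qed
    then show ?thesis using step.IH[OF \<sigma>] unfolding ext(1,2)[OF \<sigma>] by linarith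
  next
    case False
    define p where "p = inv_into UNIV \<sigma> ?N"
    have \<sigma>p: "\<sigma> p = ?N" unfolding p_def using step.prems by (simp add: permutes_inverses)
    have p': "p \<in> {1..?N}" using \<sigma>p permutes_in_image[OF step.prems, of p] by simp
    then have p: "p \<in> {1..n}" "p \<noteq> ?N" using False \<sigma>p by (auto simp: le_Suc_eq)
    define \<tau> where "\<tau> = \<sigma> \<circ> Transposition.transpose p ?N"
    have \<tau>N: "\<tau> ?N = ?N" using \<sigma>p by (simp add: \<tau>_def)
    have "\<tau> permutes {1..?N}"
      unfolding \<tau>_def using p' step.prems by (intro permutes_compose permutes_swap_id) auto
    then have \<tau>: "\<tau> permutes {1..n}"
      by (rule permutes_superset) (use \<tau>N in \<open>auto simp: le_Suc_eq\<close>)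
    have \<sigma>: "\<sigma> = \<tau> \<circ> Transposition.transpose p ?N" by (simp add: \<tau>_def comp_assoc)
    have \<tau>': "\<tau> permutes {1..?N}" by (rule permutes_subset[OF \<tau>]) auto
    have "?N \<notin> orbit \<tau> p" using permutes_orbit_subset[OF \<tau> p(1)] by auto
    then have c1: "num_cycles ?N \<sigma> = num_cycles n \<tau>"
      using num_cycles_comp_transpose_merge[OF \<tau>' p', of ?N] ext(1)[OF \<tau>] unfolding \<sigma> by simp
    let ?h = "inv_into UNIV \<tau> \<circ> long_cycle ?N"
    have h: "permutation ?h"
      using ext(4)[OF \<tau>] by (rule permutes_atLeastAtMost_imp_permutation)
    have inv: "inv_into UNIV \<sigma> \<circ> long_cycle ?N = Transposition.transpose p ?N \<circ> ?h"
      unfolding \<sigma> using \<tau> by (simp add: o_inv_distrib permutes_bij comp_assoc)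
    let ?f = "inv_into UNIV \<tau> \<circ> long_cycle n"
    \<comment> \<open>\<open>?N\<close> lies in the cycle of \<open>n\<close> under
      \<open>?h\<close>; so whether left multiplication by the transposition splits or merges
      depends on whether \<open>p\<close> lies in that cycle.\<close>
    have orb: "?N \<in> orbit ?h p \<longleftrightarrow> p \<in> orbit ?f n"
      using ext(3)[OF \<tau>] orbit_eq_iff[OF h, of p ?N] orbit_eq_iff[OF h, of ?N p] p(2) by auto
    note IH = step.IH[OF \<tau>]
    show ?thesis
    proof (cases "p \<in> orbit ?f n")
      case True
      \<comment> \<open>Splitting adds one to the second count, while the first is that of
        \<open>\<tau>\<close> on \<open>n\<close> points. The sum and the bound rise together, and
        equality is passed on in both directions.\<close>
      have c2: "num_cycles ?N (inv_into UNIV \<sigma> \<circ> long_cycle ?N) = Suc (num_cycles n ?f)"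
        unfolding inv
        using num_cycles_transpose_comp_split[OF ext(4)[OF \<tau>] p', of ?N] True orb p(2) ext(2)[OF \<tau>]
        by simp
      have "(\<exists>P\<in>noncrossing_partitions ?N. \<sigma> = partition_perm P)
        \<longleftrightarrow> (\<exists>P\<in>noncrossing_partitions n. \<tau> = partition_perm P)"
      proof
        assume "\<exists>P\<in>noncrossing_partitions n. \<tau> = partition_perm P"
        then obtain P where P: "P \<in> noncrossing_partitions n" "\<tau> = partition_perm P" by blast
        have part: "partition_on {1..n} P" using P by (simp add: mem_noncrossing_partitions)
        have unc: "uncovered P p"
          using orbit_partition_perm_long_cycle[OF P(1) step.hyps(1)] True P(2) by auto
        obtain B where B: "B \<in> P" "p \<in> B" using partition_block_ex[OF part p(1)] .
        have "Max B = p" by (rule uncovered_Max[OF part B unc])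
        then show "\<exists>P\<in>noncrossing_partitions ?N. \<sigma> = partition_perm P"
          using noncrossing_partitions_insert_block[OF P(1) B(1)]
            partition_perm_insert_block[OF P(1) B(1)] unc P(2) \<sigma> by metis
      next
        assume "\<exists>P\<in>noncrossing_partitions ?N. \<sigma> = partition_perm P"
        then obtain Q where Q: "Q \<in> noncrossing_partitions ?N" "\<sigma> = partition_perm Q" by blast
        show "\<exists>P\<in>noncrossing_partitions n. \<tau> = partition_perm P"
          using noncrossing_partitions_perm_SucD[OF Q(1) False[unfolded Q(2)]]
          unfolding Q(2)[symmetric] using \<sigma>p step.prems unfolding \<tau>_def by (metis permutes_inj injD)
      qed
      then show ?thesis using IH unfolding c1 c2 by linarith
    next
      case nt: False
      \<comment> \<open>Merging leaves the sum at most \<open>n\<close>, two below the new bound, so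
        equality fails; it remains to see that no non-crossing partition gives
        \<open>\<sigma>\<close>.\<close>
      have c2: "Suc (num_cycles ?N (inv_into UNIV \<sigma> \<circ> long_cycle ?N)) = num_cycles n ?f"
        unfolding inv
        using num_cycles_transpose_comp_merge[OF ext(4)[OF \<tau>] p', of ?N] nt orb ext(2)[OF \<tau>]
        by simp
      have "\<not> (\<exists>P\<in>noncrossing_partitions ?N. \<sigma> = partition_perm P)"
      proof
        assume "\<exists>P\<in>noncrossing_partitions ?N. \<sigma> = partition_perm P"
        then obtain Q where Q: "Q \<in> noncrossing_partitions ?N" "\<sigma> = partition_perm Q" by blast
        obtain P q where P: "P \<in> noncrossing_partitions n" "q \<in> {1..n}" "uncovered P q"
            "\<sigma> q = ?N" "\<sigma> \<circ> Transposition.transpose q ?N = partition_perm P"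
          using noncrossing_partitions_perm_SucD[OF Q(1) False[unfolded Q(2)]] unfolding Q(2)[symmetric] by blast
        have "q = p" using P(4) \<sigma>p step.prems by (metis permutes_inj injD)
        then have "\<tau> = partition_perm P" using P(5) by (simp add: \<tau>_def)
        then have "p \<in> orbit ?f n"
          using orbit_partition_perm_long_cycle[OF P(1) step.hyps(1)] P(2,3) \<open>q = p\<close> by simp
        with nt show False by simp
      qed
      then show ?thesis using c1 c2 IH by linarith
    qed
  qed
qed

section \<open>Interval partitions\<close>

definition next_end :: "nat set \<Rightarrow> nat \<Rightarrow> nat" where
  "next_end T k = Min {t \<in> T. k \<le> t}"

text \<open>Taking the step by \<open>long_cycle\<close> before searching for the next end makes the
  return from \<open>n\<close> to the least element of \<open>T\<close> automatic.\<close>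

definition ends_cycle :: "nat \<Rightarrow> nat set \<Rightarrow> nat \<Rightarrow> nat" where
  "ends_cycle n T k = (if k \<in> T then next_end T (long_cycle n k) else k)"

definition interval_partition_of :: "nat \<Rightarrow> nat set \<Rightarrow> nat set set" where
  "interval_partition_of n T = (\<lambda>t. {k \<in> {1..n}. next_end T k = t}) ` T"

text \<open>The element \<open>n\<close> has two meanings: it is the end of the last block, and it
  is the position of the factor \<open>Z\<^sub>0\<close> in the trace.\<close>

definition end_sets :: "nat \<Rightarrow> nat set set" where
  "end_sets n = {T. T \<subseteq> {1..n} \<and> n \<in> T}"

lemma next_end:
  assumes "T \<in> end_sets n" "k \<le> n"
  shows "next_end T k \<in> T" "k \<le> next_end T k" "\<And>t. t \<in> T \<Longrightarrow> k \<le> t \<Longrightarrow> next_end T k \<le> t"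
proof -
  have "T \<subseteq> {1..n}" using assms by (simp add: end_sets_def)
  then have "finite T" by (rule finite_subset) simp
  then have fin: "finite {t \<in> T. k \<le> t}" by simp
  have "n \<in> {t \<in> T. k \<le> t}" using assms by (simp add: end_sets_def)
  then have "{t \<in> T. k \<le> t} \<noteq> {}" by blast
  then have "next_end T k \<in> {t \<in> T. k \<le> t}" unfolding next_end_def using fin by (rule Min_in[rotated])
  then show "next_end T k \<in> T" "k \<le> next_end T k" by auto
  show "next_end T k \<le> t" if "t \<in> T" "k \<le> t" for t
    unfolding next_end_def using fin that by (intro Min_le) auto
qed

lemma end_sets_mem: "T \<in> end_sets n \<Longrightarrow> t \<in> T \<Longrightarrow> 1 \<le> t \<and> t \<le> n"
  by (auto simp: end_sets_def)

lemma next_end_self: "T \<in> end_sets n \<Longrightarrow> t \<in> T \<Longrightarrow> next_end T t = t"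
  using next_end[of T n t] end_sets_mem[of T n t] by (intro antisym) auto

lemma interval_partition_of_block:
  assumes T: "T \<in> end_sets n" and t: "t \<in> T"
  defines "B \<equiv> {k \<in> {1..n}. next_end T k = t}"
  shows "t \<in> B" "Max B = t" "B = {Min B..t}"
proof -
  have le: "k \<le> t" if "k \<in> B" for k using next_end(2)[OF T, of k] that by (auto simp: B_def)
  show tB: "t \<in> B" using next_end_self[OF T t] end_sets_mem[OF T t] by (simp add: B_def)
  have fin: "finite B" by (simp add: B_def)
  show "Max B = t" using le tB fin by (intro Max_eqI) auto
  have mB: "Min B \<in> B" using fin tB by (intro Min_in) auto
  have "k \<in> B" if "Min B \<le> k" "k \<le> t" for k
  proof -
    have k: "1 \<le> k" "k \<le> n" using that mB end_sets_mem[OF T t] by (auto simp: B_def)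
    \<comment> \<open>\<open>next_end T\<close> is monotone and takes the value \<open>t\<close> at
      \<open>Min B\<close> and at \<open>t\<close>, hence also in between.\<close>
    have "next_end T k \<le> t" using next_end(3)[OF T k(2) t] that by simp
    moreover have "next_end T (Min B) \<le> next_end T k"
      using next_end(3)[OF T _ next_end(1)[OF T k(2)], of "Min B"] next_end(2)[OF T k(2)] that mB
      by (auto simp: B_def)
    ultimately show ?thesis using mB k by (simp add: B_def)
  qed
  moreover have "Min B \<le> k" if "k \<in> B" for k using fin that by (rule Min_le)
  ultimately show "B = {Min B..t}" using le unfolding set_eq_iff atLeastAtMost_iff by blast
qed

lemma interval_partition_of_in:
  assumes T: "T \<in> end_sets n"
  shows "interval_partition_of n T \<in> interval_partitions n"
proof -
  let ?P = "interval_partition_of n T"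
  have "\<Union>?P = {1..n}" using next_end(1)[OF T] by (auto simp: interval_partition_of_def)
  moreover have "{} \<notin> ?P"
    using interval_partition_of_block(1)[OF T] by (force simp: interval_partition_of_def)
  ultimately have "partition_on {1..n} ?P"
    unfolding partition_on_def disjoint_def by (auto simp: interval_partition_of_def)
  moreover have "\<forall>B\<in>?P. \<exists>a b. B = {a..b}"
    unfolding interval_partition_of_def using interval_partition_of_block(3)[OF T] by blast
  ultimately show ?thesis by (simp add: interval_partitions_def)
qed

lemma interval_partition_of_surj:
  assumes n: "1 \<le> n" and "P \<in> interval_partitions n"
  shows "Max ` P \<in> end_sets n" "interval_partition_of n (Max ` P) = P"
proof -
  have P: "partition_on {1..n} P" "\<And>B. B \<in> P \<Longrightarrow> \<exists>a b. B = {a..b}"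
    using assms by (auto simp: interval_partitions_def)
  have sub: "Max B \<in> {1..n}" if "B \<in> P" for B using partition_block(1,4)[OF P(1) that] by blast
  obtain C where C: "C \<in> P" "n \<in> C" using partition_block_ex[OF P(1), of n] n by auto
  have "Max C = n"
    using partition_block[OF P(1) C(1)] C(2) by (intro Max_eqI) auto
  then show T: "Max ` P \<in> end_sets n" unfolding end_sets_def using sub C(1) by blast
  have ne: "next_end (Max ` P) k = Max B" if B: "B \<in> P" "k \<in> B" for B k
  proof -
    note pb = partition_block[OF P(1) B(1)]
    have k: "k \<le> n" using pb(1) B by auto
    have le: "next_end (Max ` P) k \<le> Max B"
      using next_end(3)[OF T k, of "Max B"] B pb by auto
    obtain C where C: "C \<in> P" "next_end (Max ` P) k = Max C" using next_end(1)[OF T k] by auto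
    obtain a b where ab: "B = {a..b}" using P(2)[OF B(1)] by blast
    have "Max B \<le> b" using pb(4) unfolding ab by simp
    \<comment> \<open>Here the blocks have to be intervals: \<open>Max C\<close> lies between
      \<open>k\<close> and \<open>Max B\<close>, both in \<open>B\<close>, so the next end after
      \<open>k\<close> is that of its own block.\<close>
    then have "Max C \<in> B" using next_end(2)[OF T k] le C B(2) unfolding ab by simp
    then have "C = B" using partition_block_unique[OF P(1) C(1) B(1)] partition_block(4)[OF P(1) C(1)] by blast
    then show ?thesis using C by simp
  qed
  have "{k \<in> {1..n}. next_end (Max ` P) k = Max B} = B" if B: "B \<in> P" for B
  proof (intro equalityI subsetI)
    fix k assume "k \<in> B"
    then show "k \<in> {k \<in> {1..n}. next_end (Max ` P) k = Max B}"
      using ne[OF B] partition_block(1)[OF P(1) B] by auto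
  next
    fix k assume k: "k \<in> {k \<in> {1..n}. next_end (Max ` P) k = Max B}"
    then obtain C where C: "C \<in> P" "k \<in> C" using partition_block_ex[OF P(1), of k] by blast
    then have "Max C = Max B" using ne[OF C] k by simp
    then have "C = B"
      using partition_block_unique[OF P(1) C(1) B] partition_block(4)[OF P(1)] C(1) B by metis
    then show "k \<in> B" using C by simp
  qed
  then show "interval_partition_of n (Max ` P) = P"
    unfolding interval_partition_of_def by (force simp: image_image)
qed

lemma bij_betw_interval_partition_of:
  assumes n: "1 \<le> n"
  shows "bij_betw (interval_partition_of n) (end_sets n) (interval_partitions n)"
proof (rule bij_betwI[where g = "\<lambda>P. Max ` P"])
  show "interval_partition_of n \<in> end_sets n \<rightarrow> interval_partitions n"
    using interval_partition_of_in by blast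
  show "(\<lambda>P. Max ` P) \<in> interval_partitions n \<rightarrow> end_sets n"
    using interval_partition_of_surj[OF n] by blast
  show "interval_partition_of n (Max ` P) = P" if "P \<in> interval_partitions n" for P
    using interval_partition_of_surj[OF n that] by blast
  show "Max ` interval_partition_of n T = T" if "T \<in> end_sets n" for T
    using interval_partition_of_block(2)[OF that] by (force simp: interval_partition_of_def image_image)
qed

text \<open>It suffices that the partition permutation sends \<open>ends_cycle n T k\<close> to
  \<open>\<gamma> k\<close>. Inside a block both move to the next integer. For an end
  \<open>k\<close>, the point \<open>\<gamma> k\<close> is the least of the following block, and the
  maximum of that block is sent to it.\<close>

lemma inv_partition_perm_interval_partition_of:
  assumes n: "1 \<le> n" and T: "T \<in> end_sets n"
  shows "inv_into UNIV (partition_perm (interval_partition_of n T)) \<circ> long_cycle n = ends_cycle n T"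
proof
  fix k
  let ?P = "interval_partition_of n T"
  have part: "partition_on {1..n} ?P"
    using interval_partition_of_in[OF T] by (simp add: interval_partitions_def)
  have nT: "n \<in> T" using T by (simp add: end_sets_def)
  have "partition_perm ?P (ends_cycle n T k) = long_cycle n k"
  proof (cases "k \<in> {1..n}")
    case False
    then have "k \<notin> T" "long_cycle n k = k" using end_sets_mem[OF T] by (auto simp: long_cycle_def)
    then show ?thesis using partition_perm_notin[OF part False] by (simp add: ends_cycle_def)
  next
    case k: True
    show ?thesis
    proof (cases "k \<in> T")
      case True
      define m where "m = long_cycle n k"
      have m: "m \<in> {1..n}" unfolding m_def using permutes_in_image[OF long_cycle_permutes] k by blast
      define t where "t = next_end T m"
      have t: "t \<in> T" "m \<le> t" using next_end(1,2)[OF T, of m] m by (auto simp: t_def)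
      define B where "B = {k \<in> {1..n}. next_end T k = t}"
      have B: "B \<in> ?P" using t by (auto simp: interval_partition_of_def B_def)
      note pb = partition_block[OF part B]
      have MB: "Max B = t" unfolding B_def by (rule interval_partition_of_block(2)[OF T t(1)])
      have "Min B = m"
      proof (rule Min_eqI)
        show "m \<in> B" using m by (simp add: B_def t_def)
        fix j assume j: "j \<in> B"
        show "m \<le> j"
        proof (rule ccontr)
          assume "\<not> m \<le> j"
          then have "m = Suc k" "j \<le> k" using k j unfolding m_def long_cycle_def B_def
            by (auto split: if_splits)
          then have "next_end T j \<le> k" using next_end(3)[OF T _ True, of j] k by simp
          then show False using j t(2) \<open>m = Suc k\<close> by (simp add: B_def)
        qed
      qed (rule pb)
      then have "partition_perm ?P t = m"
        using partition_perm_in[OF part B pb(4)] next_in_Max[OF pb(2,3)] MB by simp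
      then show ?thesis using True by (simp add: ends_cycle_def t_def m_def)
    next
      case False
      then have kn: "k < n" using nT k by (cases "k = n") auto
      define t where "t = next_end T k"
      have t: "t \<in> T" "k \<le> t" using next_end(1,2)[OF T, of k] k by (auto simp: t_def)
      then have "Suc k \<le> t" using False by (cases "k = t") auto
      then have "next_end T (Suc k) = t"
        using next_end[OF T, of "Suc k"] next_end(3)[OF T, of k] kn t by (intro antisym) (auto simp: t_def)
      define B where "B = {k \<in> {1..n}. next_end T k = t}"
      have B: "B \<in> ?P" using t by (auto simp: interval_partition_of_def B_def)
      have "k \<in> B" using k by (simp add: B_def t_def)
      then have "partition_perm ?P k = next_in B k" by (rule partition_perm_in[OF part B])
      also have "\<dots> = Suc k"
        using \<open>next_end T (Suc k) = t\<close> kn by (intro next_in_eqI) (auto simp: B_def)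
      finally show ?thesis using False k kn by (simp add: ends_cycle_def long_cycle_def)
    qed
  qed
  then show "(inv_into UNIV (partition_perm ?P) \<circ> long_cycle n) k = ends_cycle n T k"
    using partition_perm_permutes[OF part] by (metis comp_apply permutes_inverses(2))
qed

section \<open>The moment as a sum over block ends and permutations of maximal cycle count\<close>

lemma noncrossing_partition_perms:
  assumes "1 \<le> n"
  shows "bij_betw partition_perm (noncrossing_partitions n)
    {\<sigma>. \<sigma> permutes {1..n} \<and> num_cycles n \<sigma> + num_cycles n (inv_into UNIV \<sigma> \<circ> long_cycle n) = Suc n}"
  unfolding bij_betw_def
proof
  show "inj_on partition_perm (noncrossing_partitions n)"
    by (rule inj_onI, rule partition_perm_inject[of n]) (simp_all add: mem_noncrossing_partitions)
  have "partition_perm P permutes {1..n}" if "P \<in> noncrossing_partitions n" for P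
    using that partition_perm_permutes by (auto simp: mem_noncrossing_partitions)
  then show "partition_perm ` noncrossing_partitions n = {\<sigma>. \<sigma> permutes {1..n} \<and>
      num_cycles n \<sigma> + num_cycles n (inv_into UNIV \<sigma> \<circ> long_cycle n) = Suc n}"
    using num_cycles_long_cycle[OF assms] by blast
qed

text \<open>For \<open>\<beta> = \<gamma> \<pi>\<close> one has
  \<open>\<beta>\<^sup>-\<^sup>1 \<gamma> = \<pi>\<^sup>-\<^sup>1\<close>; this turns the two counts
  of the genus bound into those of \<pi> and \<open>\<gamma> \<pi>\<close>, which appear in Wick's
  formula.\<close>

lemma num_cycles_long_cycle_comp:
  assumes "\<pi> permutes {1..n}"
  shows "num_cycles n (inv_into UNIV (long_cycle n \<circ> \<pi>) \<circ> long_cycle n) = num_cycles n \<pi>"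
proof -
  have "inv_into UNIV (long_cycle n \<circ> \<pi>) \<circ> long_cycle n = inv_into UNIV \<pi>"
    using assms long_cycle_permutes[of n]
    by (simp add: o_inv_distrib permutes_bij comp_assoc permutes_inv_o)
  then show ?thesis using num_cycles_inv[OF assms] by simp
qed

lemma num_cycles_add_le:
  assumes n: "1 \<le> n" and \<pi>: "\<pi> permutes {1..n}"
  shows "num_cycles n \<pi> + num_cycles n (long_cycle n \<circ> \<pi>) \<le> Suc n"
  using num_cycles_long_cycle[OF n permutes_compose[OF \<pi> long_cycle_permutes]]
    num_cycles_long_cycle_comp[OF \<pi>] by simp

text \<open>Three changes of variable: \<alpha> becomes the set of its block ends, \<beta> its
  permutation, and that permutation \<open>\<gamma> \<pi>\<close>. Then
  \<open>\<alpha>\<^sup>-\<^sup>1 \<beta> = \<alpha>\<^sup>-\<^sup>1 \<gamma> \<pi>\<close>, whose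
  first two factors form \<open>ends_cycle\<close>.\<close>

lemma m_ST_eq:
  assumes n: "1 \<le> n"
  shows "m_ST n l = (\<Sum>T\<in>end_sets n. \<Sum>\<pi> | \<pi> permutes {1..n} \<and>
    num_cycles n \<pi> + num_cycles n (long_cycle n \<circ> \<pi>) = Suc n. l ^ num_cycles n (ends_cycle n T \<circ> \<pi>))"
proof -
  let ?S = "{\<sigma>. \<sigma> permutes {1..n} \<and> num_cycles n \<sigma> + num_cycles n (inv_into UNIV \<sigma> \<circ> long_cycle n) = Suc n}"
  let ?S' = "{\<pi>. \<pi> permutes {1..n} \<and> num_cycles n \<pi> + num_cycles n (long_cycle n \<circ> \<pi>) = Suc n}"
  have bij: "bij_betw (\<lambda>\<pi>. long_cycle n \<circ> \<pi>) ?S' ?S"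
  proof (rule bij_betwI[where g = "\<lambda>\<sigma>. inv_into UNIV (long_cycle n) \<circ> \<sigma>"])
    show "(\<lambda>\<pi>. long_cycle n \<circ> \<pi>) \<in> ?S' \<rightarrow> ?S"
      using num_cycles_long_cycle_comp permutes_compose[OF _ long_cycle_permutes] by auto
    have "long_cycle n \<circ> (inv_into UNIV (long_cycle n) \<circ> \<sigma>) = \<sigma>" for \<sigma>
      using permutes_inv_o(1)[OF long_cycle_permutes] by (metis comp_assoc id_comp)
    then show "long_cycle n \<circ> (inv_into UNIV (long_cycle n) \<circ> \<sigma>) = \<sigma>" for \<sigma> .
    show "inv_into UNIV (long_cycle n) \<circ> (long_cycle n \<circ> \<pi>) = \<pi>" for \<pi>
      using permutes_inv_o(2)[OF long_cycle_permutes] by (metis comp_assoc id_comp)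
    show "(\<lambda>\<sigma>. inv_into UNIV (long_cycle n) \<circ> \<sigma>) \<in> ?S \<rightarrow> ?S'"
    proof
      fix \<sigma> assume \<sigma>: "\<sigma> \<in> ?S"
      let ?\<pi> = "inv_into UNIV (long_cycle n) \<circ> \<sigma>"
      have \<pi>: "?\<pi> permutes {1..n}"
        using \<sigma> by (intro permutes_compose permutes_inv long_cycle_permutes) auto
      have eq: "long_cycle n \<circ> ?\<pi> = \<sigma>"
        using permutes_inv_o(1)[OF long_cycle_permutes] by (metis comp_assoc id_comp)
      have "num_cycles n ?\<pi> = num_cycles n (inv_into UNIV \<sigma> \<circ> long_cycle n)"
        using num_cycles_long_cycle_comp[OF \<pi>] unfolding eq by simp
      then have "num_cycles n ?\<pi> + num_cycles n (long_cycle n \<circ> ?\<pi>) = Suc n"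
        using \<sigma> unfolding eq by simp
      then show "?\<pi> \<in> ?S'" using \<pi> by blast
    qed
  qed
  have "m_ST n l = (\<Sum>T\<in>end_sets n. \<Sum>P\<in>noncrossing_partitions n.
      l ^ num_cycles n (inv_into UNIV (partition_perm (interval_partition_of n T)) \<circ> partition_perm P))"
    unfolding m_ST_def by (rule sum.reindex_bij_betw[OF bij_betw_interval_partition_of[OF n], symmetric])
  also have "\<dots> = (\<Sum>T\<in>end_sets n. \<Sum>\<sigma>\<in>?S.
      l ^ num_cycles n (inv_into UNIV (partition_perm (interval_partition_of n T)) \<circ> \<sigma>))"
    by (intro sum.cong refl sum.reindex_bij_betw[OF noncrossing_partition_perms[OF n]])
  also have "\<dots> = (\<Sum>T\<in>end_sets n. \<Sum>\<pi>\<in>?S'.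
      l ^ num_cycles n (inv_into UNIV (partition_perm (interval_partition_of n T)) \<circ> (long_cycle n \<circ> \<pi>)))"
    by (intro sum.cong refl sum.reindex_bij_betw[OF bij, symmetric])
  also have "\<dots> = (\<Sum>T\<in>end_sets n. \<Sum>\<pi>\<in>?S'. l ^ num_cycles n (ends_cycle n T \<circ> \<pi>))"
    by (intro sum.cong refl)
      (simp only: inv_partition_perm_interval_partition_of[OF n, symmetric] comp_assoc)
  finally show ?thesis .
qed

lemma ends_cycle_permutes:
  assumes n: "1 \<le> n" and T: "T \<in> end_sets n"
  shows "ends_cycle n T permutes {1..n}"
proof -
  have "partition_on {1..n} (interval_partition_of n T)"
    using interval_partition_of_in[OF T] by (simp add: interval_partitions_def)
  then have "inv_into UNIV (partition_perm (interval_partition_of n T)) \<circ> long_cycle n permutes {1..n}"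
    by (intro permutes_compose permutes_inv long_cycle_permutes partition_perm_permutes)
  then show ?thesis unfolding inv_partition_perm_interval_partition_of[OF n T] .
qed

section \<open>Wick's formula for complex Gaussian variables\<close>

text \<open>With \<open>F a b j k\<close> in the role of the expectation of \<open>Re z ^ a * Im z ^ b * z ^ j * cnj z ^ k\<close>,
  \<open>F10\<close> and \<open>F01\<close> are Gaussian integration by parts for polynomials in \<open>Re z\<close> and \<open>Im z\<close>; the proof
  extends it to polynomials that also involve \<open>z\<close> and its conjugate.\<close>

lemma complex_gaussian_moments_algebraic:
  fixes F :: "nat \<Rightarrow> nat \<Rightarrow> nat \<Rightarrow> nat \<Rightarrow> complex"
  assumes Fz: "\<And>a b j k. F a b (Suc j) k = F (Suc a) b j k + \<i> * F a (Suc b) j k"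
    and Fc: "\<And>a b j k. F a b j (Suc k) = F (Suc a) b j k - \<i> * F a (Suc b) j k"
    and F10: "\<And>a b. F (Suc a) b 0 0 = of_nat a * F (a - 1) b 0 0 / 2"
    and F01: "\<And>a b. F a (Suc b) 0 0 = of_nat b * F a (b - 1) 0 0 / 2"
    and F00: "F 0 0 0 0 = 1"
  shows "F 0 0 j k = (if j = k then fact j else 0)"
proof -
  \<comment> \<open>The factor \<open>of_nat j\<close> makes the truncated difference
    \<open>j - 1\<close> harmless at \<open>j = 0\<close>.\<close>
  have Fz': "of_nat j * F a b j k = of_nat j * (F (Suc a) b (j - 1) k + \<i> * F a (Suc b) (j - 1) k)" for a b j k
    by (cases j) (simp_all add: Fz)
  have Fc': "of_nat k * F a b j k = of_nat k * (F (Suc a) b j (k - 1) - \<i> * F a (Suc b) j (k - 1))" for a b j k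
    by (cases k) (simp_all add: Fc)
  have Fx: "of_nat a * G (Suc (a - 1)) = of_nat a * G a" for a and G :: "nat \<Rightarrow> complex"
    by (cases a) simp_all
  \<comment> \<open>The rule for integration by parts is extended to powers of \<open>z\<close>
    first and to powers of its conjugate afterwards. \<open>Fz\<close> and \<open>Fc\<close> lower
    one of these powers at the cost of raising \<open>a\<close> or \<open>b\<close>, hence the
    induction with \<open>a\<close> and \<open>b\<close> arbitrary.\<close>
  have X0: "F (Suc a) b j 0 = (of_nat a * F (a - 1) b j 0 + of_nat j * F a b (j - 1) 0) / 2" for a b j
  proof (induction j arbitrary: a b)
    case (Suc j)
    show ?case
      unfolding Fz[of "Suc a"] Suc
      using Fz[of "a - 1" b j 0] Fz'[of j a b 0] Fx[of a "\<lambda>c. F c b j 0"]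
      by (auto simp: field_simps)
  qed (simp add: F10)
  have Y0: "F a (Suc b) j 0 = (of_nat b * F a (b - 1) j 0 + \<i> * of_nat j * F a b (j - 1) 0) / 2" for a b j
  proof (induction j arbitrary: a b)
    case (Suc j)
    show ?case
      unfolding Fz[of a "Suc b"] Suc
      using Fz[of a "b - 1" j 0] Fz'[of j a b 0] Fx[of b "\<lambda>c. F a c j 0"]
      by (auto simp: field_simps)
  qed (simp add: F01)
  have X: "F (Suc a) b j k = (of_nat a * F (a - 1) b j k + of_nat j * F a b (j - 1) k
      + of_nat k * F a b j (k - 1)) / 2" for a b j k
  proof (induction k arbitrary: a b)
    case (Suc k)
    have *: "of_nat a * F (a - 1) b j (Suc k) = of_nat a * F a b j k - \<i> * (of_nat a * F (a - 1) (Suc b) j k)"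
      "of_nat (Suc k) * F a b j (Suc k - 1) = F a b j k
        + (of_nat k * F (Suc a) b j (k - 1) - \<i> * (of_nat k * F a (Suc b) j (k - 1)))"
      by (cases a; simp add: Fc algebra_simps) (use Fc'[of k a b j] in \<open>simp add: algebra_simps\<close>)
    show ?case
      unfolding * Fc[of a b "j - 1" k] Fc[of "Suc a"] Suc
      by (simp add: algebra_simps add_divide_distrib diff_divide_distrib)
  qed (simp add: X0)
  have Y: "F a (Suc b) j k = (of_nat b * F a (b - 1) j k + \<i> * of_nat j * F a b (j - 1) k
      - \<i> * of_nat k * F a b j (k - 1)) / 2" for a b j k
  proof (induction k arbitrary: a b)
    case (Suc k)
    have *: "of_nat b * F a (b - 1) j (Suc k) = of_nat b * F (Suc a) (b - 1) j k - \<i> * (of_nat b * F a b j k)"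
      "\<i> * of_nat (Suc k) * F a b j (Suc k - 1) = \<i> * F a b j k
        + \<i> * (of_nat k * (F (Suc a) b j (k - 1) - \<i> * F a (Suc b) j (k - 1)))"
      by (cases b; simp add: Fc algebra_simps) (simp only: Fc'[symmetric], simp add: algebra_simps)
    show ?case
      unfolding * Fc[of a b "j - 1" k] Fc[of a "Suc b"] Suc
      by (simp add: algebra_simps add_divide_distrib diff_divide_distrib)
  qed (simp add: Y0)
  \<comment> \<open>In \<open>z = Re z + \<i> * Im z\<close> the derivatives in \<open>z\<close>
    cancel, as \<open>1 + \<i> * \<i> = 0\<close>, and those in the conjugate add up, as
    \<open>1 - \<i> * \<i> = 2\<close>: a variable pairs only with its conjugate.\<close>
  have rz: "F 0 0 (Suc j) k = of_nat k * F 0 0 j (k - 1)" for j k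
    unfolding Fz X[of 0] Y[of 0 0] by (simp add: field_simps)
  have rc: "F 0 0 j (Suc k) = of_nat j * F 0 0 (j - 1) k" for j k
    unfolding Fc X[of 0] Y[of 0 0] by (simp add: field_simps)
  show ?thesis
  proof (induction j arbitrary: k)
    case 0
    show ?case using rc[of 0] F00 by (cases k) auto
  next
    case (Suc j)
    show ?case using rz[of j k] Suc[of "k - 1"] by (cases k) auto
  qed
qed

text \<open>A matching permutation maps each level set of \<open>a\<close> onto the corresponding
  level set of \<open>b\<close>, which requires equal sizes and leaves a factorial of choices.
  Composing with a transposition alters \<open>b\<close> in the induction, so \<open>b\<close> is
  kept arbitrary.\<close>

lemma sum_permutations_matching:
  fixes a b :: "'k \<Rightarrow> 'r"
  assumes "finite K" "finite R" "a ` K \<subseteq> R" "b ` K \<subseteq> R"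
  shows "(\<Sum>\<pi> | \<pi> permutes K. \<Prod>k\<in>K. of_bool (a k = b (\<pi> k)))
    = (\<Prod>r\<in>R. if card {k \<in> K. a k = r} = card {k \<in> K. b k = r}
        then fact (card {k \<in> K. a k = r}) else (0 :: 'c :: {comm_semiring_1,semiring_char_0}))"
  using assms(1,3,4)
proof (induction K arbitrary: b rule: finite_induct)
  case empty
  have "{\<pi>. \<pi> permutes ({} :: 'k set)} = {id}" by (auto simp: permutes_empty)
  then show ?case by simp
next
  case (insert k0 K)
  let ?G = "\<lambda>x y. if x = y then fact x else (0 :: 'c)"
  define r0 where "r0 = a k0"
  define m where "m r = card {k \<in> K. a k = r}" for r
  define p where "p r = card {k \<in> insert k0 K. b k = r}" for r
  define C where "C = (\<Prod>r\<in>R - {r0}. ?G (m r) (p r))"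
  have r0: "r0 \<in> R" using insert.prems by (simp add: r0_def)
  have fin: "finite {k \<in> insert k0 K. b k = r}" for r using insert.hyps by simp
  \<comment> \<open>\<open>j\<close> is the image of \<open>k0\<close>, and \<open>q\<close> carries
    the rest of the permutation.\<close>
  have step: "(\<Sum>q | q permutes K. \<Prod>k\<in>insert k0 K. of_bool (a k = b ((Transposition.transpose k0 j \<circ> q) k)))
      = of_bool (b j = r0) * (?G (m r0) (p r0 - 1) * C)" if j: "j \<in> insert k0 K" for j
  proof -
    let ?t = "Transposition.transpose k0 j"
    have "(\<Sum>q | q permutes K. \<Prod>k\<in>insert k0 K. of_bool (a k = b ((?t \<circ> q) k)))
        = (\<Sum>q | q permutes K. of_bool (b j = r0) * (\<Prod>k\<in>K. of_bool (a k = (b \<circ> ?t) (q k))) :: 'c)"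
    proof (rule sum.cong[OF refl])
      fix q assume "q \<in> {q. q permutes K}"
      then have "q k0 = k0" using insert.hyps permutes_not_in by fastforce
      then show "(\<Prod>k\<in>insert k0 K. of_bool (a k = b ((?t \<circ> q) k)))
          = of_bool (b j = r0) * (\<Prod>k\<in>K. of_bool (a k = (b \<circ> ?t) (q k)) :: 'c)"
        using insert.hyps by (simp add: r0_def eq_commute)
    qed
    also have "\<dots> = of_bool (b j = r0) * (\<Sum>q | q permutes K. \<Prod>k\<in>K. of_bool (a k = (b \<circ> ?t) (q k)))"
      by (simp add: sum_distrib_left)
    also have "(\<Sum>q | q permutes K. \<Prod>k\<in>K. of_bool (a k = (b \<circ> ?t) (q k)))
        = (\<Prod>r\<in>R. ?G (m r) (card {k \<in> K. (b \<circ> ?t) k = r}))"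
      unfolding m_def
    proof (rule insert.IH)
      show "a ` K \<subseteq> R" using insert.prems by auto
      show "(b \<circ> ?t) ` K \<subseteq> R"
      proof
        fix r assume "r \<in> (b \<circ> ?t) ` K"
        then obtain k where k: "k \<in> K" "r = b (?t k)" by auto
        then have "?t k \<in> insert k0 K" using j by (auto simp: Transposition.transpose_def)
        then show "r \<in> R" using insert.prems(2) k(2) by blast
      qed
    qed
    also have "of_bool (b j = r0) * \<dots> = of_bool (b j = r0) * (?G (m r0) (p r0 - 1) * C)"
    proof (cases "b j = r0")
      case True
      \<comment> \<open>On \<open>K\<close>, the labelling \<open>b \<circ> ?t\<close> runs through
        the values of \<open>b\<close> at all points but \<open>j\<close>, so only the level of
        \<open>r0\<close> loses a point.\<close>
      have cnt: "card {k \<in> K. (b \<circ> ?t) k = r} = card ({k \<in> insert k0 K. b k = r} - {j})" for r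
      proof (rule bij_betw_same_card[of ?t])
        have sw: "k \<in> K \<Longrightarrow> ?t k \<in> insert k0 K \<and> ?t k \<noteq> j" for k
          using insert.hyps j by (auto simp: Transposition.transpose_def)
        have sw': "k \<in> insert k0 K \<Longrightarrow> k \<noteq> j \<Longrightarrow> ?t k \<in> K" for k
          using insert.hyps j by (auto simp: Transposition.transpose_def)
        show "bij_betw ?t {k \<in> K. (b \<circ> ?t) k = r} ({k \<in> insert k0 K. b k = r} - {j})"
          by (rule bij_betwI[where g = ?t]) (use sw sw' in auto)
      qed
      have "card {k \<in> K. (b \<circ> ?t) k = r} = (if r = r0 then p r0 - 1 else p r)" for r
        unfolding cnt p_def using True j fin by (auto simp: card_Diff_singleton)
      then have "(\<Prod>r\<in>R. ?G (m r) (card {k \<in> K. (b \<circ> ?t) k = r}))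
          = (\<Prod>r\<in>R. ?G (m r) (if r = r0 then p r0 - 1 else p r))" by simp
      also have "\<dots> = ?G (m r0) (p r0 - 1) * C"
        unfolding C_def by (subst prod.remove[OF assms(2) r0]) (auto intro!: prod.cong)
      finally show ?thesis by simp
    qed simp
    finally show ?thesis .
  qed
  \<comment> \<open>The number of admissible images of \<open>k0\<close>; this factor turns the
    factorial of \<open>m r0\<close> into that of its successor.\<close>
  have cnt': "(\<Sum>j\<in>insert k0 K. of_bool (b j = r0)) = (of_nat (p r0) :: 'c)"
    using sum.inter_filter[of "insert k0 K" "\<lambda>_. 1 :: 'c" "\<lambda>j. b j = r0"] insert.hyps
    unfolding p_def of_bool_def by simp
  have "(\<Sum>\<pi> | \<pi> permutes insert k0 K. \<Prod>k\<in>insert k0 K. of_bool (a k = b (\<pi> k)))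
      = (\<Sum>j\<in>insert k0 K. of_bool (b j = r0) * (?G (m r0) (p r0 - 1) * C))"
    unfolding sum_over_permutations_insert[OF insert.hyps] using step by (rule sum.cong[OF refl])
  also have "\<dots> = of_nat (p r0) * (?G (m r0) (p r0 - 1) * C)"
    by (simp only: cnt' sum_distrib_right[symmetric])
  also have "\<dots> = ?G (Suc (m r0)) (p r0) * C"
    by (cases "p r0") (auto simp: mult_ac)
  also have "\<dots> = (\<Prod>r\<in>R. ?G (if r = r0 then Suc (m r0) else m r) (p r))"
  proof -
    have "C = (\<Prod>r\<in>R - {r0}. ?G (if r = r0 then Suc (m r0) else m r) (p r))"
      unfolding C_def by (rule prod.cong) auto
    then show ?thesis by (simp add: prod.remove[OF assms(2) r0])
  qed
  also have "\<dots> = (\<Prod>r\<in>R. ?G (card {k \<in> insert k0 K. a k = r}) (p r))"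
  proof -
    have "card {k \<in> insert k0 K. a k = r} = (if r = r0 then Suc (m r0) else m r)" for r
    proof -
      have "{k \<in> insert k0 K. a k = r} = (if r = r0 then insert k0 {k \<in> K. a k = r} else {k \<in> K. a k = r})"
        by (auto simp: r0_def)
      then show ?thesis using insert.hyps by (simp add: m_def)
    qed
    then show ?thesis by (simp only:)
  qed
  finally show ?case unfolding p_def .
qed

lemma prod_of_bool:
  "finite K \<Longrightarrow> (\<Prod>k\<in>K. of_bool (P k)) = (of_bool (\<forall>k\<in>K. P k) :: 'c :: comm_semiring_1)"
  by (induction K rule: finite_induct) auto

section \<open>Moments of one Gaussian variable and pairings of a family\<close>

context prob_space
begin

text \<open>The mean and the recursion are Gaussian integration by parts for monomials; the
  denominator 2 comes from the variance \<open>1 / 2\<close> of the real and imaginary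
  parts.\<close>

lemma gaussian_half_moments:
  assumes X: "distributed M lborel X (normal_density 0 (sqrt (1 / 2)))"
  shows "integrable M (\<lambda>\<omega>. X \<omega> ^ k)"
    and "expectation X = 0"
    and "expectation (\<lambda>\<omega>. X \<omega> ^ Suc (Suc k)) = real (Suc k) * expectation (\<lambda>\<omega>. X \<omega> ^ k) / 2"
proof -
  let ?f = "normal_density 0 (sqrt (1 / 2))"
  have pos: "0 < sqrt (1 / 2 :: real)" by simp
  \<comment> \<open>The base 4 is 2 divided by the variance.\<close>
  have ev: "has_bochner_integral lborel (\<lambda>x. ?f x * x ^ (2 * j)) (fact (2 * j) / (4 ^ j * fact j))" for j
    using normal_moment_even[OF pos, of 0 j] by (simp add: power2_eq_square real_sqrt_mult[symmetric])
  have od: "has_bochner_integral lborel (\<lambda>x. ?f x * x ^ (2 * j + 1)) 0" for j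
    using normal_moment_odd[OF pos, of 0 j] by simp
  have int: "integrable lborel (\<lambda>x. ?f x * x ^ i)" for i
    using ev[of "i div 2"] od[of "i div 2"] by (cases "even i") (auto simp: has_bochner_integral_iff)
  show "integrable M (\<lambda>\<omega>. X \<omega> ^ k)"
    using int[of k] distributed_integrable[OF X, of "\<lambda>x. x ^ k"] by simp
  have E: "expectation (\<lambda>\<omega>. X \<omega> ^ i) = (LINT x|lborel. ?f x * x ^ i)" for i
    using distributed_integral[OF X, of "\<lambda>x. x ^ i"] by simp
  show "expectation X = 0"
    using E[of 1] od[of 0] by (simp add: has_bochner_integral_iff)
  show "expectation (\<lambda>\<omega>. X \<omega> ^ Suc (Suc k)) = real (Suc k) * expectation (\<lambda>\<omega>. X \<omega> ^ k) / 2"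
  proof (cases "even k")
    case True
    then obtain j where k: "k = 2 * j" by blast
    have "expectation (\<lambda>\<omega>. X \<omega> ^ Suc (Suc k)) = fact (2 * Suc j) / (4 ^ Suc j * fact (Suc j))"
      unfolding E k using ev[of "Suc j"] by (simp add: has_bochner_integral_iff)
    moreover have "expectation (\<lambda>\<omega>. X \<omega> ^ k) = fact (2 * j) / (4 ^ j * fact j)"
      unfolding E k using ev[of j] by (simp add: has_bochner_integral_iff)
    moreover have "fact (2 * Suc j) / (4 ^ Suc j * fact (Suc j))
        = real (Suc (2 * j)) * (fact (2 * j) / (4 ^ j * fact j)) / 2"
      by (simp add: field_simps del: of_nat_Suc) (simp add: algebra_simps)
    ultimately show ?thesis by (simp add: k)
  next
    case False
    then obtain j where k: "k = 2 * j + 1" by (elim oddE)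
    show ?thesis
      unfolding E k using od[of "Suc j"] od[of j] by (simp add: has_bochner_integral_iff)
  qed
qed

lemma std_complex_gaussian_moment:
  assumes Z: "std_complex_gaussian Z"
  shows "integrable M (\<lambda>\<omega>. Z \<omega> ^ j * cnj (Z \<omega>) ^ k)"
    and "expectation (\<lambda>\<omega>. Z \<omega> ^ j * cnj (Z \<omega>) ^ k) = (if j = k then fact j else 0)"
proof -
  define X Y where "X = (\<lambda>\<omega>. Re (Z \<omega>))" and "Y = (\<lambda>\<omega>. Im (Z \<omega>))"
  have ind: "indep_var borel X borel Y"
    and X: "distributed M lborel X (normal_density 0 (sqrt (1 / 2)))"
    and Y: "distributed M lborel Y (normal_density 0 (sqrt (1 / 2)))"
    using Z unfolding std_complex_gaussian_def X_def Y_def by auto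
  have indp: "indep_var borel (\<lambda>\<omega>. X \<omega> ^ a) borel (\<lambda>\<omega>. Y \<omega> ^ b)" for a b
    using indep_var_compose[OF ind, of "\<lambda>x. x ^ a" borel "\<lambda>x. x ^ b" borel] by (simp add: comp_def)
  \<comment> \<open>Powers of the real and imaginary parts are recorded separately from those of
    \<open>Z\<close>. Expanding one factor \<open>Z\<close> or its conjugate at a time reduces
    integrability to \<open>j = k = 0\<close>, where independence applies.\<close>
  define f where "f a b j k \<omega> = complex_of_real (X \<omega> ^ a * Y \<omega> ^ b) * (Z \<omega> ^ j * cnj (Z \<omega>) ^ k)"
    for a b j k :: nat and \<omega>
  have Zeq: "Z \<omega> = complex_of_real (X \<omega>) + \<i> * complex_of_real (Y \<omega>)"
      "cnj (Z \<omega>) = complex_of_real (X \<omega>) - \<i> * complex_of_real (Y \<omega>)" for \<omega>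
    by (simp_all add: X_def Y_def complex_eq_iff)
  have fz: "f a b (Suc j) k = (\<lambda>\<omega>. f (Suc a) b j k \<omega> + \<i> * f a (Suc b) j k \<omega>)" for a b j k
  proof
    fix \<omega>
    have "f a b (Suc j) k \<omega> = Z \<omega> * f a b j k \<omega>" by (simp add: f_def mult_ac)
    also have "\<dots> = f (Suc a) b j k \<omega> + \<i> * f a (Suc b) j k \<omega>"
      unfolding Zeq(1)[of \<omega>] by (simp add: f_def algebra_simps)
    finally show "f a b (Suc j) k \<omega> = f (Suc a) b j k \<omega> + \<i> * f a (Suc b) j k \<omega>" .
  qed
  have fc: "f a b j (Suc k) = (\<lambda>\<omega>. f (Suc a) b j k \<omega> - \<i> * f a (Suc b) j k \<omega>)" for a b j k
  proof
    fix \<omega>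
    have "f a b j (Suc k) \<omega> = cnj (Z \<omega>) * f a b j k \<omega>" by (simp add: f_def mult_ac)
    also have "\<dots> = f (Suc a) b j k \<omega> - \<i> * f a (Suc b) j k \<omega>"
      unfolding Zeq(2)[of \<omega>] by (simp add: f_def algebra_simps)
    finally show "f a b j (Suc k) \<omega> = f (Suc a) b j k \<omega> - \<i> * f a (Suc b) j k \<omega>" .
  qed
  have f00: "f a b 0 0 = (\<lambda>\<omega>. complex_of_real (X \<omega> ^ a * Y \<omega> ^ b))" for a b
    by (simp add: f_def fun_eq_iff)
  have fZ: "f 0 0 j k = (\<lambda>\<omega>. Z \<omega> ^ j * cnj (Z \<omega>) ^ k)"
    by (simp add: f_def fun_eq_iff)
  have int0: "integrable M (f a b 0 0)" for a b
    using indep_var_integrable[OF indp gaussian_half_moments(1)[OF X] gaussian_half_moments(1)[OF Y]]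
    unfolding f00 by (simp del: of_real_mult of_real_power)
  have int1: "integrable M (f a b j 0)" for a b j
    by (induction j arbitrary: a b) (auto simp: int0 fz)
  have int: "integrable M (f a b j k)" for a b j k
    by (induction k arbitrary: a b) (auto simp: int1 fc)
  show "integrable M (\<lambda>\<omega>. Z \<omega> ^ j * cnj (Z \<omega>) ^ k)"
    using int[of 0 0 j k] unfolding fZ .
  define F where "F a b j k = (\<integral>\<omega>. f a b j k \<omega> \<partial>M)" for a b j k
  have F0: "F a b 0 0 = of_real (expectation (\<lambda>\<omega>. X \<omega> ^ a) * expectation (\<lambda>\<omega>. Y \<omega> ^ b))" for a b
    using indep_var_lebesgue_integral[OF indp gaussian_half_moments(1)[OF X] gaussian_half_moments(1)[OF Y], of a b]
    unfolding F_def f00 by (simp del: of_real_mult of_real_power)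
  \<comment> \<open>For \<open>a = 0\<close> this is the vanishing of the mean, the truncated
    exponent being multiplied by zero.\<close>
  have mom: "expectation (\<lambda>\<omega>. W \<omega> ^ Suc a) = real a * expectation (\<lambda>\<omega>. W \<omega> ^ (a - 1)) / 2"
    if "distributed M lborel W (normal_density 0 (sqrt (1 / 2)))" for W a
    using gaussian_half_moments(2,3)[OF that] by (cases a) simp_all
  have "F 0 0 j k = (if j = k then fact j else 0)"
  proof (rule complex_gaussian_moments_algebraic[where F = F])
    show "F a b (Suc j) k = F (Suc a) b j k + \<i> * F a (Suc b) j k" for a b j k
      unfolding F_def fz using int by simp
    show "F a b j (Suc k) = F (Suc a) b j k - \<i> * F a (Suc b) j k" for a b j k
      unfolding F_def fc using int by simp
    show "F (Suc a) b 0 0 = of_nat a * F (a - 1) b 0 0 / 2" for a b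
      unfolding F0 mom[OF X] by simp
    show "F a (Suc b) 0 0 = of_nat b * F a (b - 1) 0 0 / 2" for a b
      unfolding F0 mom[OF Y] by simp
    show "F 0 0 0 0 = 1" by (simp add: F0 prob_space)
  qed
  then show "expectation (\<lambda>\<omega>. Z \<omega> ^ j * cnj (Z \<omega>) ^ k) = (if j = k then fact j else 0)"
    unfolding F_def fZ .
qed

text \<open>The maps \<open>a\<close> and \<open>b\<close> need not be injective, so independence
  applies only after the factors are grouped by variable. Each group contributes a factorial or
  zero, and the product of these counts the matching permutations.\<close>

lemma complex_gaussian_wick:
  fixes Z :: "'r \<Rightarrow> 'a \<Rightarrow> complex"
  assumes R: "finite R" and ind: "indep_vars (\<lambda>_. borel) Z R"
    and Z: "\<And>r. r \<in> R \<Longrightarrow> std_complex_gaussian (Z r)"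
    and K: "finite K" "a ` K \<subseteq> R" "b ` K \<subseteq> R"
  shows "integrable M (\<lambda>\<omega>. \<Prod>k\<in>K. Z (a k) \<omega> * cnj (Z (b k) \<omega>))"
    and "expectation (\<lambda>\<omega>. \<Prod>k\<in>K. Z (a k) \<omega> * cnj (Z (b k) \<omega>))
      = (\<Sum>\<pi> | \<pi> permutes K. of_bool (\<forall>k\<in>K. a k = b (\<pi> k)))"
proof -
  let ?m = "\<lambda>r. card {k \<in> K. a k = r}" and ?m' = "\<lambda>r. card {k \<in> K. b k = r}"
  have grp: "(\<Prod>k\<in>K. h (c k)) = (\<Prod>r\<in>R. h r ^ card {k \<in> K. c k = r})"
    if "c ` K \<subseteq> R" for h :: "'r \<Rightarrow> complex" and c
  proof -
    have "(\<Prod>k\<in>K. h (c k)) = (\<Prod>r\<in>R. \<Prod>k\<in>{k \<in> K. c k = r}. h (c k))"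
      using prod.group[OF K(1) R that, of "\<lambda>k. h (c k)"] by simp
    also have "\<dots> = (\<Prod>r\<in>R. h r ^ card {k \<in> K. c k = r})" by (intro prod.cong) auto
    finally show ?thesis .
  qed
  have eq: "(\<Prod>k\<in>K. Z (a k) \<omega> * cnj (Z (b k) \<omega>)) = (\<Prod>r\<in>R. Z r \<omega> ^ ?m r * cnj (Z r \<omega>) ^ ?m' r)" for \<omega>
    using grp[OF K(2), of "\<lambda>r. Z r \<omega>"] grp[OF K(3), of "\<lambda>r. cnj (Z r \<omega>)"] by (simp add: prod.distrib)
  have "indep_vars (\<lambda>_. borel) (\<lambda>r \<omega>. (\<lambda>z. z ^ ?m r * cnj z ^ ?m' r) (Z r \<omega>)) R"
    by (rule indep_vars_compose2[OF ind]) (auto intro!: borel_measurable_continuous_onI continuous_intros)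
  then have ind': "indep_vars (\<lambda>_. borel) (\<lambda>r \<omega>. Z r \<omega> ^ ?m r * cnj (Z r \<omega>) ^ ?m' r) R" by simp
  have int: "integrable M (\<lambda>\<omega>. Z r \<omega> ^ ?m r * cnj (Z r \<omega>) ^ ?m' r)" if "r \<in> R" for r
    by (rule std_complex_gaussian_moment(1)[OF Z[OF that]])
  show "integrable M (\<lambda>\<omega>. \<Prod>k\<in>K. Z (a k) \<omega> * cnj (Z (b k) \<omega>))"
    unfolding eq by (rule indep_vars_integrable[OF R ind' int])
  have "expectation (\<lambda>\<omega>. \<Prod>k\<in>K. Z (a k) \<omega> * cnj (Z (b k) \<omega>))
      = (\<Prod>r\<in>R. expectation (\<lambda>\<omega>. Z r \<omega> ^ ?m r * cnj (Z r \<omega>) ^ ?m' r))"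
    unfolding eq by (rule indep_vars_lebesgue_integral[OF R ind' int])
  also have "\<dots> = (\<Prod>r\<in>R. if ?m r = ?m' r then fact (?m r) else 0)"
    by (intro prod.cong refl std_complex_gaussian_moment(2) Z)
  also have "\<dots> = (\<Sum>\<pi> | \<pi> permutes K. of_bool (\<forall>k\<in>K. a k = b (\<pi> k)))"
    unfolding sum_permutations_matching[OF K(1) R K(2,3), symmetric] prod_of_bool[OF K(1)] ..
  finally show "expectation (\<lambda>\<omega>. \<Prod>k\<in>K. Z (a k) \<omega> * cnj (Z (b k) \<omega>))
      = (\<Sum>\<pi> | \<pi> permutes K. of_bool (\<forall>k\<in>K. a k = b (\<pi> k)))" .
qed

end

section \<open>Change of basis\<close>

lemma index_mult_mat_sum:
  assumes "A \<in> carrier_mat m n" "B \<in> carrier_mat n p" "i < m" "j < p"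
  shows "(A * B) $$ (i, j) = (\<Sum>k<n. A $$ (i, k) * B $$ (k, j))"
  using assms by (auto simp: scalar_prod_def atLeast0LessThan intro!: sum.cong)

lemma mat_adjoint_carrier: "A \<in> carrier_mat m n \<Longrightarrow> mat_adjoint A \<in> carrier_mat n m"
  by (auto simp: mat_adjoint_def)

lemma mat_adjoint_index:
  assumes "A \<in> carrier_mat m n" "i < n" "j < m"
  shows "mat_adjoint A $$ (i, j) = cnj (A $$ (j, i))"
  using assms by (simp add: mat_adjoint_def mat_of_rows_def)

lemma mat_trace_mult_commute:
  assumes "A \<in> carrier_mat m n" "B \<in> carrier_mat n m"
  shows "mat_trace (A * B) = mat_trace (B * A)"
proof -
  have "mat_trace (A * B) = (\<Sum>i<m. \<Sum>k<n. A $$ (i, k) * B $$ (k, i))"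
    using assms index_mult_mat_sum[OF assms] by (simp add: mat_trace_def)
  also have "\<dots> = (\<Sum>k<n. \<Sum>i<m. B $$ (k, i) * A $$ (i, k))"
    by (subst sum.swap) (simp add: mult.commute)
  also have "\<dots> = mat_trace (B * A)"
    using assms index_mult_mat_sum[OF assms(2,1)] by (simp add: mat_trace_def)
  finally show ?thesis .
qed

text \<open>Both pairs share the same \<open>P\<close> and \<open>Q\<close>; separate similarities
  would not determine the trace of a product.\<close>

lemma mat_trace_similar_mult:
  assumes "similar_mat_wit A B P Q" "similar_mat_wit C D P Q"
  shows "mat_trace (A * C) = mat_trace (B * D)"
proof -
  define n where "n = dim_row A"
  note D1 = similar_mat_witD[OF n_def assms(1)] and D2 = similar_mat_witD[OF refl assms(2)]
  have "dim_row C = n" using carrier_matD(1)[OF D1(6)] carrier_matD(1)[OF D2(6)] by simp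
  note c = D1(4,5) D2(4,5)[unfolded this] D1(6,7)
  note QP = D1(2) and A = D1(3) and C = D2(3)
  have CP: "C * P = P * D"
  proof -
    have "C * P = P * D * (Q * P)"
      unfolding C by (rule assoc_mult_mat[OF mult_carrier_mat[OF c(5,4)] c(6,5)])
    then show ?thesis using QP right_mult_one_mat[OF mult_carrier_mat[OF c(5,4)]] by simp
  qed
  have "A * C = P * (B * Q) * C"
    unfolding A using assoc_mult_mat[OF c(5,2,6)] by simp
  also have "\<dots> = P * (B * Q * C)"
    by (rule assoc_mult_mat[OF c(5) mult_carrier_mat[OF c(2,6)] c(3)])
  finally have "mat_trace (A * C) = mat_trace (B * Q * C * P)"
    using mat_trace_mult_commute[OF c(5) mult_carrier_mat[OF mult_carrier_mat[OF c(2,6)] c(3)]] by simp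
  also have "B * Q * C * P = B * Q * (P * D)"
    unfolding CP[symmetric] by (rule assoc_mult_mat[OF mult_carrier_mat[OF c(2,6)] c(3,5)])
  also have "\<dots> = B * (Q * (P * D))"
    by (rule assoc_mult_mat[OF c(2,6) mult_carrier_mat[OF c(5,4)]])
  also have "Q * (P * D) = D"
    using assoc_mult_mat[OF c(6,5,4)] QP left_mult_one_mat[OF c(4)] by simp
  finally show ?thesis .
qed

lemma div_mod_lessThan_mult:
  fixes d l :: nat
  assumes "r < d * l"
  shows "r div l < d" "r mod l < l"
  using assms by (auto simp: less_mult_imp_div_less intro!: mod_less_divisor gr0I)

lemma lessThan_mult_index:
  fixes d l :: nat
  assumes "b < d" "p < l"
  shows "b * l + p < d * l" "(b * l + p) div l = b" "(b * l + p) mod l = p"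
proof -
  have "b * l + p < Suc b * l" using assms by simp
  also have "\<dots> \<le> d * l" using assms by (intro mult_le_mono1) simp
  finally show "b * l + p < d * l" .
qed (use assms in auto)

lemma sum_lessThan_mult:
  fixes f :: "nat \<Rightarrow> nat \<Rightarrow> 'c :: comm_monoid_add"
  shows "(\<Sum>u<d * l. f (u div l) (u mod l)) = (\<Sum>b<d. \<Sum>p<l. f b p)"
proof -
  have "(\<Sum>b<d. \<Sum>p<l. f b p) = (\<Sum>(b, p)\<in>{..<d} \<times> {..<l}. f b p)"
    by (rule sum.cartesian_product)
  also have "\<dots> = (\<Sum>u<d * l. f (u div l) (u mod l))"
    by (rule sum.reindex_bij_witness[where j = "\<lambda>(b, p). b * l + p" and i = "\<lambda>u. (u div l, u mod l)"])
      (auto simp: lessThan_mult_index div_mod_lessThan_mult)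
  finally show ?thesis by simp
qed

text \<open>With columns \<open>i\<close> and \<open>j\<close> of \<open>G\<close> reshaped into
  \<open>d\<close> by \<open>d\<close> matrices, this is an entry of the transpose of the first
  times the conjugate of the second.\<close>

definition gram :: "nat \<Rightarrow> complex mat \<Rightarrow> nat \<Rightarrow> nat \<Rightarrow> nat \<Rightarrow> nat \<Rightarrow> complex" where
  "gram d G i j b c = (\<Sum>x<d. G $$ (x * d + b, i) * cnj (G $$ (x * d + c, j)))"

lemma Phi_carrier: "Phi d G X \<in> carrier_mat d d"
  by (simp add: Phi_def partial_trace_fst_def)

lemma Phi_matrix_unit:
  assumes G: "G \<in> carrier_mat (d * d) l" and "i < l" "j < l" "b < d" "c < d"
  shows "Phi d G (matrix_unit l i j) $$ (b, c) = gram d G i j b c"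
proof -
  have E: "matrix_unit l i j \<in> carrier_mat l l" by (simp add: matrix_unit_def)
  have "(G * matrix_unit l i j * mat_adjoint G) $$ (r, s) = G $$ (r, i) * cnj (G $$ (s, j))"
    if rs: "r < d * d" "s < d * d" for r s
  proof -
    have GE: "(G * matrix_unit l i j) $$ (r, t) = (if t = j then G $$ (r, i) else 0)" if t: "t < l" for t
    proof -
      have "(G * matrix_unit l i j) $$ (r, t) = (\<Sum>k<l. G $$ (r, k) * matrix_unit l i j $$ (k, t))"
        by (rule index_mult_mat_sum[OF G E rs(1) t])
      also have "\<dots> = (\<Sum>k<l. if k = i then if t = j then G $$ (r, i) else 0 else 0)"
        using t by (intro sum.cong) (auto simp: matrix_unit_def)
      also have "\<dots> = (if t = j then G $$ (r, i) else 0)" using \<open>i < l\<close> by simp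
      finally show ?thesis .
    qed
    have "(G * matrix_unit l i j * mat_adjoint G) $$ (r, s)
        = (\<Sum>t<l. (G * matrix_unit l i j) $$ (r, t) * mat_adjoint G $$ (t, s))"
      using G E rs by (intro index_mult_mat_sum mat_adjoint_carrier) auto
    also have "\<dots> = (\<Sum>t<l. if t = j then G $$ (r, i) * cnj (G $$ (s, j)) else 0)"
      using GE mat_adjoint_index[OF G] rs by (intro sum.cong) auto
    also have "\<dots> = G $$ (r, i) * cnj (G $$ (s, j))" using \<open>j < l\<close> by simp
    finally show ?thesis .
  qed
  then show ?thesis
    using assms(4,5) by (simp add: Phi_def partial_trace_fst_def gram_def lessThan_mult_index)
qed

text \<open>The entries of the symmetric matrix \<open>S\<close>. There is no conjugate, so this is
  the identity for a real orthonormal basis but not in general.\<close>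

definition basis_gram :: "nat \<Rightarrow> (nat \<Rightarrow> complex vec) \<Rightarrow> nat \<Rightarrow> nat \<Rightarrow> complex" where
  "basis_gram l e i a = (\<Sum>k<l. e k $ i * e k $ a)"

lemma basis_gram_commute: "basis_gram l e i a = basis_gram l e a i"
  by (simp add: basis_gram_def mult.commute)

lemma Omega_vec_index:
  assumes e: "orthonormal_basis l e" and "i < l" "a < l"
  shows "Omega_vec l e $ (i * l + a) = basis_gram l e i a"
proof -
  have "dim_vec (e k) = l" if "k < l" for k using e that by (auto simp: orthonormal_basis_def)
  then show ?thesis
    using assms(2,3) lessThan_mult_index[of i l a l]
    by (simp add: Omega_vec_def basis_gram_def tensor_vec_def)
qed

lemma orthonormal_basis_sum:
  assumes "orthonormal_basis l e" "i < l" "j < l"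
  shows "(\<Sum>a<l. e i $ a * cnj (e j $ a)) = of_bool (i = j)"
proof -
  have c: "e i \<in> carrier_vec l" "e j \<in> carrier_vec l" and "e i \<bullet>c e j = (if i = j then 1 else 0)"
    using assms by (auto simp: orthonormal_basis_def)
  then show ?thesis by (simp add: scalar_prod_def atLeast0LessThan)
qed

text \<open>Orthonormality says that the adjoint of the matrix with columns \<open>e k\<close> is a
  left inverse; for a square matrix it is also a right inverse.\<close>

lemma orthonormal_basis_complete:
  assumes e: "orthonormal_basis l e" and ij: "i < l" "j < l"
  shows "(\<Sum>k<l. e k $ i * cnj (e k $ j)) = of_bool (i = j)"
proof -
  define F where "F = mat l l (\<lambda>(k, i). cnj (e k $ i))"
  define E where "E = mat l l (\<lambda>(i, k). e k $ i)"
  have c: "F \<in> carrier_mat l l" "E \<in> carrier_mat l l" by (auto simp: F_def E_def)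
  have "F * E = 1\<^sub>m l"
  proof (rule eq_matI)
    fix k m assume "k < dim_row (1\<^sub>m l)" "m < dim_col (1\<^sub>m l)"
    then have km: "k < l" "m < l" by auto
    have "(F * E) $$ (k, m) = (\<Sum>i<l. e m $ i * cnj (e k $ i))"
      unfolding index_mult_mat_sum[OF c km] using km by (intro sum.cong) (auto simp: F_def E_def)
    then show "(F * E) $$ (k, m) = 1\<^sub>m l $$ (k, m)"
      using orthonormal_basis_sum[OF e km(2,1)] km by simp
  qed (use c in auto)
  then have "E * F = 1\<^sub>m l" using mat_mult_left_right_inverse c by blast
  moreover have "(E * F) $$ (i, j) = (\<Sum>k<l. e k $ i * cnj (e k $ j))"
    unfolding index_mult_mat_sum[OF c(2,1) ij] using ij by (intro sum.cong) (auto simp: F_def E_def)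
  moreover have "1\<^sub>m l $$ (i, j) = (of_bool (i = j) :: complex)" using ij by simp
  ultimately show ?thesis by metis
qed

lemma basis_gram_unitary:
  assumes e: "orthonormal_basis l e" and ij: "i < l" "j < l"
  shows "(\<Sum>a<l. basis_gram l e i a * cnj (basis_gram l e j a)) = of_bool (i = j)"
proof -
  have "(\<Sum>a<l. basis_gram l e i a * cnj (basis_gram l e j a))
      = (\<Sum>a<l. \<Sum>k<l. \<Sum>m<l. (e k $ i * cnj (e m $ j)) * (e k $ a * cnj (e m $ a)))"
    unfolding basis_gram_def cnj_sum sum_product by (simp add: mult_ac)
  also have "\<dots> = (\<Sum>k<l. \<Sum>a<l. \<Sum>m<l. (e k $ i * cnj (e m $ j)) * (e k $ a * cnj (e m $ a)))"
    by (rule sum.swap)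
  also have "\<dots> = (\<Sum>k<l. \<Sum>m<l. (e k $ i * cnj (e m $ j)) * (\<Sum>a<l. e k $ a * cnj (e m $ a)))"
    unfolding sum_distrib_left by (intro sum.cong[OF refl] sum.swap)
  also have "\<dots> = (\<Sum>k<l. \<Sum>m<l. if k = m then e k $ i * cnj (e m $ j) else 0)"
    using orthonormal_basis_sum[OF e] by (intro sum.cong refl) auto
  also have "\<dots> = (\<Sum>k<l. e k $ i * cnj (e k $ j))" by (intro sum.cong refl) (simp add: sum.delta)
  also have "\<dots> = of_bool (i = j)" by (rule orthonormal_basis_complete[OF e ij])
  finally show ?thesis .
qed

text \<open>The map \<open>H\<close> is left general to cover both the identity and
  \<open>Psi\<close>.\<close>

lemma tensor_map_omega_index:
  assumes e: "orthonormal_basis l e" and G: "G \<in> carrier_mat (d * d) l"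
    and H: "\<And>a b. a < l \<Longrightarrow> b < l \<Longrightarrow> H (matrix_unit l a b) \<in> carrier_mat l l"
    and rs: "r < d * l" "s < d * l"
  shows "tensor_map l d (Phi d G) l l H (omega_mat l e) $$ (r, s) =
    (\<Sum>i<l. \<Sum>j<l. gram d G i j (r div l) (s div l) * (\<Sum>a<l. \<Sum>b<l.
      basis_gram l e i a * cnj (basis_gram l e j b) * H (matrix_unit l a b) $$ (r mod l, s mod l)))"
proof -
  note dm = div_mod_lessThan_mult[OF rs(1)] div_mod_lessThan_mult[OF rs(2)]
  have dims: "dim_row (Phi d G X) = d" "dim_col (Phi d G X) = d" for X
    using Phi_carrier[of d G X] by auto
  have om: "omega_mat l e $$ (i * l + a, j * l + b) = basis_gram l e i a * cnj (basis_gram l e j b)"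
    if "i < l" "j < l" "a < l" "b < l" for i j a b
    using that Omega_vec_index[OF e] lessThan_mult_index(1) by (simp add: omega_mat_def)
  have ten: "tensor_mat (Phi d G (matrix_unit l i j)) (H (matrix_unit l a b)) $$ (r, s)
      = gram d G i j (r div l) (s div l) * H (matrix_unit l a b) $$ (r mod l, s mod l)"
    if "i < l" "j < l" "a < l" "b < l" for i j a b
    using that H[of a b] rs dm Phi_matrix_unit[OF G that(1,2)] by (simp add: tensor_mat_def dims)
  have "tensor_map l d (Phi d G) l l H (omega_mat l e) $$ (r, s) =
    (\<Sum>i<l. \<Sum>j<l. \<Sum>a<l. \<Sum>b<l. gram d G i j (r div l) (s div l) *
      (basis_gram l e i a * cnj (basis_gram l e j b) * H (matrix_unit l a b) $$ (r mod l, s mod l)))"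
    unfolding tensor_map_def using rs by (auto simp: om ten mult_ac intro!: sum.cong)
  then show ?thesis by (simp only: sum_distrib_left)
qed

lemma sum_matrix_unit:
  assumes "a0 < l" "b0 < l"
  shows "(\<Sum>a<l. \<Sum>b<l. f a b * matrix_unit l a b $$ (a0, b0)) = f a0 b0"
proof -
  have "(\<Sum>a<l. \<Sum>b<l. f a b * matrix_unit l a b $$ (a0, b0))
      = (\<Sum>a<l. if a = a0 then \<Sum>b<l. if b = b0 then f a b else 0 else 0)"
  proof (rule sum.cong[OF refl])
    fix a assume "a \<in> {..<l}"
    have "f a b * matrix_unit l a b $$ (a0, b0) = (if a = a0 then if b = b0 then f a b else 0 else 0)" for b
      using assms by (simp add: matrix_unit_def)
    then show "(\<Sum>b<l. f a b * matrix_unit l a b $$ (a0, b0))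
        = (if a = a0 then \<Sum>b<l. if b = b0 then f a b else 0 else 0)" by simp
  qed
  then show ?thesis using assms by simp
qed

lemma Z0_mat_index:
  assumes e: "orthonormal_basis l e" and G: "G \<in> carrier_mat (d * d) l"
    and rs: "r < d * l" "s < d * l"
  shows "Z0_mat l e d G $$ (r, s) = (\<Sum>i<l. \<Sum>j<l. gram d G i j (r div l) (s div l) *
      (basis_gram l e i (r mod l) * cnj (basis_gram l e j (s mod l))))"
proof -
  note dm = div_mod_lessThan_mult(2)[OF rs(1)] div_mod_lessThan_mult(2)[OF rs(2)]
  have "(\<Sum>a<l. \<Sum>b<l. basis_gram l e i a * cnj (basis_gram l e j b) * id (matrix_unit l a b) $$ (r mod l, s mod l))
     = basis_gram l e i (r mod l) * cnj (basis_gram l e j (s mod l))" for i j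
    using sum_matrix_unit[OF dm, of "\<lambda>a b. basis_gram l e i a * cnj (basis_gram l e j b)"] by simp
  then show ?thesis
    unfolding Z0_mat_def using tensor_map_omega_index[OF e G _ rs, of id]
    by (simp add: matrix_unit_def)
qed

text \<open>The trace in \<open>Psi\<close> keeps only \<open>a = b\<close>, and the unitarity of
  \<open>S\<close> then forces \<open>i = j\<close>: the additional term is the same for every
  orthonormal basis.\<close>

lemma Z_mat_index:
  assumes e: "orthonormal_basis l e" and G: "G \<in> carrier_mat (d * d) l"
    and rs: "r < d * l" "s < d * l"
  shows "Z_mat l e d G $$ (r, s) = Z0_mat l e d G $$ (r, s)
    + of_bool (r mod l = s mod l) * (\<Sum>i<l. gram d G i i (r div l) (s div l))"
proof -
  note dm = div_mod_lessThan_mult(2)[OF rs(1)] div_mod_lessThan_mult(2)[OF rs(2)]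
  let ?g = "\<lambda>i j. gram d G i j (r div l) (s div l)"
  let ?S = "basis_gram l e"
  let ?E = "\<lambda>a b. matrix_unit l a b $$ (r mod l, s mod l)"
  have tr: "mat_trace (matrix_unit l a b) = of_bool (a = b)" if "a < l" for a b
  proof -
    have "mat_trace (matrix_unit l a b) = (\<Sum>i<l. if i = a then of_bool (a = b) else 0)"
      by (auto simp: mat_trace_def matrix_unit_def intro!: sum.cong)
    then show ?thesis using that by simp
  qed
  have psi: "Psi l (matrix_unit l a b) $$ (r mod l, s mod l) = ?E a b + of_bool (a = b) * of_bool (r mod l = s mod l)"
    if "a < l" "b < l" for a b
    using dm tr[OF that(1)] by (simp add: Psi_def matrix_unit_def)
  have c: "Psi l (matrix_unit l a b) \<in> carrier_mat l l" for a b by (simp add: Psi_def matrix_unit_def)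
  have inner: "(\<Sum>a<l. \<Sum>b<l. ?S i a * cnj (?S j b) * Psi l (matrix_unit l a b) $$ (r mod l, s mod l))
     = (\<Sum>a<l. \<Sum>b<l. ?S i a * cnj (?S j b) * id (matrix_unit l a b) $$ (r mod l, s mod l))
       + of_bool (r mod l = s mod l) * of_bool (i = j)" if ij: "i < l" "j < l" for i j
  proof -
    have "(\<Sum>a<l. \<Sum>b<l. ?S i a * cnj (?S j b) * Psi l (matrix_unit l a b) $$ (r mod l, s mod l))
       = (\<Sum>a<l. \<Sum>b<l. ?S i a * cnj (?S j b) * ?E a b
           + (if b = a then of_bool (r mod l = s mod l) * (?S i a * cnj (?S j a)) else 0))"
      by (intro sum.cong refl) (auto simp: psi algebra_simps)
    also have "\<dots> = (\<Sum>a<l. \<Sum>b<l. ?S i a * cnj (?S j b) * ?E a b)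
        + (\<Sum>a<l. of_bool (r mod l = s mod l) * (?S i a * cnj (?S j a)))"
      by (simp add: sum.distrib)
    also have "(\<Sum>a<l. of_bool (r mod l = s mod l) * (?S i a * cnj (?S j a)))
        = of_bool (r mod l = s mod l) * of_bool (i = j)"
      unfolding sum_distrib_left[symmetric] basis_gram_unitary[OF e ij] ..
    finally show ?thesis by simp
  qed
  have "Z_mat l e d G $$ (r, s) = (\<Sum>i<l. \<Sum>j<l. ?g i j *
      (\<Sum>a<l. \<Sum>b<l. ?S i a * cnj (?S j b) * Psi l (matrix_unit l a b) $$ (r mod l, s mod l)))"
    unfolding Z_mat_def by (rule tensor_map_omega_index[where H = "Psi l", OF e G c rs])
  also have "\<dots> = (\<Sum>i<l. \<Sum>j<l. ?g i j *
        (\<Sum>a<l. \<Sum>b<l. ?S i a * cnj (?S j b) * id (matrix_unit l a b) $$ (r mod l, s mod l))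
      + (if j = i then of_bool (r mod l = s mod l) * ?g i i else 0))"
  proof (intro sum.cong refl)
    fix i j assume "i \<in> {..<l}" "j \<in> {..<l}"
    then have ij: "i < l" "j < l" by auto
    show "?g i j * (\<Sum>a<l. \<Sum>b<l. ?S i a * cnj (?S j b) * Psi l (matrix_unit l a b) $$ (r mod l, s mod l))
      = ?g i j * (\<Sum>a<l. \<Sum>b<l. ?S i a * cnj (?S j b) * id (matrix_unit l a b) $$ (r mod l, s mod l))
        + (if j = i then of_bool (r mod l = s mod l) * ?g i i else 0)"
      unfolding inner[OF ij] distrib_left by (cases "i = j") simp_all
  qed
  also have "\<dots> = Z0_mat l e d G $$ (r, s) + (\<Sum>i<l. of_bool (r mod l = s mod l) * ?g i i)"
    unfolding Z0_mat_def
    by (subst tensor_map_omega_index[OF e G _ rs]) (simp_all add: sum.distrib matrix_unit_def)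
  finally show ?thesis by (simp add: sum_distrib_left)
qed

section \<open>Conjugation to the standard basis\<close>

definition Z0_std :: "nat \<Rightarrow> nat \<Rightarrow> complex mat \<Rightarrow> complex mat" where
  "Z0_std d l G = mat (d * l) (d * l) (\<lambda>(r, s). gram d G (r mod l) (s mod l) (r div l) (s div l))"

definition Z_std :: "nat \<Rightarrow> nat \<Rightarrow> complex mat \<Rightarrow> complex mat" where
  "Z_std d l G = mat (d * l) (d * l) (\<lambda>(r, s). gram d G (r mod l) (s mod l) (r div l) (s div l)
     + of_bool (r mod l = s mod l) * (\<Sum>i<l. gram d G i i (r div l) (s div l)))"

text \<open>The tensor product of the identity in dimension \<open>d\<close> with the matrix
  \<open>S\<close>.\<close>

definition basis_change :: "nat \<Rightarrow> nat \<Rightarrow> (nat \<Rightarrow> nat \<Rightarrow> complex) \<Rightarrow> complex mat" where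
  "basis_change d l S = mat (d * l) (d * l)
     (\<lambda>(r, s). if r div l = s div l then S (r mod l) (s mod l) else 0)"

lemma basis_change_mult_index:
  assumes "A \<in> carrier_mat (d * l) m" "r < d * l" "s < m"
  shows "(basis_change d l S * A) $$ (r, s) = (\<Sum>p<l. S (r mod l) p * A $$ (r div l * l + p, s))"
proof -
  define f where "f b p = (if b = r div l then S (r mod l) p * A $$ (b * l + p, s) else 0)" for b p
  note dm = div_mod_lessThan_mult[OF assms(2)]
  have "(basis_change d l S * A) $$ (r, s) = (\<Sum>u<d * l. basis_change d l S $$ (r, u) * A $$ (u, s))"
    using assms by (intro index_mult_mat_sum) (auto simp: basis_change_def)
  also have "\<dots> = (\<Sum>u<d * l. f (u div l) (u mod l))"
    using assms by (intro sum.cong) (auto simp: basis_change_def f_def, metis div_mult_mod_eq)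
  also have "\<dots> = (\<Sum>b<d. if b = r div l then \<Sum>p<l. S (r mod l) p * A $$ (b * l + p, s) else 0)"
    unfolding sum_lessThan_mult by (intro sum.cong) (auto simp: f_def)
  also have "\<dots> = (\<Sum>p<l. S (r mod l) p * A $$ (r div l * l + p, s))" using dm by simp
  finally show ?thesis .
qed

lemma mult_basis_change_index:
  assumes "A \<in> carrier_mat m (d * l)" "r < m" "s < d * l"
  shows "(A * basis_change d l S) $$ (r, s) = (\<Sum>p<l. A $$ (r, s div l * l + p) * S p (s mod l))"
proof -
  define f where "f b p = (if b = s div l then A $$ (r, b * l + p) * S p (s mod l) else 0)" for b p
  note dm = div_mod_lessThan_mult[OF assms(3)]
  have "(A * basis_change d l S) $$ (r, s) = (\<Sum>u<d * l. A $$ (r, u) * basis_change d l S $$ (u, s))"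
    using assms by (intro index_mult_mat_sum) (auto simp: basis_change_def)
  also have "\<dots> = (\<Sum>u<d * l. f (u div l) (u mod l))"
    using assms by (intro sum.cong) (auto simp: basis_change_def f_def, metis div_mult_mod_eq)
  also have "\<dots> = (\<Sum>b<d. if b = s div l then \<Sum>p<l. A $$ (r, b * l + p) * S p (s mod l) else 0)"
    unfolding sum_lessThan_mult by (intro sum.cong) (auto simp: f_def)
  also have "\<dots> = (\<Sum>p<l. A $$ (r, s div l * l + p) * S p (s mod l))" using dm by simp
  finally show ?thesis .
qed

text \<open>As \<open>S\<close> is symmetric, its adjoint is its entrywise conjugate, so
  \<open>Q\<close> inverts \<open>P\<close>. The additional term of \<open>Z_std\<close> acts as the
  identity on the second factor and is therefore unchanged by the conjugation.\<close>

lemma similar_Z_std: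
  assumes e: "orthonormal_basis l e" and G: "G \<in> carrier_mat (d * d) l"
  defines "P \<equiv> basis_change d l (basis_gram l e)"
    and "Q \<equiv> basis_change d l (\<lambda>a b. cnj (basis_gram l e a b))"
  shows "similar_mat_wit (Z0_mat l e d G) (Z0_std d l G) P Q"
    and "similar_mat_wit (Z_mat l e d G) (Z_std d l G) P Q"
proof -
  let ?S = "basis_gram l e"
  have c: "P \<in> carrier_mat (d * l) (d * l)" "Q \<in> carrier_mat (d * l) (d * l)"
    "Z0_mat l e d G \<in> carrier_mat (d * l) (d * l)" "Z_mat l e d G \<in> carrier_mat (d * l) (d * l)"
    "Z0_std d l G \<in> carrier_mat (d * l) (d * l)" "Z_std d l G \<in> carrier_mat (d * l) (d * l)"
    by (auto simp: P_def Q_def basis_change_def Z0_mat_def Z_mat_def tensor_map_def Z0_std_def Z_std_def)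
  have PQ: "P * Q = 1\<^sub>m (d * l)"
  proof (rule eq_matI)
    fix r s assume "r < dim_row (1\<^sub>m (d * l))" "s < dim_col (1\<^sub>m (d * l))"
    then have rs: "r < d * l" "s < d * l" by auto
    note dm = div_mod_lessThan_mult[OF rs(1)] div_mod_lessThan_mult[OF rs(2)]
    have "(P * Q) $$ (r, s) = (\<Sum>p<l. ?S (r mod l) p * Q $$ (r div l * l + p, s))"
      unfolding P_def by (rule basis_change_mult_index[OF c(2) rs])
    also have "\<dots> = (\<Sum>p<l. of_bool (r div l = s div l) * (?S (r mod l) p * cnj (?S (s mod l) p)))"
      using rs dm lessThan_mult_index[OF dm(1)]
      by (intro sum.cong) (auto simp: Q_def basis_change_def basis_gram_commute[of l e _ "s mod l"])
    also have "\<dots> = of_bool (r div l = s div l) * of_bool (r mod l = s mod l)"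
      unfolding sum_distrib_left[symmetric] basis_gram_unitary[OF e dm(2,4)] ..
    also have "\<dots> = 1\<^sub>m (d * l) $$ (r, s)"
      using rs by (auto simp: of_bool_def) (metis div_mult_mod_eq)
    finally show "(P * Q) $$ (r, s) = 1\<^sub>m (d * l) $$ (r, s)" .
  qed (use c in auto)
  then have QP: "Q * P = 1\<^sub>m (d * l)" using mat_mult_left_right_inverse c by blast
  have conj: "(P * A * Q) $$ (r, s) = (\<Sum>q<l. \<Sum>p<l.
      ?S (r mod l) p * A $$ (r div l * l + p, s div l * l + q) * cnj (?S (s mod l) q))"
    if A: "A \<in> carrier_mat (d * l) (d * l)" and rs: "r < d * l" "s < d * l" for A r s
  proof -
    note dm = div_mod_lessThan_mult[OF rs(1)] div_mod_lessThan_mult[OF rs(2)]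
    have "P * A \<in> carrier_mat (d * l) (d * l)" using A c by simp
    then have "(P * A * Q) $$ (r, s) = (\<Sum>q<l. (P * A) $$ (r, s div l * l + q) * cnj (?S q (s mod l)))"
      unfolding Q_def using rs by (rule mult_basis_change_index)
    also have "\<dots> = (\<Sum>q<l. \<Sum>p<l. ?S (r mod l) p * A $$ (r div l * l + p, s div l * l + q) * cnj (?S (s mod l) q))"
      unfolding sum_distrib_right[symmetric]
      using basis_change_mult_index[OF A rs(1)] lessThan_mult_index(1)[OF dm(3)]
      by (intro sum.cong) (auto simp: P_def basis_gram_commute[of l e _ "s mod l"])
    finally show ?thesis .
  qed
  have Z0: "Z0_mat l e d G $$ (r, s) = (\<Sum>q<l. \<Sum>p<l.
      ?S (r mod l) p * gram d G p q (r div l) (s div l) * cnj (?S (s mod l) q))"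
    if rs: "r < d * l" "s < d * l" for r s
  proof -
    have "Z0_mat l e d G $$ (r, s) = (\<Sum>p<l. \<Sum>q<l. gram d G p q (r div l) (s div l) *
      (?S p (r mod l) * cnj (?S q (s mod l))))" by (rule Z0_mat_index[OF e G rs])
    also have "\<dots> = (\<Sum>q<l. \<Sum>p<l. gram d G p q (r div l) (s div l) *
      (?S p (r mod l) * cnj (?S q (s mod l))))" by (rule sum.swap)
    finally show ?thesis
      by (simp add: mult_ac basis_gram_commute[of l e _ "s mod l"] basis_gram_commute[of l e _ "r mod l"])
  qed
  have "Z0_mat l e d G = P * Z0_std d l G * Q"
  proof (rule eq_matI)
    fix r s assume "r < dim_row (P * Z0_std d l G * Q)" "s < dim_col (P * Z0_std d l G * Q)"
    then have rs: "r < d * l" "s < d * l" using c by auto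
    note dm = div_mod_lessThan_mult[OF rs(1)] div_mod_lessThan_mult[OF rs(2)]
    show "Z0_mat l e d G $$ (r, s) = (P * Z0_std d l G * Q) $$ (r, s)"
      unfolding conj[OF c(5) rs] Z0[OF rs]
      using lessThan_mult_index[OF dm(1)] lessThan_mult_index[OF dm(3)]
      by (intro sum.cong refl) (simp add: Z0_std_def)
  qed (use c in auto)
  then show "similar_mat_wit (Z0_mat l e d G) (Z0_std d l G) P Q"
    by (rule similar_mat_witI[OF PQ QP _ c(3,5,1,2)])
  have "Z_mat l e d G = P * Z_std d l G * Q"
  proof (rule eq_matI)
    fix r s assume "r < dim_row (P * Z_std d l G * Q)" "s < dim_col (P * Z_std d l G * Q)"
    then have rs: "r < d * l" "s < d * l" using c by auto
    note dm = div_mod_lessThan_mult[OF rs(1)] div_mod_lessThan_mult[OF rs(2)]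
    let ?B = "\<Sum>i<l. gram d G i i (r div l) (s div l)"
    have "(P * Z_std d l G * Q) $$ (r, s) = (\<Sum>q<l. \<Sum>p<l.
        ?S (r mod l) p * gram d G p q (r div l) (s div l) * cnj (?S (s mod l) q)
        + (if p = q then ?B * (?S (r mod l) q * cnj (?S (s mod l) q)) else 0))"
      unfolding conj[OF c(6) rs]
    proof (intro sum.cong refl)
      fix p q assume pq: "q \<in> {..<l}" "p \<in> {..<l}"
      have "Z_std d l G $$ (r div l * l + p, s div l * l + q)
          = gram d G p q (r div l) (s div l) + of_bool (p = q) * ?B"
        using lessThan_mult_index[OF dm(1)] lessThan_mult_index[OF dm(3)] pq by (simp add: Z_std_def)
      then show "?S (r mod l) p * Z_std d l G $$ (r div l * l + p, s div l * l + q) * cnj (?S (s mod l) q) =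
          ?S (r mod l) p * gram d G p q (r div l) (s div l) * cnj (?S (s mod l) q)
          + (if p = q then ?B * (?S (r mod l) q * cnj (?S (s mod l) q)) else 0)"
        by (simp add: algebra_simps)
    qed
    also have "\<dots> = Z0_mat l e d G $$ (r, s) + (\<Sum>q<l. ?B * (?S (r mod l) q * cnj (?S (s mod l) q)))"
      unfolding Z0[OF rs] by (simp add: sum.distrib)
    also have "(\<Sum>q<l. ?B * (?S (r mod l) q * cnj (?S (s mod l) q))) = ?B * of_bool (r mod l = s mod l)"
      unfolding sum_distrib_left[symmetric] basis_gram_unitary[OF e dm(2,4)] ..
    finally show "Z_mat l e d G $$ (r, s) = (P * Z_std d l G * Q) $$ (r, s)"
      unfolding Z_mat_index[OF e G rs] by (simp add: mult.commute)
  qed (use c in auto)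
  then show "similar_mat_wit (Z_mat l e d G) (Z_std d l G) P Q"
    by (rule similar_mat_witI[OF PQ QP _ c(4,6,1,2)])
qed

text \<open>Besides changing the basis, this moves the distinguished factor to the end of the
  product, so that it sits at position \<open>n\<close>, the end of the last block.\<close>

lemma mat_trace_Z_std:
  assumes e: "orthonormal_basis l e" and G: "G \<in> carrier_mat (d * d) l"
  shows "mat_trace ((c \<cdot>\<^sub>m Z0_mat l e d G) * (c \<cdot>\<^sub>m Z_mat l e d G) ^\<^sub>m k)
    = mat_trace ((c \<cdot>\<^sub>m Z_std d l G) ^\<^sub>m k * (c \<cdot>\<^sub>m Z0_std d l G))"
proof -
  have "mat_trace ((c \<cdot>\<^sub>m Z0_mat l e d G) * (c \<cdot>\<^sub>m Z_mat l e d G) ^\<^sub>m k)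
      = mat_trace ((c \<cdot>\<^sub>m Z0_std d l G) * (c \<cdot>\<^sub>m Z_std d l G) ^\<^sub>m k)"
    by (rule mat_trace_similar_mult[OF similar_mat_wit_smult[OF similar_Z_std(1)[OF e G]]
        similar_mat_wit_pow[OF similar_mat_wit_smult[OF similar_Z_std(2)[OF e G]]]])
  also have "\<dots> = mat_trace ((c \<cdot>\<^sub>m Z_std d l G) ^\<^sub>m k * (c \<cdot>\<^sub>m Z0_std d l G))"
    by (intro mat_trace_mult_commute[of _ "d * l" "d * l"] pow_carrier_mat) (auto simp: Z_std_def Z0_std_def)
  finally show ?thesis .
qed

section \<open>Expansion of the trace\<close>

lemma PiE_lessThanD: "u \<in> I \<rightarrow>\<^sub>E {..<N :: nat} \<Longrightarrow> k \<in> I \<Longrightarrow> u k < N"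
  using PiE_mem[of u I "\<lambda>_. {..<N}" k] by simp

lemma sum_PiE_insert:
  assumes "x \<notin> S"
  shows "(\<Sum>u\<in>PiE (insert x S) B. f u) = (\<Sum>v\<in>B x. \<Sum>u\<in>PiE S B. f (u(x := v)))"
proof -
  have "(\<Sum>u\<in>PiE (insert x S) B. f u) = (\<Sum>(v, u)\<in>B x \<times> PiE S B. f (u(x := v)))"
    unfolding PiE_insert_eq
    by (subst sum.reindex[OF inj_combinator[OF assms]]) (simp add: case_prod_beta comp_def)
  then show ?thesis by (simp add: sum.cartesian_product)
qed

text \<open>The right factor \<open>A\<close> is arbitrary because the induction absorbs the last
  \<open>C\<close> into it and so lengthens the path at its end.\<close>

lemma pow_mat_mult_index:
  assumes C: "C \<in> carrier_mat N N" and A: "A \<in> carrier_mat N N" and ij: "i < N" "j < N"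
  shows "(C ^\<^sub>m m * A) $$ (i, j) = (\<Sum>u\<in>{1..Suc m} \<rightarrow>\<^sub>E {..<N}. of_bool (u 1 = i) *
    ((\<Prod>k\<in>{1..m}. C $$ (u k, u (Suc k))) * A $$ (u (Suc m), j)) :: complex)"
  using A
proof (induction m arbitrary: A)
  case 0
  have "(C ^\<^sub>m 0 * A) $$ (i, j) = A $$ (i, j)" using C 0 by simp
  also have "\<dots> = (\<Sum>v<N. if v = i then A $$ (v, j) else 0)" using ij by simp
  also have "\<dots> = (\<Sum>v<N. of_bool (v = i) * A $$ (v, j))" by (intro sum.cong) auto
  also have "\<dots> = (\<Sum>u\<in>insert 1 {} \<rightarrow>\<^sub>E {..<N}. of_bool (u 1 = i) *
      ((\<Prod>k\<in>{1..0}. C $$ (u k, u (Suc k))) * A $$ (u (Suc 0), j)))"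
    by (subst sum_PiE_insert) (simp_all add: PiE_empty_domain)
  finally show ?case by simp
next
  case (Suc m)
  have CA: "C * A \<in> carrier_mat N N" using C Suc.prems by simp
  have ins: "{1..Suc (Suc m)} = insert (Suc (Suc m)) {1..Suc m}" by auto
  have "C ^\<^sub>m Suc m * A = C ^\<^sub>m m * (C * A)"
    using assoc_mult_mat[OF pow_carrier_mat[OF C] C Suc.prems] by simp
  then have "(C ^\<^sub>m Suc m * A) $$ (i, j) = (\<Sum>u\<in>{1..Suc m} \<rightarrow>\<^sub>E {..<N}. of_bool (u 1 = i) *
      ((\<Prod>k\<in>{1..m}. C $$ (u k, u (Suc k))) * (C * A) $$ (u (Suc m), j)))"
    using Suc.IH[OF CA] by simp
  also have "\<dots> = (\<Sum>u\<in>{1..Suc m} \<rightarrow>\<^sub>E {..<N}. \<Sum>v<N. of_bool (u 1 = i) *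
      ((\<Prod>k\<in>{1..m}. C $$ (u k, u (Suc k))) * (C $$ (u (Suc m), v) * A $$ (v, j))))"
  proof (rule sum.cong[OF refl])
    fix u assume "u \<in> {1..Suc m} \<rightarrow>\<^sub>E {..<N}"
    then have "u (Suc m) < N" by (rule PiE_lessThanD) simp
    then have "(C * A) $$ (u (Suc m), j) = (\<Sum>v<N. C $$ (u (Suc m), v) * A $$ (v, j))"
      using index_mult_mat_sum[OF C Suc.prems] ij by simp
    then show "of_bool (u 1 = i) * ((\<Prod>k\<in>{1..m}. C $$ (u k, u (Suc k))) * (C * A) $$ (u (Suc m), j))
      = (\<Sum>v<N. of_bool (u 1 = i) *
          ((\<Prod>k\<in>{1..m}. C $$ (u k, u (Suc k))) * (C $$ (u (Suc m), v) * A $$ (v, j))))"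
      by (simp only: sum_distrib_left)
  qed
  also have "\<dots> = (\<Sum>v<N. \<Sum>u\<in>{1..Suc m} \<rightarrow>\<^sub>E {..<N}. of_bool (u 1 = i) *
      ((\<Prod>k\<in>{1..m}. C $$ (u k, u (Suc k))) * (C $$ (u (Suc m), v) * A $$ (v, j))))"
    by (rule sum.swap)
  also have "\<dots> = (\<Sum>u\<in>{1..Suc (Suc m)} \<rightarrow>\<^sub>E {..<N}. of_bool (u 1 = i) *
    ((\<Prod>k\<in>{1..Suc m}. C $$ (u k, u (Suc k))) * A $$ (u (Suc (Suc m)), j)))"
    unfolding ins
  proof (subst sum_PiE_insert, simp, intro sum.cong refl)
    fix v :: nat and u :: "nat \<Rightarrow> nat"
    let ?u = "u(Suc (Suc m) := v)"
    have "(\<Prod>k\<in>{1..Suc m}. C $$ (?u k, ?u (Suc k))) = (\<Prod>k\<in>{1..m}. C $$ (u k, u (Suc k))) * C $$ (u (Suc m), v)"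
      by (simp add: atLeastAtMostSuc_conv mult.commute)
    then show "of_bool (u 1 = i) * ((\<Prod>k\<in>{1..m}. C $$ (u k, u (Suc k))) * (C $$ (u (Suc m), v) * A $$ (v, j)))
      = of_bool (?u 1 = i) * ((\<Prod>k\<in>{1..Suc m}. C $$ (?u k, ?u (Suc k))) * A $$ (?u (Suc (Suc m)), j))"
      by (simp add: mult_ac)
  qed
  finally show ?case .
qed

text \<open>Taking the trace closes the index path, so the column index at position \<open>k\<close>
  is the row index at \<open>long_cycle n k\<close>.\<close>

lemma mat_trace_pow_mult:
  assumes n: "1 \<le> n" and C: "C \<in> carrier_mat N N" and A: "A \<in> carrier_mat N N"
  shows "mat_trace (C ^\<^sub>m (n - 1) * A) = (\<Sum>u\<in>{1..n} \<rightarrow>\<^sub>E {..<N}.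
    \<Prod>k\<in>{1..n}. (if k = n then A else C) $$ (u k, u (long_cycle n k)))"
proof -
  obtain m where m: "n = Suc m" using n by (cases n) auto
  have "mat_trace (C ^\<^sub>m m * A) = (\<Sum>i<N. \<Sum>u\<in>{1..Suc m} \<rightarrow>\<^sub>E {..<N}. of_bool (u 1 = i) *
      ((\<Prod>k\<in>{1..m}. C $$ (u k, u (Suc k))) * A $$ (u (Suc m), i)))"
    using C pow_mat_mult_index[OF C A] by (simp add: mat_trace_def)
  also have "\<dots> = (\<Sum>u\<in>{1..Suc m} \<rightarrow>\<^sub>E {..<N}. \<Sum>i<N. of_bool (u 1 = i) *
      ((\<Prod>k\<in>{1..m}. C $$ (u k, u (Suc k))) * A $$ (u (Suc m), i)))"
    by (rule sum.swap)
  also have "\<dots> = (\<Sum>u\<in>{1..Suc m} \<rightarrow>\<^sub>E {..<N}.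
      \<Prod>k\<in>{1..Suc m}. (if k = Suc m then A else C) $$ (u k, u (long_cycle (Suc m) k)))"
  proof (rule sum.cong[OF refl])
    fix u assume "u \<in> {1..Suc m} \<rightarrow>\<^sub>E {..<N}"
    then have u1: "u 1 < N" by (rule PiE_lessThanD) simp
    have eq: "(\<Prod>k\<in>{1..m}. C $$ (u k, u (Suc k)))
        = (\<Prod>k\<in>{1..m}. (if k = Suc m then A else C) $$ (u k, u (long_cycle (Suc m) k)))"
      by (intro prod.cong) (auto simp: long_cycle_def)
    have "(\<Sum>i<N. of_bool (u 1 = i) * ((\<Prod>k\<in>{1..m}. C $$ (u k, u (Suc k))) * A $$ (u (Suc m), i)))
      = (\<Sum>i<N. if i = u 1 then (\<Prod>k\<in>{1..m}. C $$ (u k, u (Suc k))) * A $$ (u (Suc m), i) else 0)"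
      by (intro sum.cong) auto
    also have "\<dots> = (\<Prod>k\<in>{1..m}. C $$ (u k, u (Suc k))) * A $$ (u (Suc m), u 1)" using u1 by simp
    also have "\<dots> = (\<Prod>k\<in>{1..Suc m}. (if k = Suc m then A else C) $$ (u k, u (long_cycle (Suc m) k)))"
      unfolding eq by (simp add: atLeastAtMostSuc_conv long_cycle_def mult.commute)
    finally show "(\<Sum>i<N. of_bool (u 1 = i) * ((\<Prod>k\<in>{1..m}. C $$ (u k, u (Suc k))) * A $$ (u (Suc m), i)))
      = (\<Prod>k\<in>{1..Suc m}. (if k = Suc m then A else C) $$ (u k, u (long_cycle (Suc m) k)))" .
  qed
  finally show ?thesis using m by simp
qed

lemma sum_PiE_lessThan_mult:
  fixes d l :: nat
  shows "(\<Sum>u\<in>I \<rightarrow>\<^sub>E {..<d * l}. h u)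
    = (\<Sum>b\<in>I \<rightarrow>\<^sub>E {..<d}. \<Sum>p\<in>I \<rightarrow>\<^sub>E {..<l}. h (\<lambda>k\<in>I. b k * l + p k))"
proof -
  have *: "b k < d \<and> p k < l" if "k \<in> I" "b \<in> I \<rightarrow>\<^sub>E {..<d}" "p \<in> I \<rightarrow>\<^sub>E {..<l}" for b p k
    using PiE_lessThanD[OF that(2,1)] PiE_lessThanD[OF that(3,1)] by simp
  have "(\<Sum>b\<in>I \<rightarrow>\<^sub>E {..<d}. \<Sum>p\<in>I \<rightarrow>\<^sub>E {..<l}. h (\<lambda>k\<in>I. b k * l + p k))
    = (\<Sum>(b, p)\<in>(I \<rightarrow>\<^sub>E {..<d}) \<times> (I \<rightarrow>\<^sub>E {..<l}). h (\<lambda>k\<in>I. b k * l + p k))"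
    by (rule sum.cartesian_product)
  also have "\<dots> = (\<Sum>u\<in>I \<rightarrow>\<^sub>E {..<d * l}. h u)"
  proof (rule sum.reindex_bij_witness[where j = "\<lambda>(b, p). \<lambda>k\<in>I. b k * l + p k"
        and i = "\<lambda>u. (\<lambda>k\<in>I. u k div l, \<lambda>k\<in>I. u k mod l)"])
    fix bp assume "bp \<in> (I \<rightarrow>\<^sub>E {..<d}) \<times> (I \<rightarrow>\<^sub>E {..<l})"
    then obtain b p where bp: "bp = (b, p)" "b \<in> I \<rightarrow>\<^sub>E {..<d}" "p \<in> I \<rightarrow>\<^sub>E {..<l}" by auto
    note * = *[OF _ bp(2,3)] and lm = lessThan_mult_index
    have ext: "b k = undefined" "p k = undefined" if "k \<notin> I" for k
      using bp that by (auto simp: PiE_def extensional_def)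
    have dm: "(b k * l + p k) div l = b k" "(b k * l + p k) mod l = p k" if "k \<in> I" for k
      using *[OF that] lm(2,3) by blast+
    have "(\<lambda>k\<in>I. (\<lambda>k\<in>I. b k * l + p k) k div l) = b"
    proof
      show "(\<lambda>k\<in>I. (\<lambda>k\<in>I. b k * l + p k) k div l) k = b k" for k
        by (cases "k \<in> I") (simp_all only: restrict_apply if_True if_False ext dm not_False_eq_True)
    qed
    moreover have "(\<lambda>k\<in>I. (\<lambda>k\<in>I. b k * l + p k) k mod l) = p"
    proof
      show "(\<lambda>k\<in>I. (\<lambda>k\<in>I. b k * l + p k) k mod l) k = p k" for k
        by (cases "k \<in> I") (simp_all only: restrict_apply if_True if_False ext dm not_False_eq_True)
    qed
    ultimately show "(\<lambda>u. (\<lambda>k\<in>I. u k div l, \<lambda>k\<in>I. u k mod l)) ((\<lambda>(b, p). \<lambda>k\<in>I. b k * l + p k) bp) = bp"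
      unfolding bp(1) prod.case by (simp only:)
    show "(\<lambda>(b, p). \<lambda>k\<in>I. b k * l + p k) bp \<in> I \<rightarrow>\<^sub>E {..<d * l}"
      unfolding bp(1) using * lm(1) by auto
    show "h ((\<lambda>(b, p). \<lambda>k\<in>I. b k * l + p k) bp) = (case bp of (b, p) \<Rightarrow> h (\<lambda>k\<in>I. b k * l + p k))"
      unfolding bp(1) by simp
  next
    fix u assume u: "u \<in> I \<rightarrow>\<^sub>E {..<d * l}"
    then have ext: "u k = undefined" if "k \<notin> I" for k
      using that by (auto simp: PiE_def extensional_def)
    show "(\<lambda>(b, p). \<lambda>k\<in>I. b k * l + p k) ((\<lambda>u. (\<lambda>k\<in>I. u k div l, \<lambda>k\<in>I. u k mod l)) u) = u"
      using ext by (auto simp: fun_eq_iff restrict_def)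
    have "u k div l < d" "u k mod l < l" if "k \<in> I" for k
      using div_mod_lessThan_mult[OF PiE_lessThanD[OF u that]] by auto
    then show "(\<lambda>u. (\<lambda>k\<in>I. u k div l, \<lambda>k\<in>I. u k mod l)) u \<in> (I \<rightarrow>\<^sub>E {..<d}) \<times> (I \<rightarrow>\<^sub>E {..<l})"
      by auto
  qed
  finally show ?thesis by simp
qed

text \<open>Both summands of \<open>Z_std\<close> are brought to one shape, with \<open>s\<close>
  telling which of them is chosen. In the first, \<open>i\<close> is a dummy index pinned to
  \<open>p\<close>; in the second it is the index of the partial trace. The common shape allows a
  product of sums to be expanded uniformly.\<close>

lemma Z_std_expand:
  assumes "b < d" "b' < d" "p < l" "p' < l"
  shows "(c \<cdot>\<^sub>m (if z0 then Z0_std d l G else Z_std d l G)) $$ (b * l + p, b' * l + p') =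
    (\<Sum>s\<in>(if z0 then {True} else UNIV). \<Sum>i<l. \<Sum>x<d. of_bool (if s then i = p else p = p') *
      (c * (G $$ (x * d + b, i) * cnj (G $$ (x * d + b', if s then p' else i)))))"
proof -
  note lm = lessThan_mult_index[OF assms(1,3)] lessThan_mult_index[OF assms(2,4)]
  have T: "(\<Sum>i<l. \<Sum>x<d. of_bool (i = p) * (c * (G $$ (x * d + b, i) * cnj (G $$ (x * d + b', p')))))
      = c * gram d G p p' b b'"
  proof -
    have "(\<Sum>i<l. \<Sum>x<d. of_bool (i = p) * (c * (G $$ (x * d + b, i) * cnj (G $$ (x * d + b', p')))))
      = (\<Sum>i<l. if i = p then \<Sum>x<d. c * (G $$ (x * d + b, i) * cnj (G $$ (x * d + b', p'))) else 0)"
      by (intro sum.cong) auto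
    then show ?thesis using assms(3) by (simp add: gram_def sum_distrib_left)
  qed
  have F: "(\<Sum>i<l. \<Sum>x<d. of_bool (p = p') * (c * (G $$ (x * d + b, i) * cnj (G $$ (x * d + b', i)))))
      = c * (of_bool (p = p') * (\<Sum>i<l. gram d G i i b b'))"
    by (simp add: gram_def sum_distrib_left)
  show ?thesis
  proof (cases z0)
    case True
    then show ?thesis using T lm by (simp add: Z0_std_def)
  next
    case False
    then show ?thesis using T F lm by (simp add: Z_std_def UNIV_bool distrib_left)
  qed
qed

lemma next_end_Suc:
  assumes T: "T \<in> end_sets n" and "k < n" "k \<notin> T"
  shows "next_end T (Suc k) = next_end T k"
proof (rule antisym)
  have "k \<noteq> next_end T k" using next_end(1)[OF T, of k] assms by auto
  then show "next_end T (Suc k) \<le> next_end T k"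
    using next_end[OF T, of k] next_end(3)[OF T, of "Suc k" "next_end T k"] assms by simp
  show "next_end T k \<le> next_end T (Suc k)"
    using next_end[OF T, of "Suc k"] next_end(3)[OF T, of k] assms by simp
qed

text \<open>At an end, \<open>p\<close> is pinned to \<open>i\<close>; elsewhere it agrees with its
  value at the next position. Descending from \<open>n\<close>, this fixes \<open>p\<close>
  completely, so summing it out leaves one term and keeps \<open>i\<close> free.\<close>

lemma ends_determine_indices:
  assumes T: "T \<in> end_sets n" and i: "i \<in> {1..n} \<rightarrow>\<^sub>E {..<l}" and p: "p \<in> {1..n} \<rightarrow>\<^sub>E {..<l}"
  shows "(\<forall>k\<in>{1..n}. if k \<in> T then i k = p k else p k = p (long_cycle n k))
    \<longleftrightarrow> p = (\<lambda>k\<in>{1..n}. i (next_end T k))"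
proof
  assume R: "p = (\<lambda>k\<in>{1..n}. i (next_end T k))"
  show "\<forall>k\<in>{1..n}. if k \<in> T then i k = p k else p k = p (long_cycle n k)"
  proof
    fix k assume k: "k \<in> {1..n}"
    show "if k \<in> T then i k = p k else p k = p (long_cycle n k)"
    proof (cases "k \<in> T")
      case True
      then show ?thesis using k next_end_self[OF T] unfolding R by simp
    next
      case False
      then have "k < n" using k T by (cases "k = n") (auto simp: end_sets_def)
      then show ?thesis using k False next_end_Suc[OF T _ False] unfolding R by (simp add: long_cycle_def)
    qed
  qed
next
  assume L: "\<forall>k\<in>{1..n}. if k \<in> T then i k = p k else p k = p (long_cycle n k)"
  have "p k = i (next_end T k)" if "1 \<le> k" "k \<le> n" for k
    using that(2,1)
  proof (induction k rule: inc_induct)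
    case base
    have "n \<in> T" using T by (simp add: end_sets_def)
    then show ?case using L base next_end_self[OF T] by auto
  next
    case (step k)
    show ?case
    proof (cases "k \<in> T")
      case True
      then show ?thesis using L step next_end_self[OF T] by auto
    next
      case False
      then have "p k = p (Suc k)" using L step by (auto simp: long_cycle_def)
      then show ?thesis using step next_end_Suc[OF T _ False] by simp
    qed
  qed
  then show "p = (\<lambda>k\<in>{1..n}. i (next_end T k))"
    using p by (auto simp: fun_eq_iff restrict_def PiE_def extensional_def)
qed

lemma sum_of_bool_eq_mult:
  "finite A \<Longrightarrow> a \<in> A \<Longrightarrow> (\<Sum>x\<in>A. of_bool (x = a) * f x) = (f a :: 'c :: semiring_1)"
proof -
  assume "finite A" "a \<in> A"
  moreover have "(\<Sum>x\<in>A. of_bool (x = a) * f x) = (\<Sum>x\<in>A. if x = a then f x else 0)"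
    by (intro sum.cong) auto
  ultimately show ?thesis by simp
qed

lemma mat_trace_Z_std_expand:
  assumes n: "1 \<le> n"
  shows "mat_trace ((c \<cdot>\<^sub>m Z_std d l G) ^\<^sub>m (n - 1) * (c \<cdot>\<^sub>m Z0_std d l G)) =
    c ^ n * (\<Sum>T\<in>end_sets n. \<Sum>b\<in>{1..n} \<rightarrow>\<^sub>E {..<d}. \<Sum>i\<in>{1..n} \<rightarrow>\<^sub>E {..<l}. \<Sum>x\<in>{1..n} \<rightarrow>\<^sub>E {..<d}.
      \<Prod>k\<in>{1..n}. G $$ (x k * d + b k, i k) *
        cnj (G $$ (x k * d + b (long_cycle n k), i (ends_cycle n T k))))"
proof -
  let ?I = "{1..n}"
  let ?PD = "?I \<rightarrow>\<^sub>E {..<d}" and ?PL = "?I \<rightarrow>\<^sub>E {..<l}"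
  let ?\<gamma> = "long_cycle n"
  have lc: "?\<gamma> k \<in> ?I" if "k \<in> ?I" for k using permutes_in_image[OF long_cycle_permutes] that by blast
  have fin: "finite ?PD" "finite ?PL" by (auto intro!: finite_PiE)
  \<comment> \<open>The last factor offers no choice; the selections then correspond to the sets in
    \<open>end_sets n\<close>.\<close>
  define S where "S k = (if k = n then {True} else UNIV)" for k
  define t where "t b p k s i x = of_bool (if s then i = p k else p k = p (?\<gamma> k)) *
      (c * (G $$ (x * d + b k, i) * cnj (G $$ (x * d + b (?\<gamma> k), if s then p (?\<gamma> k) else i))))"
    for b p :: "nat \<Rightarrow> nat" and k i x :: nat and s
  define F where "F T b i x = (\<Prod>k\<in>?I. G $$ (x k * d + b k, i k) *
        cnj (G $$ (x k * d + b (?\<gamma> k), i (ends_cycle n T k))))" for T and b i x :: "nat \<Rightarrow> nat"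
  have "mat_trace ((c \<cdot>\<^sub>m Z_std d l G) ^\<^sub>m (n - 1) * (c \<cdot>\<^sub>m Z0_std d l G))
      = (\<Sum>u\<in>?I \<rightarrow>\<^sub>E {..<d * l}. \<Prod>k\<in>?I. (if k = n then c \<cdot>\<^sub>m Z0_std d l G else c \<cdot>\<^sub>m Z_std d l G) $$ (u k, u (?\<gamma> k)))"
    by (rule mat_trace_pow_mult[OF n]) (auto simp: Z_std_def Z0_std_def)
  also have "\<dots> = (\<Sum>b\<in>?PD. \<Sum>p\<in>?PL. \<Prod>k\<in>?I. \<Sum>s\<in>S k. \<Sum>i<l. \<Sum>x<d. t b p k s i x)"
    unfolding sum_PiE_lessThan_mult
  proof (intro sum.cong prod.cong refl)
    fix b p k assume bp: "b \<in> ?PD" "p \<in> ?PL" and k: "k \<in> ?I"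
    have *: "b k < d" "b (?\<gamma> k) < d" "p k < l" "p (?\<gamma> k) < l" using PiE_lessThanD[OF bp(1)] PiE_lessThanD[OF bp(2)] k lc[OF k] by blast+
    show "(if k = n then c \<cdot>\<^sub>m Z0_std d l G else c \<cdot>\<^sub>m Z_std d l G) $$
        ((\<lambda>k\<in>?I. b k * l + p k) k, (\<lambda>k\<in>?I. b k * l + p k) (?\<gamma> k)) = (\<Sum>s\<in>S k. \<Sum>i<l. \<Sum>x<d. t b p k s i x)"
      using Z_std_expand[OF *, of c "k = n" G] k lc[OF k]
      unfolding S_def t_def by (simp only: restrict_apply' if_distrib[of "\<lambda>A. c \<cdot>\<^sub>m A"])
  qed
  \<comment> \<open>Distributivity is used three times, once for each of the inner indices
    \<open>s\<close>, \<open>i\<close> and \<open>x\<close>.\<close>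
  also have "\<dots> = (\<Sum>b\<in>?PD. \<Sum>p\<in>?PL. \<Sum>s\<in>PiE ?I S. \<Sum>i\<in>?PL. \<Sum>x\<in>?PD. \<Prod>k\<in>?I. t b p k (s k) (i k) (x k))"
    by (subst prod_sum_PiE, simp, simp add: S_def)+ simp
  also have "\<dots> = (\<Sum>b\<in>?PD. \<Sum>p\<in>?PL. \<Sum>T\<in>end_sets n. \<Sum>i\<in>?PL. \<Sum>x\<in>?PD. \<Prod>k\<in>?I. t b p k (k \<in> T) (i k) (x k))"
  proof (intro sum.cong refl)
    fix b p
    show "(\<Sum>s\<in>PiE ?I S. \<Sum>i\<in>?PL. \<Sum>x\<in>?PD. \<Prod>k\<in>?I. t b p k (s k) (i k) (x k))
      = (\<Sum>T\<in>end_sets n. \<Sum>i\<in>?PL. \<Sum>x\<in>?PD. \<Prod>k\<in>?I. t b p k (k \<in> T) (i k) (x k))"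
    proof (rule sum.reindex_bij_witness[where j = "\<lambda>s. {k \<in> ?I. s k}" and i = "\<lambda>T. \<lambda>k\<in>?I. k \<in> T"])
      fix s assume s: "s \<in> PiE ?I S"
      show "(\<lambda>k\<in>?I. k \<in> {k \<in> ?I. s k}) = s"
        using s by (auto simp: fun_eq_iff restrict_def PiE_def extensional_def)
      have "s n \<in> S n" using s n by (intro PiE_mem[OF s]) auto
      then show "{k \<in> ?I. s k} \<in> end_sets n" using n by (auto simp: end_sets_def S_def)
      show "(\<Sum>i\<in>?PL. \<Sum>x\<in>?PD. \<Prod>k\<in>?I. t b p k (k \<in> {k \<in> ?I. s k}) (i k) (x k))
        = (\<Sum>i\<in>?PL. \<Sum>x\<in>?PD. \<Prod>k\<in>?I. t b p k (s k) (i k) (x k))"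
        by (intro sum.cong prod.cong refl) simp
    next
      fix T assume T: "T \<in> end_sets n"
      show "{k \<in> ?I. (\<lambda>k\<in>?I. k \<in> T) k} = T" using T by (auto simp: end_sets_def)
      show "(\<lambda>k\<in>?I. k \<in> T) \<in> PiE ?I S" using T by (auto simp: end_sets_def S_def)
    qed
  qed
  also have "\<dots> = (\<Sum>T\<in>end_sets n. \<Sum>b\<in>?PD. \<Sum>i\<in>?PL. \<Sum>x\<in>?PD. \<Sum>p\<in>?PL. \<Prod>k\<in>?I. t b p k (k \<in> T) (i k) (x k))"
  proof -
    have "(\<Sum>p\<in>?PL. \<Sum>T\<in>end_sets n. \<Sum>i\<in>?PL. \<Sum>x\<in>?PD. f p T i x)
      = (\<Sum>T\<in>end_sets n. \<Sum>i\<in>?PL. \<Sum>x\<in>?PD. \<Sum>p\<in>?PL. f p T i x)" for f :: "_ \<Rightarrow> _ \<Rightarrow> _ \<Rightarrow> _ \<Rightarrow> complex"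
    proof -
      have "(\<Sum>p\<in>?PL. \<Sum>T\<in>end_sets n. \<Sum>i\<in>?PL. \<Sum>x\<in>?PD. f p T i x)
        = (\<Sum>T\<in>end_sets n. \<Sum>p\<in>?PL. \<Sum>i\<in>?PL. \<Sum>x\<in>?PD. f p T i x)"
        by (rule sum.swap)
      also have "\<dots> = (\<Sum>T\<in>end_sets n. \<Sum>i\<in>?PL. \<Sum>p\<in>?PL. \<Sum>x\<in>?PD. f p T i x)"
        by (intro sum.cong refl sum.swap)
      also have "\<dots> = (\<Sum>T\<in>end_sets n. \<Sum>i\<in>?PL. \<Sum>x\<in>?PD. \<Sum>p\<in>?PL. f p T i x)"
        by (intro sum.cong refl sum.swap)
      finally show ?thesis .
    qed
    then show ?thesis by (simp only:) (rule sum.swap)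
  qed
  also have "\<dots> = (\<Sum>T\<in>end_sets n. \<Sum>b\<in>?PD. \<Sum>i\<in>?PL. \<Sum>x\<in>?PD. c ^ n * F T b i x)"
  proof (intro sum.cong refl)
    fix T b i x assume T: "T \<in> end_sets n" and i: "i \<in> ?PL"
    let ?p = "\<lambda>k\<in>?I. i (next_end T k)"
    have ne: "next_end T k \<in> ?I" if "k \<in> ?I" for k
      using next_end(1)[OF T, of k] T that by (auto simp: end_sets_def)
    have p: "?p \<in> ?PL" using PiE_lessThanD[OF i ne] by auto
    define H where "H p = (\<Prod>k\<in>?I. c * (G $$ (x k * d + b k, i k) *
      cnj (G $$ (x k * d + b (?\<gamma> k), if k \<in> T then p (?\<gamma> k) else i k))))" for p
    have "(\<Sum>p\<in>?PL. \<Prod>k\<in>?I. t b p k (k \<in> T) (i k) (x k)) = (\<Sum>p\<in>?PL. of_bool (p = ?p) * H p)"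
    proof (rule sum.cong[OF refl])
      fix p assume "p \<in> ?PL"
      from ends_determine_indices[OF T i this]
      show "(\<Prod>k\<in>?I. t b p k (k \<in> T) (i k) (x k)) = of_bool (p = ?p) * H p"
        unfolding t_def H_def prod.distrib prod_of_bool[OF finite_atLeastAtMost] by simp
    qed
    also have "\<dots> = H ?p" by (rule sum_of_bool_eq_mult[OF fin(2) p])
    \<comment> \<open>For \<open>k \<in> T\<close>, the value of \<open>?p\<close> at
      \<open>?\<gamma> k\<close> is \<open>i\<close> at the next end from there on; for other
      \<open>k\<close> the index is \<open>i k\<close>. Both are \<open>i\<close> at
      \<open>ends_cycle n T k\<close>.\<close>
    also have "H ?p = (\<Prod>k\<in>?I. c * (G $$ (x k * d + b k, i k) *
        cnj (G $$ (x k * d + b (?\<gamma> k), i (ends_cycle n T k)))))"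
      unfolding H_def using lc by (intro prod.cong refl) (simp add: ends_cycle_def)
    also have "\<dots> = c ^ n * F T b i x" unfolding F_def prod.distrib[of "\<lambda>_. c"] by simp
    finally show "(\<Sum>p\<in>?PL. \<Prod>k\<in>?I. t b p k (k \<in> T) (i k) (x k)) = c ^ n * F T b i x" .
  qed
  finally show ?thesis unfolding F_def by (simp only: sum_distrib_left)
qed

text \<open>The labellings that survive are constant on orbits, hence correspond to functions on the
  set of orbits by means of chosen representatives.\<close>

lemma sum_constant_on_cycles:
  assumes \<sigma>: "\<sigma> permutes {1..n}"
  shows "(\<Sum>f\<in>{1..n} \<rightarrow>\<^sub>E {..<N}. of_bool (\<forall>k\<in>{1..n}. f k = f (\<sigma> k)))
    = (of_nat N ^ num_cycles n \<sigma> :: 'c :: comm_semiring_1)"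
proof -
  let ?I = "{1..n}"
  let ?O = "orbit \<sigma> ` ?I"
  have p\<sigma>: "permutation \<sigma>" using \<sigma> by (rule permutes_atLeastAtMost_imp_permutation)
  let ?C = "{f \<in> ?I \<rightarrow>\<^sub>E {..<N}. \<forall>k\<in>?I. f k = f (\<sigma> k)}"
  have const: "f y = f k" if f: "\<forall>k\<in>?I. f k = f (\<sigma> k)" and k: "k \<in> ?I" and y: "y \<in> orbit \<sigma> k"
    for f :: "nat \<Rightarrow> nat" and k y
    using y
  proof induction
    case base then show ?case using f k by simp
  next
    case (step y)
    then have "y \<in> ?I" using permutes_orbit_subset[OF \<sigma> k] by blast
    then show ?case using f step.IH by simp
  qed
  have mem: "k \<in> orbit \<sigma> k" for k by (rule permutation_self_in_orbit[OF p\<sigma>])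
  define r where "r Q = (SOME k. k \<in> ?I \<and> orbit \<sigma> k = Q)" for Q
  have r: "r Q \<in> ?I \<and> orbit \<sigma> (r Q) = Q" if "Q \<in> ?O" for Q
  proof -
    have "\<exists>k. k \<in> ?I \<and> orbit \<sigma> k = Q" using that by blast
    then show ?thesis unfolding r_def by (rule someI_ex)
  qed
  have "bij_betw (\<lambda>g. \<lambda>k\<in>?I. g (orbit \<sigma> k)) (?O \<rightarrow>\<^sub>E {..<N}) ?C"
  proof (rule bij_betwI[where g = "\<lambda>f. \<lambda>Q\<in>?O. f (r Q)"])
    show "(\<lambda>g. \<lambda>k\<in>?I. g (orbit \<sigma> k)) \<in> (?O \<rightarrow>\<^sub>E {..<N}) \<rightarrow> ?C"
    proof
      fix g assume g: "g \<in> ?O \<rightarrow>\<^sub>E {..<N}"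
      have "\<sigma> k \<in> ?I" if "k \<in> ?I" for k using permutes_in_image[OF \<sigma>] that by blast
      then show "(\<lambda>k\<in>?I. g (orbit \<sigma> k)) \<in> ?C"
        using PiE_lessThanD[OF g] permutation_orbit_step[OF p\<sigma>] by auto
    qed
    show "(\<lambda>f. \<lambda>Q\<in>?O. f (r Q)) \<in> ?C \<rightarrow> (?O \<rightarrow>\<^sub>E {..<N})"
    proof
      fix f assume "f \<in> ?C"
      then have f: "f \<in> ?I \<rightarrow>\<^sub>E {..<N}" by simp
      show "(\<lambda>Q\<in>?O. f (r Q)) \<in> ?O \<rightarrow>\<^sub>E {..<N}"
      proof (rule restrict_PiE_iff[THEN iffD2], rule ballI)
        fix Q assume "Q \<in> ?O"
        then show "f (r Q) \<in> {..<N}" using PiE_mem[OF f] r by blast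
      qed
    qed
    show "(\<lambda>Q\<in>?O. (\<lambda>k\<in>?I. g (orbit \<sigma> k)) (r Q)) = g" if g: "g \<in> ?O \<rightarrow>\<^sub>E {..<N}" for g
    proof
      fix Q
      show "(\<lambda>Q\<in>?O. (\<lambda>k\<in>?I. g (orbit \<sigma> k)) (r Q)) Q = g Q"
        using r[of Q] PiE_arb[OF g, of Q] by (cases "Q \<in> ?O") auto
    qed
    show "(\<lambda>k\<in>?I. (\<lambda>Q\<in>?O. f (r Q)) (orbit \<sigma> k)) = f" if "f \<in> ?C" for f
    proof
      fix k
      have f: "f \<in> ?I \<rightarrow>\<^sub>E {..<N}" "\<forall>k\<in>?I. f k = f (\<sigma> k)" using that by auto
      show "(\<lambda>k\<in>?I. (\<lambda>Q\<in>?O. f (r Q)) (orbit \<sigma> k)) k = f k"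
      proof (cases "k \<in> ?I")
        case True
        then have "orbit \<sigma> k \<in> ?O" by blast
        then have "r (orbit \<sigma> k) \<in> orbit \<sigma> k" using r mem by metis
        then have "f (r (orbit \<sigma> k)) = f k" by (rule const[OF f(2) True])
        then show ?thesis using True by simp
      next
        case False
        have "f k = undefined" by (rule PiE_arb[OF f(1) False])
        then show ?thesis by (simp only: restrict_apply False if_False)
      qed
    qed
  qed
  then have "card ?C = card (?O \<rightarrow>\<^sub>E {..<N})" by (rule bij_betw_same_card[symmetric])
  also have "\<dots> = N ^ num_cycles n \<sigma>" by (simp add: card_PiE num_cycles_def)
  finally have "card ?C = N ^ num_cycles n \<sigma>" .
  moreover have "(\<Sum>f\<in>?I \<rightarrow>\<^sub>E {..<N}. of_bool (\<forall>k\<in>?I. f k = f (\<sigma> k))) = (of_nat (card ?C) :: 'c)"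
    using sum.inter_filter[of "?I \<rightarrow>\<^sub>E {..<N}" "\<lambda>_. 1 :: 'c" "\<lambda>f. \<forall>k\<in>?I. f k = f (\<sigma> k)"]
    by (simp add: finite_PiE of_bool_def)
  ultimately show ?thesis by simp
qed

text \<open>The pairing conditions decouple: \<open>x\<close> must be constant on the cycles of
  \<pi>, \<open>b\<close> on those of \<open>\<gamma> \<pi>\<close>, and \<open>i\<close> on those
  of \<open>ends_cycle n T \<circ> \<pi>\<close>. Each labelling contributes its range size to the
  power of a cycle count, and the identity is exact for the given \<open>d\<close>.\<close>

lemma (in prob_space) expectation_trace:
  assumes n: "1 \<le> n" and e: "orthonormal_basis l e" and G: "ginibre (d * d) l G"
  shows "(\<integral>\<omega>. mat_trace ((c \<cdot>\<^sub>m Z0_mat l e d (G \<omega>)) * (c \<cdot>\<^sub>m Z_mat l e d (G \<omega>)) ^\<^sub>m (n - 1)) \<partial>M)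
    = c ^ n * (\<Sum>T\<in>end_sets n. \<Sum>\<pi> | \<pi> permutes {1..n}.
        of_nat l ^ num_cycles n (ends_cycle n T \<circ> \<pi>) *
        of_nat d ^ (num_cycles n \<pi> + num_cycles n (long_cycle n \<circ> \<pi>)))"
proof -
  let ?I = "{1..n}"
  let ?PD = "?I \<rightarrow>\<^sub>E {..<d}" and ?PL = "?I \<rightarrow>\<^sub>E {..<l}"
  let ?\<gamma> = "long_cycle n" and ?\<alpha> = "ends_cycle n"
  let ?R = "{..<d * d} \<times> {..<l}"
  have carr: "\<And>\<omega>. \<omega> \<in> space M \<Longrightarrow> G \<omega> \<in> carrier_mat (d * d) l"
    and ind: "indep_vars (\<lambda>_. borel) (\<lambda>rs \<omega>. G \<omega> $$ rs) ?R"
    and std: "\<And>rs. rs \<in> ?R \<Longrightarrow> std_complex_gaussian (\<lambda>\<omega>. G \<omega> $$ rs)"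
    using G by (auto simp: ginibre_def)
  have \<gamma>I: "?\<gamma> k \<in> ?I" if "k \<in> ?I" for k using permutes_in_image[OF long_cycle_permutes] that by blast
  have \<alpha>I: "?\<alpha> T k \<in> ?I" if "T \<in> end_sets n" "k \<in> ?I" for T k
    using permutes_in_image[OF ends_cycle_permutes[OF n that(1)]] that(2) by blast
  define a where "a b i x k = (x k * d + b k, i k)" for b i x :: "nat \<Rightarrow> nat" and k
  define a' where "a' T b i x k = (x k * d + b (?\<gamma> k), i (?\<alpha> T k))" for T and b i x :: "nat \<Rightarrow> nat" and k
  have aR: "a b i x ` ?I \<subseteq> ?R" "a' T b i x ` ?I \<subseteq> ?R"
    if "T \<in> end_sets n" "b \<in> ?PD" "i \<in> ?PL" "x \<in> ?PD" for T b i x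
  proof -
    have "x k < d" "b k < d" "b (?\<gamma> k) < d" "i k < l" "i (?\<alpha> T k) < l" if "k \<in> ?I" for k
      using PiE_lessThanD[OF \<open>b \<in> ?PD\<close>] PiE_lessThanD[OF \<open>i \<in> ?PL\<close>] PiE_lessThanD[OF \<open>x \<in> ?PD\<close>]
        that \<gamma>I[OF that] \<alpha>I[OF \<open>T \<in> end_sets n\<close> that] by blast+
    then show "a b i x ` ?I \<subseteq> ?R" "a' T b i x ` ?I \<subseteq> ?R"
      using lessThan_mult_index(1)[of _ d _ d] by (auto simp: a_def a'_def)
  qed
  have matching: "(\<forall>k\<in>?I. a b i x k = a' T b i x (\<pi> k)) \<longleftrightarrow>
      (\<forall>k\<in>?I. b k = b ((?\<gamma> \<circ> \<pi>) k)) \<and> (\<forall>k\<in>?I. i k = i ((?\<alpha> T \<circ> \<pi>) k)) \<and> (\<forall>k\<in>?I. x k = x (\<pi> k))"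
    if "T \<in> end_sets n" "b \<in> ?PD" "i \<in> ?PL" "x \<in> ?PD" and \<pi>: "\<pi> permutes ?I" for T b i x \<pi>
  proof -
    have "a b i x k = a' T b i x (\<pi> k) \<longleftrightarrow>
      b k = b ((?\<gamma> \<circ> \<pi>) k) \<and> i k = i ((?\<alpha> T \<circ> \<pi>) k) \<and> x k = x (\<pi> k)" if k: "k \<in> ?I" for k
    proof -
      have "\<pi> k \<in> ?I" using permutes_in_image[OF \<pi>] k by blast
      then have "b k < d" "b (?\<gamma> (\<pi> k)) < d" "x k < d" "x (\<pi> k) < d"
        using PiE_lessThanD[OF \<open>b \<in> ?PD\<close>] PiE_lessThanD[OF \<open>x \<in> ?PD\<close>] k \<gamma>I by blast+
      \<comment> \<open>All four labels are below \<open>d\<close>, so the row indices are two-digit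
        numbers in base \<open>d\<close> and can be compared digit by digit.\<close>
      then have "x k * d + b k = x (\<pi> k) * d + b (?\<gamma> (\<pi> k)) \<longleftrightarrow> x k = x (\<pi> k) \<and> b k = b (?\<gamma> (\<pi> k))"
        using lessThan_mult_index(2,3)[of _ d _ d] by metis
      then show ?thesis by (auto simp: a_def a'_def)
    qed
    then show ?thesis by blast
  qed
  define h where "h T b i x = (\<lambda>\<omega>. \<Prod>k\<in>?I. G \<omega> $$ a b i x k * cnj (G \<omega> $$ a' T b i x k))" for T b i x
  have wick: "integrable M (h T b i x)"
      "expectation (h T b i x)
        = (\<Sum>\<pi> | \<pi> permutes ?I. of_bool (\<forall>k\<in>?I. a b i x k = a' T b i x (\<pi> k)))"
    if "T \<in> end_sets n" "b \<in> ?PD" "i \<in> ?PL" "x \<in> ?PD" for T b i x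
    unfolding h_def using complex_gaussian_wick[OF _ ind std _ aR[OF that]] by auto
  have "(\<integral>\<omega>. mat_trace ((c \<cdot>\<^sub>m Z0_mat l e d (G \<omega>)) * (c \<cdot>\<^sub>m Z_mat l e d (G \<omega>)) ^\<^sub>m (n - 1)) \<partial>M)
    = (\<integral>\<omega>. c ^ n * (\<Sum>T\<in>end_sets n. \<Sum>b\<in>?PD. \<Sum>i\<in>?PL. \<Sum>x\<in>?PD. h T b i x \<omega>) \<partial>M)"
  proof (rule Bochner_Integration.integral_cong[OF refl])
    fix \<omega> assume \<omega>: "\<omega> \<in> space M"
    show "mat_trace ((c \<cdot>\<^sub>m Z0_mat l e d (G \<omega>)) * (c \<cdot>\<^sub>m Z_mat l e d (G \<omega>)) ^\<^sub>m (n - 1))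
      = c ^ n * (\<Sum>T\<in>end_sets n. \<Sum>b\<in>?PD. \<Sum>i\<in>?PL. \<Sum>x\<in>?PD. h T b i x \<omega>)"
      unfolding h_def a_def a'_def
      by (rule trans[OF mat_trace_Z_std[OF e carr[OF \<omega>]] mat_trace_Z_std_expand[OF n]])
  qed
  also have "\<dots> = c ^ n * (\<Sum>T\<in>end_sets n. \<Sum>b\<in>?PD. \<Sum>i\<in>?PL. \<Sum>x\<in>?PD.
        \<Sum>\<pi> | \<pi> permutes ?I. of_bool (\<forall>k\<in>?I. a b i x k = a' T b i x (\<pi> k)))"
    by (simp add: wick del: sum_of_bool_eq)
  also have "(\<Sum>T\<in>end_sets n. \<Sum>b\<in>?PD. \<Sum>i\<in>?PL. \<Sum>x\<in>?PD.
        \<Sum>\<pi> | \<pi> permutes ?I. of_bool (\<forall>k\<in>?I. a b i x k = a' T b i x (\<pi> k)))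
      = (\<Sum>T\<in>end_sets n. \<Sum>\<pi> | \<pi> permutes ?I. \<Sum>b\<in>?PD. \<Sum>i\<in>?PL. \<Sum>x\<in>?PD.
          (of_bool (\<forall>k\<in>?I. a b i x k = a' T b i x (\<pi> k)) :: complex))"
  proof (rule sum.cong[OF refl])
    fix T
    have "(\<Sum>b\<in>?PD. \<Sum>i\<in>?PL. \<Sum>x\<in>?PD. \<Sum>\<pi> | \<pi> permutes ?I. f b i x \<pi>)
      = (\<Sum>\<pi> | \<pi> permutes ?I. \<Sum>b\<in>?PD. \<Sum>i\<in>?PL. \<Sum>x\<in>?PD. f b i x \<pi>)"
      for f :: "_ \<Rightarrow> _ \<Rightarrow> _ \<Rightarrow> _ \<Rightarrow> complex"
    proof -
      have "(\<Sum>b\<in>?PD. \<Sum>i\<in>?PL. \<Sum>x\<in>?PD. \<Sum>\<pi> | \<pi> permutes ?I. f b i x \<pi>)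
        = (\<Sum>b\<in>?PD. \<Sum>i\<in>?PL. \<Sum>\<pi> | \<pi> permutes ?I. \<Sum>x\<in>?PD. f b i x \<pi>)"
        by (intro sum.cong refl sum.swap)
      also have "\<dots> = (\<Sum>b\<in>?PD. \<Sum>\<pi> | \<pi> permutes ?I. \<Sum>i\<in>?PL. \<Sum>x\<in>?PD. f b i x \<pi>)"
        by (intro sum.cong refl sum.swap)
      also have "\<dots> = (\<Sum>\<pi> | \<pi> permutes ?I. \<Sum>b\<in>?PD. \<Sum>i\<in>?PL. \<Sum>x\<in>?PD. f b i x \<pi>)"
        by (rule sum.swap)
      finally show ?thesis .
    qed
    then show "(\<Sum>b\<in>?PD. \<Sum>i\<in>?PL. \<Sum>x\<in>?PD.
        \<Sum>\<pi> | \<pi> permutes ?I. (of_bool (\<forall>k\<in>?I. a b i x k = a' T b i x (\<pi> k)) :: complex))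
      = (\<Sum>\<pi> | \<pi> permutes ?I. \<Sum>b\<in>?PD. \<Sum>i\<in>?PL. \<Sum>x\<in>?PD.
          of_bool (\<forall>k\<in>?I. a b i x k = a' T b i x (\<pi> k)))" .
  qed
  also have "\<dots> = (\<Sum>T\<in>end_sets n. \<Sum>\<pi> | \<pi> permutes ?I.
      of_nat l ^ num_cycles n (?\<alpha> T \<circ> \<pi>) * of_nat d ^ (num_cycles n \<pi> + num_cycles n (?\<gamma> \<circ> \<pi>)))"
  proof (intro sum.cong refl)
    fix T \<pi> assume T: "T \<in> end_sets n" and "\<pi> \<in> {\<pi>. \<pi> permutes ?I}"
    then have \<pi>: "\<pi> permutes ?I" by simp
    let ?B = "\<lambda>b. of_bool (\<forall>k\<in>?I. b k = b ((?\<gamma> \<circ> \<pi>) k)) :: complex"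
    let ?L = "\<lambda>i. of_bool (\<forall>k\<in>?I. i k = i ((?\<alpha> T \<circ> \<pi>) k)) :: complex"
    let ?X = "\<lambda>x. of_bool (\<forall>k\<in>?I. x k = x (\<pi> k)) :: complex"
    have "(\<Sum>b\<in>?PD. \<Sum>i\<in>?PL. \<Sum>x\<in>?PD. of_bool (\<forall>k\<in>?I. a b i x k = a' T b i x (\<pi> k)))
        = (\<Sum>b\<in>?PD. \<Sum>i\<in>?PL. \<Sum>x\<in>?PD. ?B b * (?L i * ?X x))"
      by (intro sum.cong refl) (simp only: matching[OF T _ _ _ \<pi>] of_bool_conj)
    also have "\<dots> = (\<Sum>b\<in>?PD. ?B b) * ((\<Sum>i\<in>?PL. ?L i) * (\<Sum>x\<in>?PD. ?X x))"
      by (simp only: sum_distrib_left[symmetric] sum_distrib_right[symmetric])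
    also have "\<dots> = of_nat d ^ num_cycles n (?\<gamma> \<circ> \<pi>) *
        (of_nat l ^ num_cycles n (?\<alpha> T \<circ> \<pi>) * of_nat d ^ num_cycles n \<pi>)"
      by (simp only: sum_constant_on_cycles \<pi> permutes_compose[OF \<pi> long_cycle_permutes]
          permutes_compose[OF \<pi> ends_cycle_permutes[OF n T]])
    finally show "(\<Sum>b\<in>?PD. \<Sum>i\<in>?PL. \<Sum>x\<in>?PD. of_bool (\<forall>k\<in>?I. a b i x k = a' T b i x (\<pi> k)))
        = (of_nat l ^ num_cycles n (?\<alpha> T \<circ> \<pi>) * of_nat d ^ (num_cycles n \<pi> + num_cycles n (?\<gamma> \<circ> \<pi>)) :: complex)"
      by (simp add: power_add mult_ac)
  qed
  finally show ?thesis .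
qed

text \<open>The ratio is a power of \<open>1 / d\<close>. The convention \<open>0 ^ 0 = 1\<close>
  lets one limit cover both the surviving and the vanishing terms.\<close>

lemma tendsto_power_ratio:
  assumes "g \<le> Suc n"
  shows "(\<lambda>d. of_nat d ^ g / of_nat d ^ Suc n) \<longlonglongrightarrow> (of_bool (g = Suc n) :: complex)"
proof -
  have "(\<lambda>d. (1 / of_nat d :: complex) ^ (Suc n - g)) \<longlonglongrightarrow> 0 ^ (Suc n - g)"
    by (intro tendsto_power lim_1_over_n)
  moreover have "(0 :: complex) ^ (Suc n - g) = of_bool (g = Suc n)" using assms by (cases "g = Suc n") auto
  ultimately have lim: "(\<lambda>d. (1 / of_nat d :: complex) ^ (Suc n - g)) \<longlonglongrightarrow> of_bool (g = Suc n)"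
    by (simp only:)
  have "\<forall>\<^sub>F d in sequentially. (1 / of_nat d :: complex) ^ (Suc n - g) = of_nat d ^ g / of_nat d ^ Suc n"
    using eventually_gt_at_top[of 0]
  proof eventually_elim
    case (elim d)
    have "(of_nat d :: complex) ^ Suc n = of_nat d ^ (Suc n - g) * of_nat d ^ g"
      unfolding power_add[symmetric] using assms by simp
    then show ?case using elim by (simp add: power_one_over)
  qed
  then show ?thesis by (rule Lim_transform_eventually[OF lim])
qed

theorem theorem7p6:
  fixes n l :: nat
    and e :: "nat \<Rightarrow> complex vec"
    and M :: "nat \<Rightarrow> 'a measure"
    and G :: "nat \<Rightarrow> 'a \<Rightarrow> complex mat"
  assumes "n \<ge> 1" and "l \<ge> 1"
    and "orthonormal_basis l e"
    and "\<And>d. d \<ge> 1 \<Longrightarrow> prob_space (M d)"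
    and "\<And>d. d \<ge> 1 \<Longrightarrow> prob_space.ginibre (M d) (d * d) l (G d)"
  shows "(\<lambda>d. \<integral>\<omega>. 1 / of_nat d *
            mat_trace (((1 / of_nat d) \<cdot>\<^sub>m Z0_mat l e d (G d \<omega>)) *
                       ((1 / of_nat d) \<cdot>\<^sub>m Z_mat l e d (G d \<omega>)) ^\<^sub>m (n - 1)) \<partial>M d)
         \<longlonglongrightarrow> (of_nat (m_ST n l) :: complex)"
proof -
  let ?g = "\<lambda>\<pi>. num_cycles n \<pi> + num_cycles n (long_cycle n \<circ> \<pi>)"
  let ?w = "\<lambda>T \<pi>. of_nat l ^ num_cycles n (ends_cycle n T \<circ> \<pi>) :: complex"
  let ?E = "\<lambda>d. \<integral>\<omega>. 1 / of_nat d *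
            mat_trace (((1 / of_nat d) \<cdot>\<^sub>m Z0_mat l e d (G d \<omega>)) *
                       ((1 / of_nat d) \<cdot>\<^sub>m Z_mat l e d (G d \<omega>)) ^\<^sub>m (n - 1)) \<partial>M d"
  \<comment> \<open>The exponent \<open>Suc n\<close> collects the scaling of the \<open>n\<close>
    matrix factors and the normalisation of the trace.\<close>
  let ?E' = "\<lambda>d. \<Sum>T\<in>end_sets n. \<Sum>\<pi> | \<pi> permutes {1..n}. ?w T \<pi> * (of_nat d ^ ?g \<pi> / of_nat d ^ Suc n)"
  have "?E' \<longlonglongrightarrow> (\<Sum>T\<in>end_sets n. \<Sum>\<pi> | \<pi> permutes {1..n}. ?w T \<pi> * of_bool (?g \<pi> = Suc n))"
    by (intro tendsto_sum tendsto_mult tendsto_const tendsto_power_ratio num_cycles_add_le[OF assms(1)]) simp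
  also have "(\<Sum>T\<in>end_sets n. \<Sum>\<pi> | \<pi> permutes {1..n}. ?w T \<pi> * of_bool (?g \<pi> = Suc n)) = of_nat (m_ST n l)"
  proof -
    have "(\<Sum>\<pi> | \<pi> permutes {1..n}. ?w T \<pi> * of_bool (?g \<pi> = Suc n))
        = (\<Sum>\<pi> | \<pi> permutes {1..n} \<and> ?g \<pi> = Suc n. ?w T \<pi>)" for T
    proof -
      have "(\<Sum>\<pi> | \<pi> permutes {1..n}. ?w T \<pi> * of_bool (?g \<pi> = Suc n))
        = (\<Sum>\<pi> | \<pi> permutes {1..n}. if ?g \<pi> = Suc n then ?w T \<pi> else 0)" by (intro sum.cong) auto
      then show ?thesis
        using sum.inter_filter[of "{\<pi>. \<pi> permutes {1..n}}" "?w T" "\<lambda>\<pi>. ?g \<pi> = Suc n"]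
        by (simp add: finite_permutations)
    qed
    then show ?thesis unfolding m_ST_eq[OF assms(1)] by simp
  qed
  finally have lim: "?E' \<longlonglongrightarrow> of_nat (m_ST n l)" .
  \<comment> \<open>The random matrices are specified only from \<open>d = 1\<close> on, so the two
    sequences are compared eventually.\<close>
  have "\<forall>\<^sub>F d in sequentially. ?E' d = ?E d"
    using eventually_ge_at_top[of 1]
  proof eventually_elim
    case (elim d)
    interpret prob_space "M d" by (rule assms(4)[OF elim])
    have "?E d = 1 / of_nat d * ((1 / of_nat d) ^ n * (\<Sum>T\<in>end_sets n. \<Sum>\<pi> | \<pi> permutes {1..n}. ?w T \<pi> * of_nat d ^ ?g \<pi>))"
      using expectation_trace[OF assms(1,3) assms(5)[OF elim], of "1 / of_nat d"]
      by (simp only: integral_mult_right_zero)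
    also have "\<dots> = (\<Sum>T\<in>end_sets n. \<Sum>\<pi> | \<pi> permutes {1..n}. ?w T \<pi> * of_nat d ^ ?g \<pi>) / of_nat d ^ Suc n"
      by (simp only: power_one_over mult_1 times_divide_eq_left divide_divide_eq_left power_Suc2)
    also have "\<dots> = ?E' d" by (simp only: sum_divide_distrib times_divide_eq_right)
    finally show ?case by simp
  qed
  then show ?thesis by (rule Lim_transform_eventually[OF lim])
qed

end
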